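(* Let $g \colon \mathbb{R}^{+} \to \mathbb{R}^{+}$ be a continuous function such that $g(0)=0$, $g(s)>0$ for all $s>0$, $\lim_{s\to0^{+}} g(s)/s = 0$ and $\lim_{s\to+\infty} g(s)/s = 0$. Let $a \colon \mathbb{R} \to \mathbb{R}$ be a locally integrable periodic function of minimal period $T>0$ for which there exist $2m+1$ points (with $m\geq 1$) $\sigma_{1}<\tau_{1}<\ldots<\sigma_{m}<\tau_{m}<\sigma_{m+1}$, with $\sigma_{m+1}-\sigma_{1}=T$, such that, for $i=1,\ldots,m$, $a\succ0$ on $I^{+}_{i}:=[\sigma_{i},\tau_{i}]$ and $a\prec0$ on $I^{-}_{i}:=[\tau_{i},\sigma_{i+1}]$. For $\ell\in\mathbb{Z}$ set $I^{+}_{i,\ell}:=I^{+}_{i}+\ell T$. Then, for every constant $\rho>0$ there exists $\lambda^{*}=\lambda^{*}(\rho)>0$ such that for each $\lambda>\lambda^{*}$ there exist two constants $r,R$ with $0<r<\rho<R$ and $\mu^{*}(\lambda)=\mu^{*}(\lambda,r,R)>0$ such that for any $\mu>\mu^{*}(\lambda)$ the following holds: given any two-sided sequence $\mathcal{S}=(\mathcal{S}_{j})_{j\in\mathbb{Z}}$ in the alphabet $\{0,1,2\}$ which is not identically zero, there exists at least one positive solution $u(t)$, defined on $\mathbb{R}$, of $$u''+\bigl(\lambda a^{+}(t)-\mu a^{-}(t)\bigr)g(u)=0$$ such that, for all $i=1,\ldots,m$ and $\ell\in\mathbb{Z}$: \begin{itemize} \item $\max_{t\in I^{+}_{i,\ell}}u(t)<r$,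 if $\mathcal{S}_{j}=0$ for $j=i+\ell m$; \item $r<\max_{t\in I^{+}_{i,\ell}}u(t)<\rho$, if $\mathcal{S}_{j}=1$ for $j=i+\ell m$; \item $\rho<\max_{t\in I^{+}_{i,\ell}}u(t)<R$, if $\mathcal{S}_{j}=2$ for $j=i+\ell m$. \end{itemize}
   Context: $\mathbb{R}^{+}:=[0,+\infty)$; $a^{+}=\max\{a,0\}$ and $a^{-}=\max\{-a,0\}$. On a given interval, $w\succ0$ means that $w(t)\geq0$ for almost every $t$ and $w$ is not almost everywhere zero on that interval; $w\prec0$ means $-w\succ0$. Solutions are meant in the Carathéodory sense ($u$ is $C^{1}$ with $u'$ locally absolutely continuous and the equation holds almost everywhere); positive means $u(t)>0$ for all $t\in\mathbb{R}$. *)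

theory Defs
  imports "HOL-Analysis.Analysis"
begin

definition locally_integrable :: "(real \<Rightarrow> real) \<Rightarrow> bool" where
  "locally_integrable f \<longleftrightarrow> (\<forall>x y. f absolutely_integrable_on {x..y})"

definition has_minimal_period :: "(real \<Rightarrow> real) \<Rightarrow> real \<Rightarrow> bool" where
  "has_minimal_period f T \<longleftrightarrow>
     0 < T \<and> (\<forall>t. f (t + T) = f t) \<and>
     (\<forall>T'. 0 < T' \<and> (\<forall>t. f (t + T') = f t) \<longrightarrow> T \<le> T')"

text \<open>\<^term>\<open>pos_on w I\<close> is the relation $w \succ 0$ on $I$, and \<^term>\<open>neg_on w I\<close> is $w \prec 0$ on $I$.\<close>

definition pos_on :: "(real \<Rightarrow> real) \<Rightarrow> real set \<Rightarrow> bool" where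
  "pos_on w I \<longleftrightarrow>
     (AE t in lebesgue. t \<in> I \<longrightarrow> 0 \<le> w t) \<and> \<not> (AE t in lebesgue. t \<in> I \<longrightarrow> w t = 0)"

definition neg_on :: "(real \<Rightarrow> real) \<Rightarrow> real set \<Rightarrow> bool" where
  "neg_on w I \<longleftrightarrow> pos_on (\<lambda>t. - w t) I"

definition pos_part :: "(real \<Rightarrow> real) \<Rightarrow> real \<Rightarrow> real" where
  "pos_part a t = max (a t) 0"

definition neg_part :: "(real \<Rightarrow> real) \<Rightarrow> real \<Rightarrow> real" where
  "neg_part a t = max (- a t) 0"

text \<open>The usual epsilon-delta definition of absolute continuity.  A division \<open>\<D>\<close> of its own
  union is a finite family of non-overlapping nonempty compact intervals, and each \<open>K \<in> \<D>\<close> has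
  endpoints \<open>Inf K\<close> and \<open>Sup K\<close>.\<close>

definition abs_continuous_on :: "real set \<Rightarrow> (real \<Rightarrow> real) \<Rightarrow> bool" where
  "abs_continuous_on I f \<longleftrightarrow>
     (\<forall>\<epsilon>>0. \<exists>\<delta>>0. \<forall>\<D>. \<D> division_of \<Union>\<D> \<and> \<Union>\<D> \<subseteq> I \<and> (\<Sum>K\<in>\<D>. Sup K - Inf K) < \<delta> \<longrightarrow>
        (\<Sum>K\<in>\<D>. \<bar>f (Sup K) - f (Inf K)\<bar>) < \<epsilon>)"

definition locally_abs_continuous :: "(real \<Rightarrow> real) \<Rightarrow> bool" where
  "locally_abs_continuous f \<longleftrightarrow> (\<forall>x y. abs_continuous_on {x..y} f)"

text \<open>\<^term>\<open>caratheodory_solution F u\<close>: \<open>u\<close> is a solution on the whole real line, in the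
  Caratheodory sense, of $u'' + F(t,u) = 0$.\<close>

definition caratheodory_solution :: "(real \<Rightarrow> real \<Rightarrow> real) \<Rightarrow> (real \<Rightarrow> real) \<Rightarrow> bool" where
  "caratheodory_solution F u \<longleftrightarrow>
     u C1_differentiable_on UNIV \<and>
     locally_abs_continuous (deriv u) \<and>
     (AE t in lebesgue. deriv u differentiable (at t) \<and> deriv (deriv u) t + F t (u t) = 0)"

text \<open>Only applied to continuous \<open>u\<close> and nonempty compact \<open>I\<close>, where the supremum is attained.\<close>

definition max_on :: "real set \<Rightarrow> (real \<Rightarrow> real) \<Rightarrow> real" where
  "max_on I u = (SUP t\<in>I. u t)"

end

(* A shooting argument. On a positive block a solution is concave, on a negative block convex. For lam
   large a positive solution cannot have maximum comparable to rho on a positive block: it hits zero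
   within the block. For r small and R large the nonlinearity is weak compared to the size of the
   solution, so a solution entering from a negative block with maximum r or R leaves the positive
   block with nonnegative slope, and for mu large it explodes on the following negative block. Hence
   along a path of initial data on which the entry value of a positive block runs from 0 to R, the
   intermediate value theorem selects for each symbol a subpath with the prescribed maximum whose
   ends die and explode, respectively; its exit values again contain a path from 0 to R. Iterating
   over finitely many blocks needs neither uniqueness for initial value problems nor degree theory,
   since the weight is replaced by finitely many point masses. Refining the grid and moving the initial
   point to minus infinity gives the entire solution by the theorem of Arzela and Ascoli. *)
theory Submission
  imports Defs "HOL-Complex_Analysis.Great_Picard"
begin

text \<open>The weight of a block may sit close to its ends, where a concave solution can be close
  to zero. Each block is therefore cut into \<open>c\<close> equal parts, and lower bounds use only
  the mass off the two outer parts: there a nonnegative concave function with maximum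
  \<open>X\<close> is at least \<open>X / c\<close>. The grids have a multiple of \<open>c\<close>
  cells per block, so that all estimates depend on lengths and masses of blocks but not on the mesh.
  The constants follow the quantifiers. A lower bound of \<open>g\<close> on an interval around
  \<open>\<rho>\<close> fixes the bound for \<open>lam\<close>. Then \<open>lam\<close> fixes the
  smallness \<open>\<kappa>\<close> of \<open>g s / s\<close> at which a positive block is too weak
  to turn a solution around, \<open>\<kappa>\<close> fixes \<open>r\<close> and \<open>R\<close>,
  and these fix the bound for \<open>\<mu>\<close>. With \<open>g\<close> set to zero on the
  negative axis, a negative solution runs down a straight line and never returns. The sign at the
  end of a window thus controls the whole past, and nonnegativity needs no separate argument along
  the path of initial data.\<close>

subsection \<open>Absolutely continuous functions\<close>

text \<open>The bad points are covered in the sense of Vitali by intervals on which Henstock's lemma bounds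
  the total length.\<close>

lemma negligible_nondiff_indefinite_integral:
  fixes f :: "real \<Rightarrow> real"
  assumes f: "f integrable_on {a..b}" and e: "e > 0"
  defines "F \<equiv> \<lambda>t. integral {a..t} f"
  shows "negligible {x\<in>{a<..<b}. \<forall>d>0. \<exists>y\<in>{a<..<b}. 0 < \<bar>y - x\<bar> \<and> \<bar>y - x\<bar> < d \<and> \<bar>F y - F x - f x * (y - x)\<bar> > e * \<bar>y - x\<bar>}"
    (is "negligible ?B")
  unfolding negligible_outer_le
proof (intro allI impI)
  fix \<eta> :: real assume \<eta>: "\<eta> > 0"
  have e\<eta>: "0 < e * \<eta>" using e \<eta> by simp
  have f': "f integrable_on cbox a b" using f by simp
  obtain \<gamma> where \<gamma>: "gauge \<gamma>" 
    and hen: "\<And>p. \<lbrakk>p tagged_partial_division_of (cbox a b); \<gamma> fine p\<rbrakk> \<Longrightarrow>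
             sum (\<lambda>(x,k). norm(measure lborel k *\<^sub>R f x - integral k f)) p < e * \<eta>"
    by (rule Henstock_lemma[OF f' e\<eta>]) (rule that)
  define J :: "real \<times> real \<Rightarrow> real set" where "J = (\<lambda>(x,y). {min x y..max x y})"
  \<comment> \<open>A pair \<open>(x, y)\<close> in \<open>K\<close> is a tagged interval on which
    the increment of \<open>F\<close> misses \<open>f x * (y - x)\<close> by more than
    \<open>e\<close> times the length. Henstock's lemma with error \<open>e * \<eta>\<close>
    therefore bounds the total length of disjoint members of \<open>K\<close> by
    \<open>\<eta>\<close>.\<close>
  define K where "K = {(x,y). x \<in> {a<..<b} \<and> y \<in> {a<..<b} \<and> x \<noteq> y \<and> \<bar>F y - F x - f x * (y - x)\<bar> > e * \<bar>y - x\<bar> \<and> J (x,y) \<subseteq> \<gamma> x}"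
  define c :: "real \<times> real \<Rightarrow> real" where "c = (\<lambda>(x,y). (x+y)/2)"
  define r :: "real \<times> real \<Rightarrow> real" where "r = (\<lambda>(x,y). \<bar>y - x\<bar>/2)"
  have cb: "cball (c i) (r i) = J i" for i
    by (cases i) (auto simp: c_def r_def J_def cball_eq_atLeastAtMost min_def max_def field_simps abs_if)
  have key: "e * measure lborel (J (x,y)) \<le> norm (measure lborel (J (x,y)) *\<^sub>R f x - integral (J (x,y)) f)" if "(x,y) \<in> K" for x y
  proof -
    have xy: "x \<in> {a<..<b}" "y \<in> {a<..<b}" "\<bar>F y - F x - f x * (y - x)\<bar> > e * \<bar>y - x\<bar>"
      using that by (auto simp: K_def)
    have comb: "F v - F u = integral {u..v} f" if "a < u" "u \<le> v" "v < b" for u v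
    proof -
      have "f integrable_on {a..v}" using f that by (auto intro: integrable_on_subinterval)
      then have "integral {a..u} f + integral {u..v} f = integral {a..v} f"
        using that by (intro Henstock_Kurzweil_Integration.integral_combine) auto
      then show ?thesis unfolding F_def by simp
    qed
    show ?thesis
    proof (cases "x \<le> y")
      case True
      then have "J (x,y) = {x..y}" by (auto simp: J_def)
      then show ?thesis using xy comb[of x y] True by (simp add: algebra_simps abs_minus_commute)
    next
      case False
      then have "J (x,y) = {y..x}" by (auto simp: J_def)
      then show ?thesis using xy comb[of y x] False by (simp add: algebra_simps abs_minus_commute)
    qed
  qed
  have rpos: "0 < r i" if "i \<in> K" for i
    using that by (auto simp: K_def r_def)
  have cov: "\<exists>i. i \<in> K \<and> x \<in> cball (c i) (r i) \<and> r i < d" if x: "x \<in> ?B" and d: "0 < d" for x d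
  proof -
    have "x \<in> \<gamma> x" "open (\<gamma> x)" using \<gamma> by (auto simp: gauge_def)
    then obtain \<delta> where \<delta>: "\<delta> > 0" "ball x \<delta> \<subseteq> \<gamma> x" by (meson openE)
    have "0 < min \<delta> d" using \<delta> d by simp
    then obtain y where y: "y\<in>{a<..<b}" "0 < \<bar>y - x\<bar>" "\<bar>y - x\<bar> < min \<delta> d" "\<bar>F y - F x - f x * (y - x)\<bar> > e * \<bar>y - x\<bar>"
      using x unfolding mem_Collect_eq by blast
    have "J (x,y) \<subseteq> ball x \<delta>" using y by (auto simp: J_def dist_real_def)
    then have "(x,y) \<in> K" using x y \<delta> by (auto simp: K_def)
    moreover have "x \<in> J (x,y)" by (auto simp: J_def)
    moreover have "r (x,y) < d" using y by (auto simp: r_def)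
    ultimately show ?thesis using cb by blast
  qed
  obtain C where C: "countable C" "C \<subseteq> K"
     "pairwise (\<lambda>i j. disjnt (cball (c i) (r i)) (cball (c j) (r j))) C"
     "negligible(?B - (\<Union>i \<in> C. cball (c i) (r i)))"
    by (rule Vitali_covering_theorem_cballs[of K r ?B c, OF rpos cov]) (assumption | rule that)+
  have fin: "(\<Sum>i\<in>D. measure lebesgue (J i)) \<le> \<eta>" if D: "D \<subseteq> C" "finite D" for D
  proof -
    define p where "p = (\<lambda>(x,y). (x, J (x,y))) ` D"
    have inj: "inj_on (\<lambda>(x,y). (x, J (x,y))) D"
    proof (rule inj_onI, clarify)
      fix x y x' y'
      assume *: "(x,y) \<in> D" "(x',y') \<in> D" "J (x,y) = J (x',y')"
      have "x \<in> J (x,y)" by (auto simp: J_def)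
      then have "\<not> disjnt (J (x,y)) (J (x',y'))" using * by (auto simp: disjnt_def)
      then show "x = x' \<and> y = y'" using C(3) * D(1) unfolding cb pairwise_def by blast
    qed
    have tpd: "p tagged_partial_division_of (cbox a b)"
      unfolding tagged_partial_division_of_def
    proof (intro conjI allI impI)
      show "finite p" using D by (simp add: p_def)
    next
      fix x k assume "(x,k) \<in> p"
      then obtain y where y: "(x,y) \<in> D" "k = J (x,y)" by (auto simp: p_def)
      then have inK: "(x,y) \<in> K" using D C by auto
      show "x \<in> k" by (simp add: y J_def)
      show "k \<subseteq> cbox a b" using inK by (auto simp: y J_def K_def)
      show "\<exists>a b. k = cbox a b" unfolding y J_def by (simp flip: box_real(2)) blast
    next
      fix x k x' k' assume *: "(x,k) \<in> p \<and> (x',k') \<in> p \<and> (x,k) \<noteq> (x',k')"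
      then obtain y y' where y: "(x,y) \<in> D" "k = J (x,y)" and y': "(x',y') \<in> D" "k' = J (x',y')"
        by (auto simp: p_def)
      have "(x,y) \<noteq> (x',y')" using * y y' by auto
      then have "disjnt k k'" using C(3) D y y' unfolding cb pairwise_def by blast
      then show "interior k \<inter> interior k' = {}" unfolding disjnt_def using interior_subset by blast
    qed
    have fine: "\<gamma> fine p"
      unfolding fine_def using D C by (auto simp: p_def K_def)
    have "e * (\<Sum>i\<in>D. measure lebesgue (J i)) = (\<Sum>i\<in>D. e * measure lborel (J i))"
      by (auto simp: sum_distrib_left J_def split: prod.split intro!: sum.cong)
    also have "\<dots> \<le> (\<Sum>(x,y)\<in>D. norm (measure lborel (J (x,y)) *\<^sub>R f x - integral (J (x,y)) f))"
    proof (rule sum_mono)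
      fix i assume i: "i \<in> D"
      obtain x y where "i = (x,y)" by fastforce
      then show "e * measure lborel (J i) \<le> (case i of (x, y) \<Rightarrow> norm (measure lborel (J (x, y)) *\<^sub>R f x - integral (J (x, y)) f))"
        using key[of x y] i D(1) C(2) by auto
    qed
    also have "\<dots> = sum (\<lambda>(x,k). norm(measure lborel k *\<^sub>R f x - integral k f)) p"
      unfolding p_def by (subst sum.reindex[OF inj]) (auto simp: case_prod_beta intro!: sum.cong)
    also have "\<dots> < e * \<eta>" using hen[OF tpd fine] .
    finally show ?thesis using e by simp
  qed
  have meas: "J i \<in> lmeasurable" for i by (cases i) (simp add: J_def)
  have fin': "measure lebesgue (\<Union>i\<in>D. J i) \<le> \<eta>" if "D \<subseteq> C" "finite D" for D
    using measure_UNION_le[of D J lebesgue] fin[OF that] that(2) meas fmeasurableD order_trans by blast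
  have U: "(\<Union>i\<in>C. J i) \<in> lmeasurable" "measure lebesgue (\<Union>i\<in>C. J i) \<le> \<eta>"
    using fmeasurable_UN_bound[OF C(1) meas fin'] measure_UN_bound[OF C(1) meas fin'] by auto
  let ?N = "?B - (\<Union>i \<in> C. J i)"
  have N: "negligible ?N" using C(4) unfolding cb .
  show "\<exists>T. ?B \<subseteq> T \<and> T \<in> lmeasurable \<and> measure lebesgue T \<le> \<eta>"
  proof (intro exI conjI)
    show "?B \<subseteq> (\<Union>i\<in>C. J i) \<union> ?N" by blast
    show "(\<Union>i\<in>C. J i) \<union> ?N \<in> lmeasurable" using U N negligible_imp_measurable by blast
    show "measure lebesgue ((\<Union>i\<in>C. J i) \<union> ?N) \<le> \<eta>"
    proof -
      have N': "?N \<in> lmeasurable" "measure lebesgue ?N = 0"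
        using negligible_imp_measurable[OF N] negligible_imp_measure0[OF N] by auto
      have "measure lebesgue ((\<Union>i\<in>C. J i) \<union> ?N) \<le> measure lebesgue (\<Union>i\<in>C. J i) + measure lebesgue ?N"
        by (rule measure_Un_le[OF fmeasurableD[OF U(1)] fmeasurableD[OF N'(1)]])
      then show ?thesis using U(2) N'(2) by linarith
    qed
  qed
qed

text \<open>The derivative fails at \<open>x\<close> only if the linear estimate fails for one of
  the countably many tolerances \<open>inverse (Suc n)\<close>, and each of these exceptional sets
  is negligible.\<close>

lemma AE_has_derivative_indefinite_integral:
  fixes f :: "real \<Rightarrow> real"
  assumes f: "f integrable_on {a..b}"
  shows "AE x in lebesgue. x \<in> {a<..<b} \<longrightarrow> ((\<lambda>t. integral {a..t} f) has_real_derivative f x) (at x)"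
proof -
  define F where "F = (\<lambda>t. integral {a..t} f)"
  define B where "B e = {x\<in>{a<..<b}. \<forall>d>0. \<exists>y\<in>{a<..<b}. 0 < \<bar>y - x\<bar> \<and> \<bar>y - x\<bar> < d \<and> \<bar>F y - F x - f x * (y - x)\<bar> > e * \<bar>y - x\<bar>}" for e
  have "negligible (\<Union>n. B (inverse (real (Suc n))))"
    by (rule negligible_countable_Union) (use negligible_nondiff_indefinite_integral[OF f] in \<open>auto simp: B_def F_def\<close>)
  moreover have "(F has_real_derivative f x) (at x)" if x: "x \<in> {a<..<b}" "x \<notin> (\<Union>n. B (inverse (real (Suc n))))" for x
    unfolding has_field_derivative_def has_derivative_at_alt
  proof (intro conjI allI impI)
    show "bounded_linear ((*) (f x))" by (rule bounded_linear_mult_right)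
    fix e :: real assume "0 < e"
    then obtain n where n: "inverse (real (Suc n)) < e" using reals_Archimedean by blast
    have "x \<notin> B (inverse (real (Suc n)))" using x by blast
    then have "\<not> (\<forall>d>0. \<exists>y\<in>{a<..<b}. 0 < \<bar>y - x\<bar> \<and> \<bar>y - x\<bar> < d \<and> \<bar>F y - F x - f x * (y - x)\<bar> > inverse (real (Suc n)) * \<bar>y - x\<bar>)"
      using x(1) unfolding B_def by blast
    then obtain d where d: "d > 0" "\<And>y. y\<in>{a<..<b} \<Longrightarrow> 0 < \<bar>y - x\<bar> \<Longrightarrow> \<bar>y - x\<bar> < d \<Longrightarrow> \<bar>F y - F x - f x * (y - x)\<bar> \<le> inverse (real (Suc n)) * \<bar>y - x\<bar>"
      by (meson linorder_not_le)
    show "\<exists>d>0. \<forall>y. norm (y - x) < d \<longrightarrow> norm (F y - F x - f x * (y - x)) \<le> e * norm (y - x)"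
    proof (intro exI[of _ "min d (min (x - a) (b - x))"] conjI allI impI)
      show "0 < min d (min (x - a) (b - x))" using d x by auto
      fix y assume y: "norm (y - x) < min d (min (x - a) (b - x))"
      show "norm (F y - F x - f x * (y - x)) \<le> e * norm (y - x)"
      proof (cases "y = x")
        case False
        then have "\<bar>F y - F x - f x * (y - x)\<bar> \<le> inverse (real (Suc n)) * \<bar>y - x\<bar>"
          using y by (intro d(2)) auto
        also have "\<dots> \<le> e * \<bar>y - x\<bar>" using n by (intro mult_right_mono) auto
        finally show ?thesis by simp
      qed simp
    qed
  qed
  ultimately show ?thesis
    unfolding F_def[symmetric] eventually_ae_filter negligible_iff_null_sets
    by (intro bexI[of _ "\<Union>n. B (inverse (real (Suc n)))"]) auto
qed

text \<open>For a large truncation level \<open>n\<close> the excess of \<open>\<bar>f\<bar>\<close>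
  over \<open>n\<close> has integral below \<open>\<epsilon> / 2\<close>, on whatever intervals it
  is taken; the truncated part contributes at most \<open>n\<close> times the total length. Hence
  the choice \<open>\<epsilon> / (2 * (n + 1))\<close> for \<open>\<delta>\<close>.\<close>

lemma abs_continuous_on_indefinite_integral:
  fixes f F :: "real \<Rightarrow> real"
  assumes f: "f absolutely_integrable_on {a..b}"
    and F: "\<And>u v. a \<le> u \<Longrightarrow> u \<le> v \<Longrightarrow> v \<le> b \<Longrightarrow> F v - F u = integral {u..v} f"
  shows "abs_continuous_on {a..b} F"
  unfolding abs_continuous_on_def
proof (intro allI impI)
  fix \<epsilon> :: real assume \<epsilon>: "\<epsilon> > 0"
  define fn where "fn n t = min \<bar>f t\<bar> (real n)" for n t
  have af: "(\<lambda>t. \<bar>f t\<bar>) absolutely_integrable_on {a..b}"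
    using f absolutely_integrable_norm[of _ f] by (simp add: o_def)
  have fn: "fn n absolutely_integrable_on {a..b}" for n
    unfolding fn_def by (rule absolutely_integrable_min_1[OF af]) auto
  have i1: "(\<lambda>t. \<bar>f t\<bar>) integrable_on {a..b}" "\<And>n. fn n integrable_on {a..b}"
    using af fn set_lebesgue_integral_eq_integral(1) by blast+
  have "(\<lambda>n. integral {a..b} (fn n)) \<longlonglongrightarrow> integral {a..b} (\<lambda>t. \<bar>f t\<bar>)"
  proof (rule dominated_convergence(2)[OF i1(2) i1(1)])
    show "norm (fn n t) \<le> \<bar>f t\<bar>" for n t by (auto simp: fn_def)
    show "(\<lambda>n. fn n t) \<longlonglongrightarrow> \<bar>f t\<bar>" for t
    proof (rule tendsto_eventually)
      obtain m where "\<bar>f t\<bar> \<le> real m" using real_arch_simple by blast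
      then show "\<forall>\<^sub>F n in sequentially. fn n t = \<bar>f t\<bar>"
        unfolding eventually_sequentially fn_def by (intro exI[of _ m]) auto
    qed
  qed
  then obtain n where n: "\<bar>integral {a..b} (fn n) - integral {a..b} (\<lambda>t. \<bar>f t\<bar>)\<bar> < \<epsilon>/2"
    using \<epsilon> LIMSEQ_D[of _ _ "\<epsilon>/2"] by fastforce
  define h where "h t = \<bar>f t\<bar> - fn n t" for t
  have h: "h integrable_on {a..b}" "\<And>t. 0 \<le> h t" 
    unfolding h_def using integrable_diff[OF i1] by (simp_all add: fn_def)
  have hint: "integral {a..b} h < \<epsilon>/2"
    unfolding h_def integral_diff[OF i1] using n unfolding abs_less_iff by linarith
  show "\<exists>\<delta>>0. \<forall>\<D>. \<D> division_of \<Union>\<D> \<and> \<Union>\<D> \<subseteq> {a..b} \<and> (\<Sum>K\<in>\<D>. Sup K - Inf K) < \<delta> \<longrightarrow>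
        (\<Sum>K\<in>\<D>. \<bar>F (Sup K) - F (Inf K)\<bar>) < \<epsilon>"
  proof (intro exI[of _ "\<epsilon> / (2 * (real n + 1))"] conjI allI impI; (elim conjE)?)
    show "0 < \<epsilon> / (2 * (real n + 1))" using \<epsilon> by simp
    fix \<D> assume D: "\<D> division_of \<Union>\<D>" "\<Union>\<D> \<subseteq> {a..b}" "(\<Sum>K\<in>\<D>. Sup K - Inf K) < \<epsilon> / (2 * (real n + 1))"
    have K: "\<exists>u v. K = {u..v} \<and> a \<le> u \<and> u \<le> v \<and> v \<le> b" if KD: "K \<in> \<D>" for K
    proof -
      obtain u v where uv: "K = cbox u v" "K \<noteq> {}" using division_ofD(3,4)[OF D(1) KD] by blast
      moreover have "K \<subseteq> {a..b}" using D(2) KD by blast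
      ultimately show ?thesis by auto
    qed
    have "(\<Sum>K\<in>\<D>. \<bar>F (Sup K) - F (Inf K)\<bar>) \<le> (\<Sum>K\<in>\<D>. integral K h + real n * (Sup K - Inf K))"
    proof (rule sum_mono)
      fix K assume "K \<in> \<D>"
      then obtain u v where uv: "K = {u..v}" "a \<le> u" "u \<le> v" "v \<le> b" using K by blast
      have sub: "{u..v} \<subseteq> {a..b}" using uv by auto
      have io: "f integrable_on {u..v}" "(\<lambda>t. \<bar>f t\<bar>) integrable_on {u..v}" "h integrable_on {u..v}" "fn n integrable_on {u..v}"
        using integrable_on_subinterval[OF _ sub] i1 h f set_lebesgue_integral_eq_integral(1) by blast+
      have "\<bar>F v - F u\<bar> = norm (integral {u..v} f)" using F uv by simp
      also have "\<dots> \<le> integral {u..v} (\<lambda>t. \<bar>f t\<bar>)"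
        by (rule integral_norm_bound_integral) (use io in auto)
      also have "\<dots> = integral {u..v} (\<lambda>t. h t + fn n t)" by (simp add: h_def)
      also have "\<dots> = integral {u..v} h + integral {u..v} (fn n)" using io by (intro integral_add)
      also have "integral {u..v} (fn n) \<le> integral {u..v} (\<lambda>t. real n)"
        by (rule integral_le) (use io in \<open>auto simp: fn_def\<close>)
      also have "\<dots> = real n * (v - u)" using uv by simp
      finally show "\<bar>F (Sup K) - F (Inf K)\<bar> \<le> integral K h + real n * (Sup K - Inf K)"
        using uv by simp
    qed
    also have "\<dots> = (\<Sum>K\<in>\<D>. integral K h) + real n * (\<Sum>K\<in>\<D>. Sup K - Inf K)"
      by (simp add: sum.distrib sum_distrib_left)
    also have "(\<Sum>K\<in>\<D>. integral K h) = integral (\<Union>\<D>) h"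
      by (rule integral_combine_division_topdown[symmetric, OF _ D(1)])
         (use D h in \<open>auto intro: integrable_on_subdivision\<close>)
    also have "\<dots> \<le> integral {a..b} h"
      by (rule integral_subset_le) (use D h in \<open>auto intro: integrable_on_subdivision\<close>)
    also have "real n * (\<Sum>K\<in>\<D>. Sup K - Inf K) \<le> real n * (\<epsilon> / (2 * (real n + 1)))"
      using D(3) by (intro mult_left_mono) auto
    also have "\<dots> < \<epsilon>/2" using \<epsilon> by (simp add: field_simps)
    finally show "(\<Sum>K\<in>\<D>. \<bar>F (Sup K) - F (Inf K)\<bar>) < \<epsilon>" using hint by linarith
  qed
qed

subsection \<open>Concave and convex blocks of a kicked sequence\<close>

text \<open>\<open>u j - u i\<close> is \<open>D\<close> times the sum of the slopes at
  \<open>i, ..., j - 1\<close>, all of which lie between \<open>y j\<close> and \<open>y i\<close>.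
  These are the chord inequalities of a concave function; the common cell length \<open>D\<close>
  turns distances into numbers of cells.\<close>

lemma concave_chord:
  fixes u y :: "nat \<Rightarrow> real"
  assumes u: "\<And>p. p < N \<Longrightarrow> u (Suc p) = u p + D * y p" and D: "0 \<le> D"
    and y: "\<And>p. p < N \<Longrightarrow> y (Suc p) \<le> y p"
    and ij: "i \<le> j" "j \<le> N"
  shows "u j - u i \<le> real (j - i) * D * y i" "real (j - i) * D * y j \<le> u j - u i" "y j \<le> y i"
proof -
  have "u j - u i \<le> real (j - i) * D * y i \<and> real (j - i) * D * y j \<le> u j - u i \<and> y j \<le> y i"
    using ij
  proof (induction j rule: dec_induct)
    case (step j)
    have "D * y j \<le> D * y i" using step D mult_left_mono[of "y j" "y i" D] by auto
    moreover have *: "D * y (Suc j) \<le> D * y j" using step y[of j] D mult_left_mono[of "y (Suc j)" "y j" D] by auto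
    moreover have "real (j - i) * (D * y (Suc j)) \<le> real (j - i) * (D * y j)"
      by (rule mult_left_mono[OF *]) simp
    ultimately show ?case using step u[of j] y[of j] by (auto simp: Suc_diff_le algebra_simps)
  qed auto
  then show "u j - u i \<le> real (j - i) * D * y i" "real (j - i) * D * y j \<le> u j - u i" "y j \<le> y i"
    by auto
qed

lemma convex_chord:
  fixes u y :: "nat \<Rightarrow> real"
  assumes u: "\<And>p. p < N \<Longrightarrow> u (Suc p) = u p + D * y p" and D: "0 \<le> D"
    and y: "\<And>p. p < N \<Longrightarrow> y p \<le> y (Suc p)"
    and ij: "i \<le> j" "j \<le> N"
  shows "real (j - i) * D * y i \<le> u j - u i" "u j - u i \<le> real (j - i) * D * y j" "y i \<le> y j"
  using concave_chord[of N "\<lambda>p. - u p" D "\<lambda>p. - y p" i j] assms by auto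

lemma slope_telescope:
  fixes y w z :: "nat \<Rightarrow> real"
  assumes "\<And>p. p < N \<Longrightarrow> y (Suc p) = y p + w p * z p" "i \<le> j" "j \<le> N"
  shows "y j = y i + (\<Sum>p=i..<j. w p * z p)"
  using assms(2,3) by (induction j rule: dec_induct) (use assms(1) in auto)

lemma sum_kicks_ge:
  fixes w z :: "nat \<Rightarrow> real"
  assumes "\<And>p. p \<in> I \<Longrightarrow> 0 \<le> w p" "\<And>p. p \<in> I \<Longrightarrow> \<gamma> \<le> z p" "0 \<le> \<gamma>" "K \<le> sum w I"
  shows "K * \<gamma> \<le> (\<Sum>p\<in>I. w p * z p)"
proof -
  have "K * \<gamma> \<le> sum w I * \<gamma>" using assms by (intro mult_right_mono)
  also have "\<dots> = (\<Sum>p\<in>I. w p * \<gamma>)" by (rule sum_distrib_right)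
  also have "\<dots> \<le> (\<Sum>p\<in>I. w p * z p)" using assms by (intro sum_mono mult_left_mono) auto
  finally show ?thesis .
qed

text \<open>For \<open>K\<close> large this excludes a nonnegative solution with maximum \<open>X\<close> on a positive block.\<close>

lemma concave_block_bound:
  fixes u y w :: "nat \<Rightarrow> real"
  assumes u: "\<And>p. p < N \<Longrightarrow> u (Suc p) = u p + D * y p" and D: "0 < D"
    and y: "\<And>p. p < N \<Longrightarrow> y (Suc p) = y p - w p * g (u (Suc p))"
    and w: "\<And>p. p < N \<Longrightarrow> 0 \<le> w p" and g: "\<And>x. 0 \<le> g x"
    and N: "N = c * n" "0 < n" "2 \<le> c"
    and u0: "\<And>p. p \<le> N \<Longrightarrow> 0 \<le> u p"
    and uX: "\<And>p. p \<le> N \<Longrightarrow> u p \<le> X" and ps: "ps \<le> N" "u ps = X"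
    and \<gamma>: "0 \<le> \<gamma>" "\<And>x. X / real c \<le> x \<Longrightarrow> x \<le> X \<Longrightarrow> \<gamma> \<le> g x"
    and K: "K \<le> (\<Sum>p=n..<N-n. w p)"
  shows "real n * D * K * \<gamma> \<le> 2 * X"
proof -
  have ym: "y (Suc p) \<le> y p" if "p < N" for p using y[OF that] w[OF that] g[of "u (Suc p)"] by simp
  note ch = concave_chord[of N u D y, OF u less_imp_le[OF D] ym]
  have X0: "0 \<le> X" using u0 ps by metis
  have nN: "n \<le> N - n" "N - n \<le> N" "n \<le> N"
  proof -
    have "2 * n \<le> N" unfolding N(1) using N by (intro mult_right_mono) auto
    then show "n \<le> N - n" "N - n \<le> N" "n \<le> N" by auto
  qed
  have cpos: "0 < real c" using N by auto
  \<comment> \<open>\<open>u\<close> lies above the chords from its maximum to the nonnegative ends.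
    A core point is at least \<open>n\<close> of the \<open>N = c * n\<close> cells away from either
    end, which leaves \<open>X * n / N = X / c\<close>.\<close>
  have low: "X / real c \<le> u p" if p: "n \<le> p" "p \<le> N - n" for p
  proof -
    have pN: "p \<le> N" using p nN by auto
    have main: "real n * X \<le> real N * u p"
    proof (cases "p \<le> ps")
      case True
      have a: "real p * D * y p \<le> u p - u 0" using ch(2)[of 0 p] pN by simp
      have b: "X - u p \<le> real (ps - p) * D * y p" using ch(1)[of p ps] True ps by simp
      have "real p * (X - u p) \<le> real p * (real (ps - p) * D * y p)" using b by (intro mult_left_mono) auto
      also have "\<dots> = real (ps - p) * (real p * D * y p)" by simp
      also have "\<dots> \<le> real (ps - p) * (u p - u 0)" using a by (intro mult_left_mono) auto
      also have "\<dots> \<le> real (ps - p) * u p" using u0[of 0] by (intro mult_left_mono) auto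
      finally have "real p * X \<le> real ps * u p" using True by (simp add: of_nat_diff algebra_simps)
      moreover have "real n * X \<le> real p * X" using p X0 by (intro mult_right_mono) auto
      moreover have "real ps * u p \<le> real N * u p" using ps u0[OF pN] by (intro mult_right_mono) auto
      ultimately show ?thesis by linarith
    next
      case False
      have a: "real (p - ps) * D * y p \<le> u p - X" using ch(2)[of ps p] pN False ps by simp
      have b: "u N - u p \<le> real (N - p) * D * y p" using ch(1)[of p N] pN by simp
      have "real (p - ps) * (- u p) \<le> real (p - ps) * (u N - u p)" using u0[of N] by (intro mult_left_mono) auto
      also have "\<dots> \<le> real (p - ps) * (real (N - p) * D * y p)" using b by (intro mult_left_mono) auto
      also have "\<dots> = real (N - p) * (real (p - ps) * D * y p)" by simp
      also have "\<dots> \<le> real (N - p) * (u p - X)" using a by (intro mult_left_mono) auto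
      finally have "real (N - p) * X \<le> real (N - ps) * u p" using False pN ps by (simp add: of_nat_diff algebra_simps)
      moreover have "real n * X \<le> real (N - p) * X" using p X0 nN by (intro mult_right_mono) auto
      moreover have "real (N - ps) * u p \<le> real N * u p" using ps u0[OF pN] by (intro mult_right_mono) auto
      ultimately show ?thesis by linarith
    qed
    then have "real n * X \<le> real n * (real c * u p)" using N by (simp add: mult_ac)
    then have "X \<le> real c * u p" using N by simp
    then show ?thesis using cpos by (simp add: field_simps)
  qed
  \<comment> \<open>Over the first \<open>n\<close> cells \<open>u\<close> gains at most
    \<open>X\<close>, over the last \<open>n\<close> cells it loses at most \<open>X\<close>. So the
    slope is at most \<open>X / (n * D)\<close> where the core begins and at least
    \<open>- X / (n * D)\<close> where it ends, while the core kicks lower it by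
    \<open>K * \<gamma>\<close>.\<close>
  have "real n * D * y n \<le> u n - u 0" using ch(2)[of 0 n] nN by simp
  then have yn: "real n * D * y n \<le> X" using uX[of n] u0[of 0] nN by linarith
  have tel: "y (N - n) = y n + (\<Sum>p=n..<N-n. (- w p) * g (u (Suc p)))"
    by (rule slope_telescope[of N]) (use y nN in auto)
  have "K * \<gamma> \<le> (\<Sum>p=n..<N-n. w p * g (u (Suc p)))"
    by (rule sum_kicks_ge) (use w \<gamma> K low uX in auto)
  then have "y (N - n) \<le> y n - K * \<gamma>" unfolding tel by (simp add: sum_negf)
  then have "real n * D * y (N - n) \<le> real n * D * (y n - K * \<gamma>)" using D by (intro mult_left_mono) auto
  moreover have "u N - u (N - n) \<le> real n * D * y (N - n)" using ch(1)[of "N-n" N] nN by simp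
  moreover have "0 \<le> u N" "u (N - n) \<le> X" using u0 uX nN by auto
  ultimately show ?thesis using yn by (simp add: algebra_simps)
qed

text \<open>Mirror image of the concave bound. By convexity the ends keep \<open>u\<close> below
  \<open>R\<close>, so the two margins of \<open>n\<close> cells confine the slopes at the ends of
  the core to \<open>[- R / (n * D), R / (n * D)]\<close>. If \<open>u\<close> stayed above
  \<open>\<delta>\<close>, the core kicks would raise the slope by more than this interval
  allows.\<close>

lemma convex_block_dip:
  fixes u y w :: "nat \<Rightarrow> real"
  assumes u: "\<And>p. p < N \<Longrightarrow> u (Suc p) = u p + D * y p" and D: "0 < D"
    and y: "\<And>p. p < N \<Longrightarrow> y (Suc p) = y p + w p * g (u (Suc p))"
    and w: "\<And>p. p < N \<Longrightarrow> 0 \<le> w p" and g: "\<And>x. 0 \<le> g x"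
    and N: "N = c * n" "0 < n" "2 \<le> c"
    and u0: "\<And>p. p \<le> N \<Longrightarrow> 0 \<le> u p"
    and uR: "u 0 \<le> R" "u N \<le> R"
    and \<gamma>: "0 \<le> \<gamma>" "\<And>x. \<delta> \<le> x \<Longrightarrow> x \<le> R \<Longrightarrow> \<gamma> \<le> g x"
    and K: "K \<le> (\<Sum>p=n..<N-n. w p)" and big: "2 * R < real n * D * K * \<gamma>"
  shows "\<exists>p\<le>N. u p \<le> \<delta>"
proof (rule ccontr)
  assume "\<not> ?thesis"
  then have low: "\<delta> \<le> u p" if "p \<le> N" for p using that by force
  have ym: "y p \<le> y (Suc p)" if "p < N" for p using y[OF that] w[OF that] g[of "u (Suc p)"] by simp
  note ch = convex_chord[of N u D y, OF u less_imp_le[OF D] ym]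
  have nN: "n \<le> N - n" "N - n \<le> N" "n \<le> N"
  proof -
    have "2 * n \<le> N" unfolding N(1) using N by (intro mult_right_mono) auto
    then show "n \<le> N - n" "N - n \<le> N" "n \<le> N" by auto
  qed
  have up: "u p \<le> R" if p: "p \<le> N" for p
  proof (cases "y p \<le> 0")
    case True
    have "u p - u 0 \<le> real p * D * y p" using ch(2)[of 0 p] p by simp
    also have "\<dots> \<le> 0" using True D by (intro mult_nonneg_nonpos) auto
    finally show ?thesis using uR by simp
  next
    case False
    have "0 \<le> real (N - p) * D * y p" using False D by simp
    also have "\<dots> \<le> u N - u p" using ch(1)[of p N] p by simp
    finally show ?thesis using uR by simp
  qed
  have "u n - u 0 \<le> real n * D * y n" using ch(2)[of 0 n] nN by simp
  then have yn: "- R \<le> real n * D * y n" using u0[of n] nN uR by linarith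
  have tel: "y (N - n) = y n + (\<Sum>p=n..<N-n. w p * g (u (Suc p)))"
    by (rule slope_telescope[of N]) (use y nN in auto)
  have "K * \<gamma> \<le> (\<Sum>p=n..<N-n. w p * g (u (Suc p)))"
    by (rule sum_kicks_ge) (use w \<gamma> K low up in auto)
  then have "y n + K * \<gamma> \<le> y (N - n)" unfolding tel by simp
  then have "real n * D * (y n + K * \<gamma>) \<le> real n * D * y (N - n)" using D by (intro mult_left_mono) auto
  moreover have "real n * D * y (N - n) \<le> u N - u (N - n)" using ch(1)[of "N-n" N] nN by simp
  moreover have "0 \<le> u (N - n)" using u0 nN by auto
  ultimately show False using yn big uR by (simp add: algebra_simps)
qed

text \<open>After the dip no slope exceeds the final one. The past of a solution is thereby reduced
  to one inequality between height and slope on entering a positive block, which is the hypothesis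
  \<open>start\<close> of \<open>concave_block_pass\<close>.\<close>

lemma convex_block_end:
  fixes u y :: "nat \<Rightarrow> real"
  assumes u: "\<And>p. p < N \<Longrightarrow> u (Suc p) = u p + D * y p" and D: "0 < D"
    and y: "\<And>p. p < N \<Longrightarrow> y p \<le> y (Suc p)" and L: "real N * D \<le> L"
    and p: "p \<le> N" "u p \<le> \<delta>"
  shows "u N \<le> \<delta> + L * max 0 (y N)"
proof -
  have "u N - u p \<le> real (N - p) * D * y N" using convex_chord(2)[of N u D y p N] assms by simp
  also have "\<dots> \<le> real (N - p) * D * max 0 (y N)" using D by (intro mult_left_mono) auto
  also have "\<dots> \<le> real N * D * max 0 (y N)" using D by (intro mult_right_mono) auto
  also have "\<dots> \<le> L * max 0 (y N)" using L by (intro mult_right_mono) auto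
  finally show ?thesis using p by simp
qed

text \<open>A maximum \<open>Q\<close> at which \<open>g\<close> is small compared to \<open>Q\<close> can only be reached with a slope that
  the block is too weak to turn around.\<close>

lemma concave_block_pass:
  fixes u y w :: "nat \<Rightarrow> real"
  assumes u: "\<And>p. p < N \<Longrightarrow> u (Suc p) = u p + D * y p" and D: "0 < D"
    and y: "\<And>p. p < N \<Longrightarrow> y (Suc p) = y p - w p * g (u (Suc p))"
    and w: "\<And>p. p < N \<Longrightarrow> 0 \<le> w p" and g: "\<And>x. 0 \<le> g x"
    and L: "real N * D \<le> L" "0 < L"
    and start: "u 0 \<le> \<delta> + L * max 0 (y 0)"
    and Q: "0 < Q" "2 * \<delta> \<le> Q" "\<And>p. p \<le> N \<Longrightarrow> u p \<le> Q" "ps \<le> N" "u ps = Q"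
    and K: "(\<Sum>p<N. w p) \<le> K" and \<kappa>: "\<And>x. x \<le> Q \<Longrightarrow> g x \<le> \<kappa> * Q" "0 \<le> \<kappa>" "4 * L * K * \<kappa> < 1"
  shows "u N = Q" "0 < y N"
proof -
  have ym: "y (Suc p) \<le> y p" if "p < N" for p using y[OF that] w[OF that] g[of "u (Suc p)"] by simp
  note ch = concave_chord[of N u D y, OF u less_imp_le[OF D] ym]
  have "Q - u 0 \<le> real ps * D * y 0" using ch(1)[of 0 ps] Q by simp
  also have "\<dots> \<le> real ps * D * max 0 (y 0)" using D by (intro mult_left_mono) auto
  also have "\<dots> \<le> real N * D * max 0 (y 0)" using D Q by (intro mult_right_mono) auto
  also have "\<dots> \<le> L * max 0 (y 0)" using L by (intro mult_right_mono) auto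
  \<comment> \<open>Both \<open>u 0 - \<delta>\<close> and \<open>Q - u 0\<close> are at most
    \<open>L * max 0 (y 0)\<close>, and \<open>\<delta>\<close> is at most \<open>Q / 2\<close>;
    hence the factor 4.\<close>
  finally have "Q \<le> 4 * L * max 0 (y 0)" using start Q by linarith
  then have y0: "Q \<le> 4 * L * y 0" using Q L by (cases "y 0 \<le> 0") (simp_all add: max_absorb1 max_absorb2)
  have tel: "y N = y 0 + (\<Sum>p=0..<N. (- w p) * g (u (Suc p)))"
    by (rule slope_telescope[of N]) (use y in auto)
  have "(\<Sum>p=0..<N. w p * g (u (Suc p))) \<le> (\<Sum>p=0..<N. w p * (\<kappa> * Q))"
    using w Q \<kappa> by (intro sum_mono mult_left_mono) auto
  also have "\<dots> = (\<Sum>p<N. w p) * (\<kappa> * Q)" by (simp add: sum_distrib_right atLeast0LessThan)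
  also have "\<dots> \<le> K * (\<kappa> * Q)" using K \<kappa> Q by (intro mult_right_mono) auto
  finally have "y 0 - K * (\<kappa> * Q) \<le> y N" unfolding tel by (simp add: sum_negf)
  then have "4 * L * (y 0 - K * (\<kappa> * Q)) \<le> 4 * L * y N" using L by (intro mult_left_mono) auto
  moreover have "4 * L * K * \<kappa> * Q < 1 * Q" using \<kappa> Q by (intro mult_strict_right_mono) auto
  ultimately have "0 < 4 * L * y N" using y0 by (simp add: algebra_simps)
  then show yN: "0 < y N" using L by (simp add: zero_less_mult_iff)
  have "0 \<le> real (N - ps) * D * y N" using yN D by simp
  also have "\<dots> \<le> u N - u ps" using ch(2)[of ps N] Q by simp
  finally show "u N = Q" using Q(3)[of N] Q(5) by linarith
qed

text \<open>The mean slope over a block of length at least \<open>l\<close> has modulus at most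
  \<open>R / l\<close>, so some slope is at most \<open>R / l\<close> and some is at least
  \<open>- R / l\<close>; all kicks together change the slope by at most \<open>K * G\<close>. The
  bound does not involve the mesh, which is what equicontinuity under refinement requires.\<close>

lemma block_slope_bound:
  fixes u y w :: "nat \<Rightarrow> real"
  assumes u: "\<And>p. p < N \<Longrightarrow> u (Suc p) = u p + D * y p" and D: "0 < D" and N: "0 < N"
    and y: "\<And>p. p < N \<Longrightarrow> y (Suc p) = y p + w p * g (u (Suc p))"
    and b: "\<And>p. p \<le> N \<Longrightarrow> 0 \<le> u p" "\<And>p. p \<le> N \<Longrightarrow> u p \<le> R"
    and l: "0 < l" "l \<le> real N * D" and K: "(\<Sum>p<N. \<bar>w p\<bar>) \<le> K"
    and G: "0 \<le> G" "\<And>x. 0 \<le> x \<Longrightarrow> x \<le> R \<Longrightarrow> \<bar>g x\<bar> \<le> G"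
    and p: "p \<le> N"
  shows "\<bar>y p\<bar> \<le> R / l + K * G"
proof -
  have R: "0 \<le> R" using b[of 0] by simp
  have vary: "\<bar>y j - y i\<bar> \<le> K * G" if "i \<le> j" "j \<le> N" for i j
  proof -
    have "\<bar>y j - y i\<bar> = \<bar>\<Sum>q=i..<j. w q * g (u (Suc q))\<bar>"
      using slope_telescope[of N y w "\<lambda>q. g (u (Suc q))" i j] y that by simp
    also have "\<dots> \<le> (\<Sum>q=i..<j. \<bar>w q * g (u (Suc q))\<bar>)" by (rule sum_abs)
    also have "\<dots> \<le> (\<Sum>q=i..<j. \<bar>w q\<bar> * G)"
      using that b G by (intro sum_mono) (auto simp: abs_mult intro!: mult_left_mono)
    also have "\<dots> = (\<Sum>q=i..<j. \<bar>w q\<bar>) * G" by (rule sum_distrib_right[symmetric])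
    also have "\<dots> \<le> (\<Sum>q<N. \<bar>w q\<bar>) * G"
      using that G by (intro mult_right_mono sum_mono2) auto
    also have "\<dots> \<le> K * G" using K G by (intro mult_right_mono)
    finally show ?thesis .
  qed
  then have vary': "\<bar>y j - y i\<bar> \<le> K * G" if "i \<le> N" "j \<le> N" for i j
    using vary[of i j] vary[of j i] that by (cases "i \<le> j") (auto simp: abs_minus_commute)
  have tel: "u N - u 0 = (\<Sum>q<N. D * y q)"
    using slope_telescope[of N u "\<lambda>_. D" y 0 N] u by (simp add: atLeast0LessThan)
  have bd: "R / l * (real N * D) \<ge> R"
    using R l mult_left_mono[OF l(2) R] by (simp add: field_simps)
  have "\<exists>q<N. y q \<le> R / l"
  proof (rule ccontr)
    assume "\<not> ?thesis"
    then have "(\<Sum>q<N. D * (R / l)) < (\<Sum>q<N. D * y q)"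
      using D N by (intro sum_strict_mono mult_strict_left_mono) auto
    then show False using tel b[of N] b[of 0] bd by (simp add: algebra_simps)
  qed
  moreover have "\<exists>q<N. - (R / l) \<le> y q"
  proof (rule ccontr)
    assume "\<not> ?thesis"
    then have "(\<Sum>q<N. D * y q) < (\<Sum>q<N. D * (- (R / l)))"
      using D N by (intro sum_strict_mono mult_strict_left_mono) auto
    then show False using tel b[of N] b[of 0] bd by (simp add: algebra_simps)
  qed
  ultimately obtain q q' where "q < N" "y q \<le> R / l" "q' < N" "- (R / l) \<le> y q'" by blast
  then show ?thesis using vary'[of q p] vary'[of q' p] p by (auto simp: abs_le_iff)
qed

subsection \<open>Shooting\<close>

text \<open>Take the first parameter at which \<open>f\<close> equals \<open>h\<close> and, before
  it, the last one at which \<open>f\<close> equals \<open>l\<close>; between the two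
  \<open>f\<close> cannot leave \<open>[l, h]\<close>. Segments replace intervals because
  \<open>p\<close> may lie on either side of \<open>q\<close>, and code 1 exchanges the
  ends.\<close>

lemma IVT_subsegment:
  fixes f :: "real \<Rightarrow> real"
  assumes f: "continuous_on (closed_segment p q) f" and pq: "f p \<le> l" "l \<le> h" "h \<le> f q"
  obtains p' q' where "closed_segment p' q' \<subseteq> closed_segment p q" "f p' = l" "f q' = h"
    "\<And>x. x \<in> closed_segment p' q' \<Longrightarrow> l \<le> f x \<and> f x \<le> h"
proof -
  define \<phi> where "\<phi> t = f (linepath p q t)" for t
  have \<phi>: "continuous_on {0..1} \<phi>"
    unfolding \<phi>_def
    by (rule continuous_on_compose2[OF f]) (auto intro!: continuous_intros simp: linepath_in_path)
  have ends: "\<phi> 0 = f p" "\<phi> 1 = f q" by (simp_all add: \<phi>_def linepath_def)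
  have closed: "closed {t\<in>{a..b}. \<phi> t = v}" if "{a..b} \<subseteq> {0..1}" for a b v
    by (rule continuous_closed_preimage_constant[OF continuous_on_subset[OF \<phi> that]]) auto
  define B where "B = {t\<in>{0..1}. \<phi> t = h}"
  obtain t where "0 \<le> t" "t \<le> 1" "\<phi> t = h"
    using IVT'[of \<phi> 0 h 1] \<phi> ends pq by auto
  then have "B \<noteq> {}" by (auto simp: B_def)
  moreover have "compact B" unfolding B_def
    using closed[of 0 1 h] by (auto simp: compact_eq_bounded_closed intro: bounded_subset[of "{0..1::real}"])
  ultimately obtain b where b: "b \<in> B" "\<And>t. t \<in> B \<Longrightarrow> b \<le> t"
    using compact_attains_inf by metis
  define A where "A = {t\<in>{0..b}. \<phi> t = l}"
  have b01: "0 \<le> b" "b \<le> 1" "\<phi> b = h" using b by (auto simp: B_def)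
  have \<phi>b: "continuous_on {0..b} \<phi>" by (rule continuous_on_subset[OF \<phi>]) (use b01 in auto)
  obtain t where "0 \<le> t" "t \<le> b" "\<phi> t = l"
    using IVT'[of \<phi> 0 l b] \<phi>b ends pq b01 by auto
  then have "A \<noteq> {}" by (auto simp: A_def)
  moreover have "compact A" unfolding A_def
    using closed[of 0 b l] b01 by (auto simp: compact_eq_bounded_closed intro: bounded_subset[of "{0..1::real}"])
  ultimately obtain a where a: "a \<in> A" "\<And>t. t \<in> A \<Longrightarrow> t \<le> a"
    using compact_attains_sup by metis
  have ab: "0 \<le> a" "a \<le> b" "\<phi> a = l" using a by (auto simp: A_def)
  have le_h: "\<phi> t \<le> h" if t: "a \<le> t" "t \<le> b" for t
  proof (rule ccontr)
    assume "\<not> ?thesis"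
    moreover have "continuous_on {a..t} \<phi>" by (rule continuous_on_subset[OF \<phi>]) (use ab b01 t in auto)
    ultimately obtain x where x: "a \<le> x" "x \<le> t" "\<phi> x = h" using IVT'[of \<phi> a h t] ab t pq by auto
    then have "b \<le> x" using b(2)[of x] ab b01 t by (auto simp: B_def)
    then have "x = t" "t = b" using x t by auto
    then show False using \<open>\<not> \<phi> t \<le> h\<close> b01 by simp
  qed
  have ge_l: "l \<le> \<phi> t" if t: "a \<le> t" "t \<le> b" for t
  proof (rule ccontr)
    assume "\<not> ?thesis"
    moreover have "continuous_on {t..b} \<phi>" by (rule continuous_on_subset[OF \<phi>]) (use ab b01 t in auto)
    ultimately obtain x where x: "t \<le> x" "x \<le> b" "\<phi> x = l" using IVT'[of \<phi> t l b] ab b01 t pq by auto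
    then have "x \<le> a" using a(2)[of x] ab b01 t by (auto simp: A_def)
    then have "x = t" "t = a" using x t by auto
    then show False using \<open>\<not> l \<le> \<phi> t\<close> ab by simp
  qed
  have sub: "\<exists>t\<in>{a..b}. x = linepath p q t" if x: "x \<in> closed_segment (linepath p q a) (linepath p q b)" for x
  proof -
    obtain v where v: "0 \<le> v" "v \<le> 1" "x = (1 - v) *\<^sub>R linepath p q a + v *\<^sub>R linepath p q b"
      using x[unfolded in_segment(1)] by blast
    have "x = linepath p q ((1 - v) * a + v * b)"
      unfolding v(3) linepath_def real_scaleR_def by algebra
    moreover have "(1 - v) * a + v * b \<in> {a..b}"
      using mult_left_mono[OF ab(2) v(1)] mult_left_mono[OF ab(2), of "1 - v"] v(2)
      by (simp add: left_diff_distrib)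
    ultimately show ?thesis by blast
  qed
  show thesis
  proof (rule that[of "linepath p q a" "linepath p q b"])
    show "closed_segment (linepath p q a) (linepath p q b) \<subseteq> closed_segment p q"
    proof
      fix x assume "x \<in> closed_segment (linepath p q a) (linepath p q b)"
      then obtain t where "t \<in> {a..b}" "x = linepath p q t" using sub by blast
      then show "x \<in> closed_segment p q" using ab b01 by (auto intro: linepath_in_path)
    qed
    show "f (linepath p q a) = l" "f (linepath p q b) = h" using ab b01 by (simp_all add: \<phi>_def)
    show "l \<le> f x \<and> f x \<le> h" if "x \<in> closed_segment (linepath p q a) (linepath p q b)" for x
      using sub[OF that] ge_l le_h by (auto simp: \<phi>_def)
  qed
qed

lemma continuous_on_Max_image:
  fixes f :: "'i \<Rightarrow> 'a::topological_space \<Rightarrow> 'b::linorder_topology"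
  assumes "finite I" "I \<noteq> {}" "\<And>i. i \<in> I \<Longrightarrow> continuous_on S (f i)"
  shows "continuous_on S (\<lambda>s. Max ((\<lambda>i. f i s) ` I))"
  using assms
proof (induction I rule: finite_ne_induct)
  case (insert i I)
  then have "continuous_on S (\<lambda>s. max (f i s) (Max ((\<lambda>i. f i s) ` I)))"
    by (intro continuous_on_max) auto
  then show ?case using insert by simp
qed simp

text \<open>\<open>kick_seq\<close> yields position and slope of a solution of $u'' + \sum_i k_i g(u) \delta_{t_i} = 0$ at the
  points \<open>t_i\<close>, the slope after the kick. The kick at \<open>t_i\<close> uses the position at \<open>t_i\<close>, so the sequence is
  explicit and continuous in the data although \<open>g\<close> is only continuous, and it never returns once it is negative.\<close>

primrec kick_seq :: "(real \<Rightarrow> real) \<Rightarrow> (nat \<Rightarrow> real) \<Rightarrow> (nat \<Rightarrow> real) \<Rightarrow> real \<Rightarrow> real \<Rightarrow> nat \<Rightarrow> real \<times> real" where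
  "kick_seq g d w u0 s 0 = (u0, s)"
| "kick_seq g d w u0 s (Suc i) =
     (let (u, y) = kick_seq g d w u0 s i; u' = u + d i * y in (u', y + w i * g u'))"

definition code_lo :: "real \<Rightarrow> real \<Rightarrow> nat \<Rightarrow> real" where
  "code_lo r2 \<rho>2 k = (if k = 0 then 0 else if k = 1 then r2 else \<rho>2)"

definition code_hi :: "real \<Rightarrow> real \<Rightarrow> real \<Rightarrow> nat \<Rightarrow> real" where
  "code_hi r1 \<rho>1 R k = (if k = 0 then r1 else if k = 1 then \<rho>1 else R)"

text \<open>Even blocks carry the negative weight. A maximum in \<open>{r1, r2, R}\<close> on an odd block forces the
  solution above \<open>R\<close> at the end of the next block, a maximum in \<open>{\<rho>1, \<rho>2}\<close> forces it below zero;
  the codes use thresholds on both sides of \<open>r\<close> and of \<open>\<rho>\<close> so that strictness survives the limit.\<close>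

locale shooting =
  fixes g :: "real \<Rightarrow> real" and d w :: "nat \<Rightarrow> real" and D :: "nat \<Rightarrow> real" and N n c :: nat
    and L k0 k1 K \<kappa> \<gamma> \<delta> r1 r2 \<rho>1 \<rho>2 R :: real
  assumes g_cont: "continuous_on UNIV g" and g_nonneg: "\<And>x. 0 \<le> g x" and g_nonpos: "\<And>x. x \<le> 0 \<Longrightarrow> g x = 0"
    and N: "N = c * n" "0 < n" "2 \<le> c"
    and D_pos: "\<And>q. 0 < D q" and d_block: "\<And>q p. p < N \<Longrightarrow> d (q * N + p) = D q"
    and L: "0 < L" "\<And>q. real N * D q \<le> L"
    and w_even: "\<And>q p. even q \<Longrightarrow> p < N \<Longrightarrow> 0 \<le> w (q * N + p)"
    and w_odd: "\<And>q p. odd q \<Longrightarrow> p < N \<Longrightarrow> w (q * N + p) \<le> 0"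
    and mass_odd: "\<And>q. odd q \<Longrightarrow> (\<Sum>p<N. - w (q * N + p)) \<le> K"
    and core_odd: "\<And>q. odd q \<Longrightarrow> k0 \<le> (\<Sum>p=n..<N-n. - w (q * N + p))"
    and core_even: "\<And>q. even q \<Longrightarrow> k1 \<le> (\<Sum>p=n..<N-n. w (q * N + p))"
    and thresholds: "0 < \<delta>" "2 * \<delta> \<le> r1" "r1 \<le> r2" "r2 \<le> \<rho>1" "\<rho>1 \<le> \<rho>2" "\<rho>2 \<le> R"
    and pass: "\<And>Q x. Q \<in> {r1, r2, R} \<Longrightarrow> x \<le> Q \<Longrightarrow> g x \<le> \<kappa> * Q" "0 \<le> \<kappa>" "4 * L * K * \<kappa> < 1"
    and die: "\<And>X. X \<in> {\<rho>1, \<rho>2} \<Longrightarrow> \<exists>\<gamma>\<ge>0. (\<forall>x. X / real c \<le> x \<and> x \<le> X \<longrightarrow> \<gamma> \<le> g x) \<and>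
                  (\<forall>q. 2 * X < real n * D q * k0 * \<gamma>)"
    and dip: "0 \<le> \<gamma>" "\<And>x. \<delta> \<le> x \<Longrightarrow> x \<le> R \<Longrightarrow> \<gamma> \<le> g x" "\<And>q. 2 * R < real n * D q * k1 * \<gamma>"
begin

text \<open>The shooting parameter is the initial slope \<open>s\<close>, at the left end of a
  negative block; the starting height is fixed at \<open>r1\<close>, which is positive and at most
  \<open>R\<close>.\<close>

definition u :: "real \<Rightarrow> nat \<Rightarrow> real" where "u s i = fst (kick_seq g d w r1 s i)"
definition y :: "real \<Rightarrow> nat \<Rightarrow> real" where "y s i = snd (kick_seq g d w r1 s i)"

lemma u_0: "u s 0 = r1" and y_0: "y s 0 = s"
  by (simp_all add: u_def y_def)

lemma u_Suc: "u s (Suc i) = u s i + d i * y s i"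
  by (simp add: u_def y_def Let_def case_prod_beta)

lemma y_Suc: "y s (Suc i) = y s i + w i * g (u s (Suc i))"
  by (simp add: u_def y_def Let_def case_prod_beta)

lemma N_pos: "0 < N"
  using N by simp

lemma d_pos: "0 < d i"
proof -
  have "d (i div N * N + i mod N) = D (i div N)" using N_pos by (intro d_block) simp
  then show ?thesis using D_pos[of "i div N"] by simp
qed

lemma cont: "continuous_on S (\<lambda>s. u s i)" "continuous_on S (\<lambda>s. y s i)"
proof -
  have "continuous_on S (\<lambda>s. u s i) \<and> continuous_on S (\<lambda>s. y s i)"
  proof (induction i)
    case 0
    then show ?case by (simp add: u_0 y_0)
  next
    case (Suc i)
    then have "continuous_on S (\<lambda>s. u s (Suc i))" unfolding u_Suc by (intro continuous_intros) auto
    moreover from this have "continuous_on S (\<lambda>s. y s (Suc i))" unfolding y_Suc using Suc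
      by (intro continuous_intros continuous_on_compose2[OF g_cont]) auto
    ultimately show ?case by simp
  qed
  then show "continuous_on S (\<lambda>s. u s i)" "continuous_on S (\<lambda>s. y s i)" by auto
qed

lemma nonpos_stays:
  assumes "u s i \<le> 0" "y s i \<le> 0" "i \<le> j"
  shows "u s j \<le> 0 \<and> y s j \<le> 0"
  using assms(3)
proof (induction j rule: dec_induct)
  case (step j)
  have "d j * y s j \<le> 0" using step d_pos[of j] by (simp add: mult_nonneg_nonpos)
  then have "u s (Suc j) \<le> 0" using step by (simp add: u_Suc)
  then show ?case using step by (simp add: y_Suc g_nonpos)
qed (use assms in auto)

text \<open>The first negative position is reached with negative slope, and from there on the kicks
  vanish, so both position and slope stay negative. It is mostly applied in contraposition: a
  nonnegative final position makes all earlier positions nonnegative.\<close>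

lemma neg_stays:
  assumes "u s i < 0" "i \<le> j"
  shows "u s j < 0"
proof -
  define k where "k = (LEAST i. u s i < 0)"
  have k: "u s k < 0" "k \<le> i" unfolding k_def using assms(1) by (auto intro: LeastI Least_le)
  have "k \<noteq> 0" using k thresholds by (auto simp: u_0 intro!: gr0I)
  then obtain k' where k': "k = Suc k'" using not0_implies_Suc by blast
  have "\<not> u s k' < 0" using not_less_Least[of k' "\<lambda>i. u s i < 0"] k' unfolding k_def by simp
  then have "d k' * y s k' < 0" using k by (simp add: k' u_Suc)
  then have "y s k' < 0" using d_pos[of k'] by (simp add: mult_less_0_iff)
  then have yk: "y s k < 0" using k by (simp add: k' y_Suc g_nonpos)
  have "k \<le> j" using k assms by simp
  then have "u s j < 0 \<and> y s j < 0"
  proof (induction j rule: dec_induct)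
    case (step j)
    have "d j * y s j < 0" using step d_pos[of j] by (simp add: mult_pos_neg)
    then have "u s (Suc j) < 0" using step by (simp add: u_Suc)
    then show ?case using step by (simp add: y_Suc g_nonpos)
  qed (use k yk in auto)
  then show ?thesis by simp
qed

text \<open>A nonnegative sequence can reach \<open>0\<close> only with nonpositive slope. This
  treats the lower threshold \<open>0\<close> of code 0, at which \<open>die_block\<close> says
  nothing.\<close>

lemma zero_stays:
  assumes "\<And>j. j \<le> i \<Longrightarrow> 0 \<le> u s j" "u s i = 0" "i \<le> j"
  shows "u s j \<le> 0"
proof -
  have "i \<noteq> 0" using assms(2) thresholds by (auto simp: u_0 intro!: gr0I)
  then obtain k where k: "i = Suc k" using not0_implies_Suc by blast
  have "d k * y s k \<le> 0" using assms(1)[of k] assms(2) by (simp add: k u_Suc)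
  then have "y s k \<le> 0" using d_pos[of k] by (simp add: mult_le_0_iff)
  then have "y s i \<le> 0" using assms(2) by (simp add: k y_Suc g_nonpos)
  then show ?thesis using nonpos_stays[of s i j] assms by simp
qed

definition M :: "real \<Rightarrow> nat \<Rightarrow> real" where "M s q = Max ((\<lambda>p. u s (q * N + p)) ` {..N})"

lemma M_cont: "continuous_on S (\<lambda>s. M s q)"
  unfolding M_def by (rule continuous_on_Max_image) (auto intro: cont)

lemma M_ge: "p \<le> N \<Longrightarrow> u s (q * N + p) \<le> M s q"
  unfolding M_def by (rule Max_ge) auto

lemma M_attained: obtains p where "p \<le> N" "u s (q * N + p) = M s q"
proof -
  have "M s q \<in> (\<lambda>p. u s (q * N + p)) ` {..N}" unfolding M_def by (rule Max_in) auto
  then show thesis using that by auto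
qed

lemma block_u: "p < N \<Longrightarrow> u s (q * N + Suc p) = u s (q * N + p) + D q * y s (q * N + p)"
  by (simp add: u_Suc d_block)

lemma block_y: "y s (q * N + Suc p) = y s (q * N + p) + w (q * N + p) * g (u s (q * N + Suc p))"
  by (simp add: y_Suc)

lemma block_dip:
  assumes q: "even q" and nn: "\<And>i. i \<le> Suc q * N \<Longrightarrow> 0 \<le> u s i" and R: "u s (q * N) \<le> R" "u s (Suc q * N) \<le> R"
  obtains p where "p \<le> N" "u s (q * N + p) \<le> \<delta>"
proof -
  have "\<exists>p\<le>N. u s (q * N + p) \<le> \<delta>"
    by (rule convex_block_dip[where u = "\<lambda>p. u s (q * N + p)" and y = "\<lambda>p. y s (q * N + p)" and w = "\<lambda>p. w (q * N + p)" and D = "D q" and N = N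
          and g = g and n = n and c = c and R = R and K = k1 and \<gamma> = \<gamma>])
       (use q nn R block_u block_y D_pos w_even g_nonneg N dip core_even in \<open>auto simp: add.commute\<close>)
  then show thesis using that by blast
qed

lemma entry:
  assumes q: "even q" and nn: "\<And>i. i \<le> Suc q * N \<Longrightarrow> 0 \<le> u s i" and R: "u s (q * N) \<le> R" "u s (Suc q * N) \<le> R"
  shows "u s (Suc q * N) \<le> \<delta> + L * max 0 (y s (Suc q * N))"
proof -
  obtain p where p: "p \<le> N" "u s (q * N + p) \<le> \<delta>" using block_dip assms by blast
  have "u s (q * N + N) \<le> \<delta> + L * max 0 (y s (q * N + N))"
    by (rule convex_block_end[where u = "\<lambda>p. u s (q * N + p)" and y = "\<lambda>p. y s (q * N + p)" and D = "D q" and N = N])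
       (use p q block_u block_y D_pos w_even g_nonneg L in auto)
  then show ?thesis by (simp add: add.commute)
qed

text \<open>By \<open>concave_block_pass\<close> the solution leaves the block at height
  \<open>Q\<close> with positive slope. On the next block, which is convex, it keeps rising from
  \<open>Q > \<delta>\<close>, whereas ending at or below \<open>R\<close> would require a dip to
  \<open>\<delta>\<close>.\<close>

lemma pass_explodes:
  assumes q: "odd q" and nn: "\<And>i. i \<le> q * N \<Longrightarrow> 0 \<le> u s i"
    and en: "u s (q * N) \<le> \<delta> + L * max 0 (y s (q * N))" and Q: "M s q = Q" "Q \<in> {r1, r2, R}"
  shows "R < u s ((q + 2) * N)"
proof (rule ccontr)
  assume "\<not> ?thesis"
  then have uR: "u s ((q + 2) * N) \<le> R" by simp
  obtain ps where ps: "ps \<le> N" "u s (q * N + ps) = M s q" using M_attained .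
  have *: "u s (q * N + N) = Q \<and> 0 < y s (q * N + N)"
  proof (rule conjI; rule concave_block_pass[where u = "\<lambda>p. u s (q * N + p)" and y = "\<lambda>p. y s (q * N + p)" and w = "\<lambda>p. - w (q * N + p)" and D = "D q" and N = N
          and g = g and L = L and \<delta> = \<delta> and K = K and \<kappa> = \<kappa> and Q = Q and ps = ps])
  qed (use q en ps Q block_u block_y D_pos w_odd g_nonneg L mass_odd pass M_ge[of _ s q] thresholds in auto)
  have ge: "u s (q * N + N) \<le> u s (Suc q * N + p) \<and> 0 \<le> y s (Suc q * N + p)" if "p \<le> N" for p
    using that
  proof (induction p)
    case 0
    then show ?case using * by (simp add: add.commute)
  next
    case (Suc p)
    then have "0 \<le> D (Suc q) * y s (Suc q * N + p)" "0 \<le> w (Suc q * N + p) * g (u s (Suc q * N + Suc p))"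
      using D_pos[of "Suc q"] w_even[of "Suc q" p] q g_nonneg by auto
    then show ?case using Suc block_u[of p s "Suc q"] block_y[of s "Suc q" p] by auto
  qed
  have Qr: "r1 \<le> Q" "Q \<le> R" using Q thresholds by auto
  have nn': "0 \<le> u s i" if "i \<le> Suc (Suc q) * N" for i
  proof (rule ccontr)
    assume "\<not> ?thesis"
    then have "u s (Suc q * N + N) < 0" using neg_stays[of s i "Suc q * N + N"] that by (simp add: algebra_simps)
    then show False using ge[of N] * Qr thresholds by simp
  qed
  have "u s (Suc q * N) \<le> R" using * Qr by (simp add: add.commute)
  moreover have "u s (Suc (Suc q) * N) \<le> R" using uR by simp
  ultimately obtain p where "p \<le> N" "u s (Suc q * N + p) \<le> \<delta>"
    using block_dip[of "Suc q" s] q nn' by auto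
  then show False using ge[of p] * Qr thresholds by simp
qed

text \<open>The solution already dies inside block \<open>q\<close>, since it could not be
  nonnegative there by \<open>concave_block_bound\<close>. The conclusion is stated two blocks after
  the start of \<open>q\<close>, where \<open>pass_explodes\<close> gives the opposite
  outcome.\<close>

lemma die_block:
  assumes q: "odd q" and X: "M s q = X" "X \<in> {\<rho>1, \<rho>2}"
  shows "u s ((q + 2) * N) < 0"
proof (rule ccontr)
  assume "\<not> ?thesis"
  then have nn: "0 \<le> u s (q * N + p)" if "p \<le> N" for p
    using neg_stays[of s "q * N + p" "(q + 2) * N"] that by (force simp: algebra_simps)
  obtain \<gamma> where \<gamma>: "\<gamma> \<ge> 0" "\<And>x. X / real c \<le> x \<Longrightarrow> x \<le> X \<Longrightarrow> \<gamma> \<le> g x" "\<And>q. 2 * X < real n * D q * k0 * \<gamma>"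
    using die[OF X(2)] by blast
  obtain ps where ps: "ps \<le> N" "u s (q * N + ps) = M s q" using M_attained .
  have "real n * D q * k0 * \<gamma> \<le> 2 * X"
    by (rule concave_block_bound[where u = "\<lambda>p. u s (q * N + p)" and y = "\<lambda>p. y s (q * N + p)" and w = "\<lambda>p. - w (q * N + p)" and D = "D q" and N = N
          and g = g and n = n and c = c and K = k0 and \<gamma> = \<gamma> and X = X and ps = ps])
       (use q nn ps X block_u block_y D_pos w_odd g_nonneg N \<gamma> core_odd M_ge[of _ s q] in auto)
  then show False using \<gamma>(3)[of q] by simp
qed

abbreviation lo :: "nat \<Rightarrow> real" where "lo \<equiv> code_lo r2 \<rho>2"
abbreviation hi :: "nat \<Rightarrow> real" where "hi \<equiv> code_hi r1 \<rho>1 R"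

text \<open>The window consists of \<open>2 * J + 1\<close> blocks and ends with a negative one,
  because the position at its end is the quantity that runs from \<open>0\<close> to
  \<open>R\<close>. The separate bound at \<open>2 * J * N\<close> is there for
  \<open>entry\<close>, which needs both ends of the last negative block below
  \<open>R\<close>.\<close>

definition reaches :: "(nat \<Rightarrow> nat) \<Rightarrow> nat \<Rightarrow> real \<Rightarrow> bool" where
  "reaches S J s \<longleftrightarrow> (\<forall>i\<le>(2 * J + 1) * N. 0 \<le> u s i) \<and> (\<forall>j\<le>J. u s ((2 * j + 1) * N) \<le> R) \<and> u s (2 * J * N) \<le> R \<and>
     (\<forall>j<J. lo (S j) \<le> M s (2 * j + 1) \<and> M s (2 * j + 1) \<le> hi (S j))"

text \<open>Along the segment the position at the end of an even block runs from \<open>0\<close> to \<open>R\<close>. On the next odd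
  block the maximum then runs from \<open>0\<close> to \<open>R\<close> or beyond, and the part of the segment where it lies
  between the two thresholds of the code has one end that dies and one that explodes.\<close>

lemma reaches_path:
  assumes S: "\<And>j. S j \<in> {0, 1, 2}"
  shows "\<exists>p q. (\<forall>s\<in>closed_segment p q. reaches S J s) \<and> u p ((2 * J + 1) * N) = 0 \<and> u q ((2 * J + 1) * N) = R"
proof (induction J)
  case 0
  \<comment> \<open>The slopes \<open>- B\<close> and \<open>B\<close> move the position by exactly
    \<open>R\<close> within the first cell, from \<open>r1\<close> to at most \<open>0\<close> or to
    at least \<open>R\<close>.\<close>
  define B where "B = R / D 0"
  have R: "r1 \<le> R" "0 < r1" "0 < R" using thresholds by auto
  have d0: "d 0 = D 0" using d_block[of 0 0] N_pos by simp
  have "u (- B) (Suc 0) \<le> 0" using R D_pos[of 0] by (simp add: u_Suc u_0 y_0 d0 B_def)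
  moreover have "y (- B) (Suc 0) \<le> 0"
    using calculation R D_pos[of 0] by (simp add: y_Suc y_0 g_nonpos B_def)
  ultimately have end0: "u (- B) (1 * N) \<le> 0" using nonpos_stays[of "- B" "Suc 0" "1 * N"] N_pos by simp
  have "R \<le> u B p \<and> B \<le> y B p" if "1 \<le> p" "p \<le> N" for p
    using that
  proof (induction p rule: dec_induct)
    case base
    have "0 \<le> w 0 * g (u B (Suc 0))" using w_even[of 0 0] N_pos g_nonneg by simp
    then show ?case using R D_pos[of 0] unfolding One_nat_def by (simp add: u_Suc y_Suc u_0 y_0 d0 B_def)
  next
    case (step p)
    have "0 \<le> w p * g (u B (Suc p))" using w_even[of 0 p] step g_nonneg by simp
    moreover have "0 \<le> B" using R D_pos[of 0] by (simp add: B_def)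
    then have "0 \<le> d p * y B p" using step d_pos[of p] by (intro mult_nonneg_nonneg) auto
    ultimately show ?case using step by (simp add: u_Suc y_Suc)
  qed
  then have end1: "R \<le> u B (1 * N)" using N_pos by simp
  obtain p q where pq: "closed_segment p q \<subseteq> closed_segment (- B) B" "u p (1 * N) = 0" "u q (1 * N) = R"
    "\<And>x. x \<in> closed_segment p q \<Longrightarrow> 0 \<le> u x (1 * N) \<and> u x (1 * N) \<le> R"
    using IVT_subsegment[OF cont(1) end0 less_imp_le[OF R(3)] end1] by blast
  have "reaches S 0 s" if "s \<in> closed_segment p q" for s
  proof -
    have "0 \<le> u s i" if "i \<le> N" for i
      using neg_stays[of s i "1 * N"] pq(4)[OF \<open>s \<in> _\<close>] that by force
    then show ?thesis using pq(4)[OF that] R by (simp add: reaches_def u_0)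
  qed
  then show ?case using pq by auto
next
  case (Suc J)
  define q0 where "q0 = 2 * J + 1"
  obtain p q where pq: "\<And>s. s \<in> closed_segment p q \<Longrightarrow> reaches S J s" "u p (q0 * N) = 0" "u q (q0 * N) = R"
    using Suc unfolding q0_def by blast
  have q0: "odd q0" "q0 = Suc (2 * J)" "even (2 * J)" by (auto simp: q0_def)
  have R: "r1 \<le> R" "r2 \<le> R" "\<rho>1 \<le> R" "0 \<le> r2" "0 < r1" "0 < R" using thresholds by auto
  have nn: "0 \<le> u s i" if "s \<in> closed_segment p q" "i \<le> q0 * N" for s i
    using pq(1) that unfolding reaches_def q0_def by blast
  have en: "u s (q0 * N) \<le> \<delta> + L * max 0 (y s (q0 * N))" if s: "s \<in> closed_segment p q" for s
  proof -
    have "u s (2 * J * N) \<le> R" "u s (q0 * N) \<le> R"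
      using pq(1)[OF s] unfolding reaches_def q0_def by auto
    then show ?thesis using entry[of "2 * J" s] nn[OF s] q0(3) unfolding q0(2) by blast
  qed
  have explode: "R < u s ((q0 + 2) * N)" if "s \<in> closed_segment p q" "M s q0 \<in> {r1, r2, R}" for s
    using pass_explodes[OF q0(1) nn en] that by blast
  have die0: "u s ((q0 + 2) * N) \<le> 0" if "s \<in> closed_segment p q" "M s q0 \<in> {0, \<rho>1, \<rho>2}" for s
  proof (cases "M s q0 = 0")
    case True
    then have "u s (q0 * N) \<le> 0" using M_ge[of 0 s q0] by simp
    then have "u s (q0 * N) = 0" using nn[OF that(1), of "q0 * N"] by simp
    then show ?thesis using zero_stays[of "q0 * N" s "(q0 + 2) * N"] nn[OF that(1)] by simp
  next
    case False
    then show ?thesis using die_block[OF q0(1)] that by (metis insertE less_imp_le)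
  qed
  have Mp: "M p q0 \<le> 0"
  proof -
    obtain i where i: "i \<le> N" "u p (q0 * N + i) = M p q0" using M_attained .
    have "u p (q0 * N + i) \<le> 0" by (rule zero_stays[OF nn]) (use pq in auto)
    then show ?thesis using i by simp
  qed
  have Mq: "R \<le> M q q0" using M_ge[of 0 q q0] pq by simp
  have lohi: "0 \<le> lo (S J)" "lo (S J) \<le> hi (S J)" "hi (S J) \<le> R"
    using S[of J] thresholds by (auto simp: code_lo_def code_hi_def)
  obtain p1 q1 where pq1: "closed_segment p1 q1 \<subseteq> closed_segment p q" "M p1 q0 = lo (S J)" "M q1 q0 = hi (S J)"
    "\<And>s. s \<in> closed_segment p1 q1 \<Longrightarrow> lo (S J) \<le> M s q0 \<and> M s q0 \<le> hi (S J)"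
    using IVT_subsegment[OF M_cont order_trans[OF Mp lohi(1)] lohi(2) order_trans[OF lohi(3) Mq]] by blast
  have pq1': "p1 \<in> closed_segment p q" "q1 \<in> closed_segment p q" using pq1(1) by auto
  have "\<exists>p2 q2. closed_segment p2 q2 \<subseteq> closed_segment p1 q1 \<and> u p2 ((q0 + 2) * N) \<le> 0 \<and> R \<le> u q2 ((q0 + 2) * N)"
  proof (cases "S J = 1")
    case True
    then have "u q1 ((q0 + 2) * N) \<le> 0" "R \<le> u p1 ((q0 + 2) * N)"
      using die0[OF pq1'(2)] explode[OF pq1'(1)] pq1 by (auto simp: code_lo_def code_hi_def intro: less_imp_le)
    \<comment> \<open>For code 1 the lower threshold \<open>r2\<close> explodes and the upper
      threshold \<open>\<rho>1\<close> dies, so the ends are exchanged. For codes 0 and 2 the lower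
      threshold dies.\<close>
    then show ?thesis by (intro exI[of _ q1] exI[of _ p1]) (simp add: closed_segment_commute)
  next
    case False
    then have "u p1 ((q0 + 2) * N) \<le> 0" "R \<le> u q1 ((q0 + 2) * N)"
      using die0[OF pq1'(1)] explode[OF pq1'(2)] pq1 by (auto simp: code_lo_def code_hi_def intro: less_imp_le split: if_splits)
    then show ?thesis by blast
  qed
  then obtain p2 q2 where pq2: "closed_segment p2 q2 \<subseteq> closed_segment p1 q1" "u p2 ((q0 + 2) * N) \<le> 0" "R \<le> u q2 ((q0 + 2) * N)"
    by blast
  \<comment> \<open>Cutting once more makes the end values exactly \<open>0\<close> and
    \<open>R\<close> and keeps the position at the new end of the window in \<open>[0, R]\<close> on
    the whole segment; \<open>neg_stays\<close> then gives nonnegativity on the whole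
    window.\<close>
  obtain p3 q3 where pq3: "closed_segment p3 q3 \<subseteq> closed_segment p2 q2" "u p3 ((q0 + 2) * N) = 0" "u q3 ((q0 + 2) * N) = R"
    "\<And>s. s \<in> closed_segment p3 q3 \<Longrightarrow> 0 \<le> u s ((q0 + 2) * N) \<and> u s ((q0 + 2) * N) \<le> R"
    using IVT_subsegment[OF cont(1) pq2(2) less_imp_le[OF R(6)] pq2(3)] by blast
  have q0': "2 * Suc J + 1 = q0 + 2" by (simp add: q0_def)
  have "reaches S (Suc J) s" if s: "s \<in> closed_segment p3 q3" for s
  proof -
    have s1: "s \<in> closed_segment p1 q1" using s pq2 pq3 by blast
    have old: "reaches S J s" using pq(1) s1 pq1 by blast
    have "0 \<le> u s i" if "i \<le> (q0 + 2) * N" for i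
      using neg_stays[of s i "(q0 + 2) * N"] that pq3(4)[OF s] by force
    moreover have "u s ((2 * j + 1) * N) \<le> R" if "j \<le> Suc J" for j
    proof (cases "j = Suc J")
      case True
      then show ?thesis using pq3(4)[OF s] unfolding q0'[symmetric] by simp
    next
      case False
      then show ?thesis using old that unfolding reaches_def by auto
    qed
    moreover have "u s (2 * Suc J * N) \<le> R"
    proof -
      have "u s (2 * Suc J * N) = u s (q0 * N + N)" by (simp add: q0_def algebra_simps)
      also have "\<dots> \<le> M s q0" by (rule M_ge) simp
      also have "\<dots> \<le> R" using pq1(4)[OF s1] lohi by simp
      finally show ?thesis .
    qed
    moreover have "lo (S j) \<le> M s (2 * j + 1) \<and> M s (2 * j + 1) \<le> hi (S j)" if "j < Suc J" for j
      using that old pq1(4)[OF s1] unfolding reaches_def q0_def by (cases "j = J") auto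
    ultimately show ?thesis unfolding reaches_def q0' by blast
  qed
  then show ?case using pq3 unfolding q0' by blast
qed

text \<open>Positive blocks are bounded through their codes. On a negative block convexity puts the
  maximum at an end, which belongs to a neighbouring positive block or is the starting point with
  height \<open>r1\<close>.\<close>

lemma reaches_bounded:
  assumes s: "reaches S J s" and S: "\<And>j. S j \<in> {0, 1, 2}" and i: "i \<le> 2 * J * N"
  shows "u s i \<le> R"
proof (cases "i = 2 * J * N")
  case True
  then show ?thesis using s by (simp add: reaches_def)
next
  case False
  then have i: "i < 2 * J * N" using i by simp
  define q where "q = i div N"
  define p where "p = i mod N"
  have ipq: "i = q * N + p" "p < N" using N_pos by (simp_all add: q_def p_def)
  have hiR: "hi (S j) \<le> R" for j using S[of j] thresholds by (auto simp: code_hi_def)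
  have qJ: "q < 2 * J" unfolding q_def using i N_pos by (simp add: less_mult_imp_div_less)
  have odd: "u s (q' * N + p') \<le> R" if "odd q'" "q' < 2 * J" "p' \<le> N" for q' p'
  proof -
    obtain j where j: "q' = 2 * j + 1" using \<open>odd q'\<close> by (rule oddE)
    have "u s (q' * N + p') \<le> M s q'" using that by (intro M_ge)
    also have "\<dots> \<le> hi (S j)"
    proof -
      have "j < J" using j that by simp
      then show ?thesis using s unfolding reaches_def j by blast
    qed
    finally show ?thesis using hiR[of j] by simp
  qed
  show ?thesis
  proof (cases "even q")
    case False
    then show ?thesis using odd[of q p] ipq qJ by simp
  next
    case True
    then have "Suc q < 2 * J" using qJ by presburger
    then have e1: "u s (q * N + N) \<le> R" using odd[of "Suc q" 0] True by (simp add: add.commute)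
    have e0: "u s (q * N + 0) \<le> R"
    proof (cases q)
      case 0
      then show ?thesis using thresholds by (simp add: u_0)
    next
      case (Suc q')
      then show ?thesis using odd[of q' N] True qJ by (simp add: add.commute)
    qed
    have mono: "y s (q * N + p) \<le> y s (q * N + Suc p)" if "p < N" for p
      using block_y[of s q p] w_even[OF True that] g_nonneg by simp
    note ch = convex_chord[of N "\<lambda>p. u s (q * N + p)" "D q" "\<lambda>p. y s (q * N + p)", OF block_u less_imp_le[OF D_pos] mono]
    show ?thesis
    proof (cases "y s (q * N + p) \<le> 0")
      case yneg: True
      have "u s (q * N + p) - u s (q * N + 0) \<le> real p * D q * y s (q * N + p)" using ch(2)[of 0 p] ipq by simp
      also have "\<dots> \<le> 0" using yneg D_pos[of q] by (intro mult_nonneg_nonpos) auto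
      finally show ?thesis using e0 ipq by simp
    next
      case False
      have "0 \<le> real (N - p) * D q * y s (q * N + p)" using False D_pos[of q] by simp
      also have "\<dots> \<le> u s (q * N + N) - u s (q * N + p)" using ch(1)[of p N] ipq by simp
      finally show ?thesis using e1 ipq by simp
    qed
  qed
qed

end

subsection \<open>Passage to the limit\<close>

text \<open>Diagonal argument over the intervals \<open>[-i, i]\<close>: \<open>P i r\<close> states
  uniform convergence along \<open>r\<close> on the interval for \<open>i\<close>, a property
  inherited by every sequence that is eventually a subsequence.\<close>

lemma Arzela_Ascoli_line:
  fixes V :: "nat \<Rightarrow> real \<Rightarrow> real"
  assumes bound: "\<And>n x. \<bar>V n x\<bar> \<le> R" and lip: "\<And>n x z. \<bar>V n x - V n z\<bar> \<le> Y * \<bar>x - z\<bar>"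
  obtains U k where "strict_mono (k :: nat \<Rightarrow> nat)" "\<And>x z. \<bar>U x - U z\<bar> \<le> Y * \<bar>x - z\<bar>"
    "\<And>A e. 0 < e \<Longrightarrow> \<exists>n0. \<forall>n\<ge>n0. \<forall>x. \<bar>x\<bar> \<le> A \<longrightarrow> \<bar>V (k n) x - U x\<bar> < (e::real)"
proof -
  have Y: "0 \<le> Y" using lip[of 0 0 1] abs_ge_zero[of "V 0 0 - V 0 1"] by simp
  define P where "P i r = (\<exists>U. \<forall>e>0. \<exists>n0. \<forall>n\<ge>n0. \<forall>x\<in>{- real i..real i}. \<bar>V (r n) x - U x\<bar> < e)" for i and r :: "nat \<Rightarrow> nat"
  have sub: "\<exists>k. strict_mono (k :: nat \<Rightarrow> nat) \<and> P i (r \<circ> k)" for i r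
  proof -
    obtain U k where "continuous_on {- real i..real i} U" and k: "strict_mono (k :: nat \<Rightarrow> nat)"
      "\<And>e. 0 < e \<Longrightarrow> \<exists>N. \<forall>n x. n \<ge> N \<and> x \<in> {- real i..real i} \<longrightarrow> norm (V (r (k n)) x - U x) < e"
    proof (rule Arzela_Ascoli[of "{- real i..real i}" "\<lambda>n. V (r n)" R])
      show "compact {- real i..real i}" by simp
      show "norm (V (r n) x) \<le> R" for n x using bound by simp
      show "\<exists>d>0. \<forall>n y. y \<in> {- real i..real i} \<and> norm (x - y) < d \<longrightarrow> norm (V (r n) x - V (r n) y) < e" if "0 < e" for x e
      proof (intro exI[of _ "e / (Y + 1)"] conjI allI impI)
        show "0 < e / (Y + 1)" using that Y by simp
        fix n y assume "y \<in> {- real i..real i} \<and> norm (x - y) < e / (Y + 1)"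
        then have "(Y + 1) * \<bar>x - y\<bar> < e" using Y by (simp add: field_simps)
        moreover have "Y * \<bar>x - y\<bar> \<le> (Y + 1) * \<bar>x - y\<bar>" by (simp add: mult_right_mono)
        ultimately show "norm (V (r n) x - V (r n) y) < e" using lip[of "r n" x y] by simp
      qed
    qed blast
    have "P i (r \<circ> k)"
      unfolding P_def
    proof (intro exI[of _ U] allI impI)
      fix e :: real assume "0 < e"
      from k(2)[OF this] obtain N where "\<forall>n x. n \<ge> N \<and> x \<in> {- real i..real i} \<longrightarrow> norm (V (r (k n)) x - U x) < e" ..
      then show "\<exists>n0. \<forall>n\<ge>n0. \<forall>x\<in>{- real i..real i}. \<bar>V ((r \<circ> k) n) x - U x\<bar> < e"
        by (intro exI[of _ N]) (simp add: o_def)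
    qed
    then show ?thesis using k(1) by blast
  qed
  have P_P: "P i (r \<circ> k2)" if "P i (r \<circ> k1)" "\<And>j. N \<le> j \<Longrightarrow> \<exists>j'. j \<le> j' \<and> k2 j = k1 j'" for i r k1 k2 N
  proof -
    obtain U where U: "\<And>e. e>0 \<Longrightarrow> \<exists>n0. \<forall>n\<ge>n0. \<forall>x\<in>{- real i..real i}. \<bar>V ((r \<circ> k1) n) x - U x\<bar> < e"
      using \<open>P i (r \<circ> k1)\<close> unfolding P_def by blast
    show ?thesis
      unfolding P_def
    proof (intro exI[of _ U] allI impI)
      fix e :: real assume "0 < e"
      then obtain n0 where "\<forall>n\<ge>n0. \<forall>x\<in>{- real i..real i}. \<bar>V ((r \<circ> k1) n) x - U x\<bar> < e" using U by blast
      then have "\<forall>x\<in>{- real i..real i}. \<bar>V ((r \<circ> k2) n) x - U x\<bar> < e" if n: "n \<ge> max N n0" for n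
      proof -
        obtain j' where "n \<le> j'" "k2 n = k1 j'" using n \<open>\<And>j. N \<le> j \<Longrightarrow> \<exists>j'. j \<le> j' \<and> k2 j = k1 j'\<close>[of n] by auto
        then show ?thesis using n \<open>\<forall>n\<ge>n0. _\<close> by (auto simp: o_def)
      qed
      then show "\<exists>n0. \<forall>n\<ge>n0. \<forall>x\<in>{- real i..real i}. \<bar>V ((r \<circ> k2) n) x - U x\<bar> < e" by blast
    qed
  qed
  obtain k where k: "strict_mono (k :: nat \<Rightarrow> nat)" and Pk: "\<And>i. P i (id \<circ> k)"
  proof (rule subsequence_diagonalization_lemma[of P id])
    show "\<exists>k. strict_mono (k :: nat \<Rightarrow> nat) \<and> P i (r \<circ> k)" for i r by (rule sub)
    show "P i (r \<circ> k2)" if "P i (r \<circ> k1)" "\<And>j. N \<le> j \<Longrightarrow> \<exists>j'\<ge>j. k2 j = k1 j'" for i r k1 k2 N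
      using P_P that by blast
  qed blast
  have "\<forall>i. \<exists>U. \<forall>e>0. \<exists>n0. \<forall>n\<ge>n0. \<forall>x\<in>{- real i..real i}. \<bar>V (k n) x - U x\<bar> < e"
    using Pk unfolding P_def by simp
  then obtain Ui where Ui: "\<And>i e. e > 0 \<Longrightarrow> \<exists>n0. \<forall>n\<ge>n0. \<forall>x\<in>{- real i..real i}. \<bar>V (k n) x - Ui i x\<bar> < e"
    by metis
  \<comment> \<open>The limits obtained on different intervals are unrelated a priori; being
    pointwise limits of one sequence they agree on overlaps, and \<open>lim\<close> glues
    them.\<close>
  define U where "U x = lim (\<lambda>n. V (k n) x)" for x
  have lims: "(\<lambda>n. V (k n) x) \<longlonglongrightarrow> Ui i x" if "\<bar>x\<bar> \<le> real i" for x i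
  proof (rule LIMSEQ_I)
    fix e :: real assume "0 < e"
    then obtain n0 where "\<forall>n\<ge>n0. \<forall>x\<in>{- real i..real i}. \<bar>V (k n) x - Ui i x\<bar> < e" using Ui by blast
    moreover have "x \<in> {- real i..real i}" using that by auto
    ultimately show "\<exists>no. \<forall>n\<ge>no. norm (V (k n) x - Ui i x) < e" unfolding real_norm_def by blast
  qed
  have U: "U x = Ui i x" if "\<bar>x\<bar> \<le> real i" for x i
    unfolding U_def by (rule limI[OF lims[OF that]])
  have Ulim: "(\<lambda>n. V (k n) x) \<longlonglongrightarrow> U x" for x
    using lims[of x "nat \<lceil>\<bar>x\<bar>\<rceil>"] U[of x "nat \<lceil>\<bar>x\<bar>\<rceil>"] by (simp add: of_nat_ceiling)
  show thesis
  proof (rule that[OF k])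
    show "\<bar>U x - U z\<bar> \<le> Y * \<bar>x - z\<bar>" for x z
    proof (rule LIMSEQ_le_const2)
      show "(\<lambda>n. \<bar>V (k n) x - V (k n) z\<bar>) \<longlonglongrightarrow> \<bar>U x - U z\<bar>" by (intro tendsto_intros Ulim)
    qed (use lip in auto)
    fix A e :: real assume "0 < e"
    obtain i where i: "A \<le> real i" using real_arch_simple by blast
    obtain n0 where n0: "\<forall>n\<ge>n0. \<forall>x\<in>{- real i..real i}. \<bar>V (k n) x - Ui i x\<bar> < e" using Ui \<open>0 < e\<close> by blast
    show "\<exists>n0. \<forall>n\<ge>n0. \<forall>x. \<bar>x\<bar> \<le> A \<longrightarrow> \<bar>V (k n) x - U x\<bar> < e"
    proof (intro exI[of _ n0] allI impI)
      fix n x assume "n0 \<le> n" "\<bar>x\<bar> \<le> A"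
      then have "\<bar>x\<bar> \<le> real i" "x \<in> {- real i..real i}" using i by auto
      then show "\<bar>V (k n) x - U x\<bar> < e" using n0 \<open>n0 \<le> n\<close> U by simp
    qed
  qed
qed

text \<open>McShane's extension; the constant \<open>R\<close> is added to the minimum to keep the bound.\<close>

lemma Lipschitz_extension_finite:
  fixes t u :: "nat \<Rightarrow> real"
  assumes lip: "\<And>i j. i \<le> I \<Longrightarrow> j \<le> I \<Longrightarrow> \<bar>u i - u j\<bar> \<le> Y * \<bar>t i - t j\<bar>"
    and bound: "\<And>i. i \<le> I \<Longrightarrow> \<bar>u i\<bar> \<le> R" and Y: "0 \<le> Y"
  obtains V where "\<And>x. \<bar>V x\<bar> \<le> R" "\<And>x z. \<bar>V x - V z\<bar> \<le> Y * \<bar>x - z\<bar>" "\<And>i. i \<le> I \<Longrightarrow> V (t i) = u i"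
proof -
  define A where "A x = insert R ((\<lambda>i. u i + Y * \<bar>x - t i\<bar>) ` {..I})" for x
  define V where "V x = Min (A x)" for x
  have A: "finite (A x)" "A x \<noteq> {}" for x by (auto simp: A_def)
  have lower: "- R \<le> u i + Y * \<bar>x - t i\<bar>" if "i \<le> I" for i x
  proof -
    have "0 \<le> Y * \<bar>x - t i\<bar>" using Y by simp
    then show ?thesis using bound[OF that] by linarith
  qed
  have R: "0 \<le> R" using bound[of 0] by simp
  have half: "V x \<le> V z + Y * \<bar>x - z\<bar>" for x z
  proof -
    have "V z \<in> A z" unfolding V_def by (rule Min_in[OF A])
    then consider "V z = R" | i where "i \<le> I" "V z = u i + Y * \<bar>z - t i\<bar>" by (auto simp: A_def)
    then show ?thesis
    proof cases
      case 1
      have "V x \<le> R" unfolding V_def by (rule Min_le[OF A(1)]) (simp add: A_def)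
      moreover have "0 \<le> Y * \<bar>x - z\<bar>" using Y by simp
      ultimately show ?thesis using 1 by linarith
    next
      case 2
      have "V x \<le> u i + Y * \<bar>x - t i\<bar>" unfolding V_def by (rule Min_le[OF A(1)]) (use 2 in \<open>simp add: A_def\<close>)
      also have "Y * \<bar>x - t i\<bar> \<le> Y * (\<bar>x - z\<bar> + \<bar>z - t i\<bar>)" using Y by (intro mult_left_mono) auto
      finally show ?thesis using 2 by (simp add: distrib_left)
    qed
  qed
  show thesis
  proof (rule that)
    show "\<bar>V x - V z\<bar> \<le> Y * \<bar>x - z\<bar>" for x z
      using half[of x z] half[of z x] by (simp add: abs_minus_commute abs_le_iff)
    show "\<bar>V x\<bar> \<le> R" for x
    proof -
      have "V x \<le> R" unfolding V_def by (rule Min_le[OF A(1)]) (simp add: A_def)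
      moreover have "- R \<le> V x" unfolding V_def using A lower R by (auto simp: A_def)
      ultimately show ?thesis by simp
    qed
    show "V (t i) = u i" if i: "i \<le> I" for i
      unfolding V_def
    proof (rule Min_eqI[OF A(1)])
      show "u i \<in> A (t i)" unfolding A_def by (rule insertI2, rule image_eqI[of _ _ i]) (use i in auto)
      fix z assume "z \<in> A (t i)"
      then consider "z = R" | j where "j \<le> I" "z = u j + Y * \<bar>t i - t j\<bar>" by (auto simp: A_def)
      then show "u i \<le> z"
      proof cases
        case 1
        then show ?thesis using bound[OF i] by simp
      next
        case 2
        then show ?thesis using lip[OF i 2(1)] by simp
      qed
    qed
  qed
qed

text \<open>Taylor's formula with integral remainder, for point masses. The kick of cell
  \<open>i\<close> acts at the right end of the cell, hence the lever arm
  \<open>t b - t (Suc i)\<close>.\<close>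

lemma kick_sum_formula:
  fixes t u y k :: "nat \<Rightarrow> real"
  assumes u: "\<And>i. i < I \<Longrightarrow> u (Suc i) = u i + (t (Suc i) - t i) * y i"
    and y: "\<And>i. i < I \<Longrightarrow> y (Suc i) = y i - k i"
    and ab: "a \<le> b" "b \<le> I"
  shows "u b = u a + y a * (t b - t a) - (\<Sum>i=a..<b. k i * (t b - t (Suc i)))"
proof -
  have tel: "y b = y a - (\<Sum>i=a..<b. k i)" if "a \<le> b" "b \<le> I" for b
    using that by (induction b rule: dec_induct) (use y in auto)
  show ?thesis
    using ab
  proof (induction b rule: dec_induct)
    case (step b)
    have "(\<Sum>i=a..<Suc b. k i * (t (Suc b) - t (Suc i))) = (\<Sum>i=a..<b. k i * (t b - t (Suc i))) + (\<Sum>i=a..<b. k i) * (t (Suc b) - t b)"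
    proof -
      have "(\<Sum>i=a..<b. k i * (t (Suc b) - t (Suc i))) = (\<Sum>i=a..<b. k i * (t b - t (Suc i)) + k i * (t (Suc b) - t b))"
        by (rule sum.cong) (simp_all add: algebra_simps)
      then show ?thesis using step by (simp add: sum.distrib sum_distrib_right)
    qed
    then show ?case using step u[of b] tel[of b] by (simp add: algebra_simps)
  qed simp
qed

section \<open>Grid cells, and sums over cells written as integrals\<close>

lemma grid_mono:
  fixes t :: "nat \<Rightarrow> real"
  assumes "\<And>i. i < I \<Longrightarrow> t i \<le> t (Suc i)" "i \<le> j" "j \<le> I"
  shows "t i \<le> t j"
  using assms(2,3)
proof (induction j rule: dec_induct)
  case (step j)
  then show ?case using assms(1)[of j] by simp
qed simp

text \<open>Rounding up to the grid. On the half-open cell \<open>(t i, t (Suc i)]\<close> of an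
  increasing grid the value is \<open>Suc i\<close>, the index at which the kick of that cell
  acts.\<close>

definition next_index :: "(nat \<Rightarrow> real) \<Rightarrow> real \<Rightarrow> nat" where "next_index t x = (LEAST i. x \<le> t i)"

text \<open>Kick sums are exact integrals of \<open>h\<close> against a step function. As
  \<open>h\<close> is merely integrable, their limit is taken by dominated convergence instead of as
  a limit of Riemann sums.\<close>

lemma has_integral_cells:
  fixes t :: "nat \<Rightarrow> real" and h :: "real \<Rightarrow> real"
  assumes t: "\<And>i. i < I \<Longrightarrow> t i < t (Suc i)" and h: "\<And>x z. h integrable_on {x..z}"
    and ab: "a \<le> b" "b \<le> I"
  shows "((\<lambda>z. h z * \<phi> (next_index t z)) has_integral (\<Sum>i=a..<b. integral {t i..t (Suc i)} h * \<phi> (Suc i))) {t a..t b}"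
  using ab
proof (induction b rule: dec_induct)
  case (step b)
  have mono: "t i \<le> t j" if "i \<le> j" "j \<le> I" for i j
    using grid_mono[of I t] t that by (simp add: less_imp_le)
  have idx: "next_index t z = Suc b" if "t b < z" "z \<le> t (Suc b)" for z
    unfolding next_index_def
  proof (rule Least_equality)
    show "Suc b \<le> i" if "z \<le> t i" for i
      using mono[of i b] step that \<open>t b < z\<close> by (cases "i \<le> b") auto
  qed (use that in auto)
  have "((\<lambda>z. h z * \<phi> (Suc b)) has_integral (integral {t b..t (Suc b)} h * \<phi> (Suc b))) {t b..t (Suc b)}"
    by (rule has_integral_mult_left[OF integrable_integral[OF h]])
  then have "((\<lambda>z. h z * \<phi> (next_index t z)) has_integral (integral {t b..t (Suc b)} h * \<phi> (Suc b))) {t b..t (Suc b)}"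
    by (rule has_integral_spike_finite[where S="{t b}", rotated 2]) (use idx in auto)
  then show ?case
    using has_integral_combine[OF mono[of a b] _ step.IH] step t[of b] by fastforce
qed (simp add: has_integral_refl)

lemma absolutely_integrable_mult_continuous:
  fixes f c :: "real \<Rightarrow> real"
  assumes "f absolutely_integrable_on {a..b}" "continuous_on {a..b} c"
  shows "(\<lambda>z. f z * c z) absolutely_integrable_on {a..b}"
proof -
  have "(\<lambda>z. c z * f z) absolutely_integrable_on {a..b}"
  proof (rule absolutely_integrable_bounded_measurable_product_real)
    show "c \<in> borel_measurable (lebesgue_on {a..b})"
      using assms(2) by (simp add: continuous_imp_measurable_on_sets_lebesgue)
    show "bounded (c ` {a..b})" using assms(2) by (intro compact_imp_bounded compact_continuous_image) auto
  qed (use assms in auto)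
  then show ?thesis by (simp add: mult.commute)
qed

text \<open>The error of the linear approximation over an increment is at most its length times the
  increment of \<open>P\<close>, the indefinite integral of \<open>\<bar>f\<bar>\<close>. Since
  \<open>P\<close> is continuous, the derivative exists at every \<open>x > t0\<close>, although
  \<open>f\<close> itself need not be continuous.\<close>

lemma has_derivative_repeated_integral:
  fixes f :: "real \<Rightarrow> real"
  assumes f: "\<And>a b. f absolutely_integrable_on {a..b}" and x: "t0 < x"
  shows "((\<lambda>x. integral {t0..x} (\<lambda>z. f z * (x - z))) has_real_derivative integral {t0..x} f) (at x)"
proof -
  define \<Phi> where "\<Phi> x = integral {t0..x} (\<lambda>z. f z * (x - z))" for x
  define F where "F x = integral {t0..x} f" for x
  define P where "P x = integral {t0..x} (\<lambda>z. \<bar>f z\<bar>)" for x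
  have int: "(\<lambda>z. f z * (x - z)) integrable_on {a..b}" for a b x
    by (rule set_lebesgue_integral_eq_integral(1), rule absolutely_integrable_mult_continuous[OF f]) (intro continuous_intros)
  have fi: "f integrable_on {a..b}" for a b using f set_lebesgue_integral_eq_integral(1) by blast
  have af: "(\<lambda>z. \<bar>f z\<bar>) integrable_on {a..b}" for a b
    using absolutely_integrable_norm[OF f, of a b] set_lebesgue_integral_eq_integral(1) by (fastforce simp: o_def)
  have comb: "integral {t0..x2} k = integral {t0..x1} k + integral {x1..x2} k"
    if "t0 \<le> x1" "x1 \<le> x2" "\<And>a b. k integrable_on {a..b}" for x1 x2 and k :: "real \<Rightarrow> real"
    using Henstock_Kurzweil_Integration.integral_combine[OF that(1,2) that(3)] by simp
  have est: "\<bar>integral {x1..x2} (\<lambda>z. f z * c z)\<bar> \<le> (x2 - x1) * (P x2 - P x1)"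
    if x12: "t0 \<le> x1" "x1 \<le> x2" and c: "continuous_on {x1..x2} c" "\<And>z. z \<in> {x1..x2} \<Longrightarrow> \<bar>c z\<bar> \<le> x2 - x1" for x1 x2 and c :: "real \<Rightarrow> real"
  proof -
    have "norm (integral {x1..x2} (\<lambda>z. f z * c z)) \<le> integral {x1..x2} (\<lambda>z. \<bar>f z\<bar> * (x2 - x1))"
    proof (rule integral_norm_bound_integral)
      show "(\<lambda>z. f z * c z) integrable_on {x1..x2}"
        by (rule set_lebesgue_integral_eq_integral(1), rule absolutely_integrable_mult_continuous[OF f c(1)])
      show "(\<lambda>z. \<bar>f z\<bar> * (x2 - x1)) integrable_on {x1..x2}" by (intro integrable_on_mult_left af)
      show "norm (f z * c z) \<le> \<bar>f z\<bar> * (x2 - x1)" if "z \<in> {x1..x2}" for z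
        using c(2)[OF that] by (simp add: abs_mult mult_left_mono)
    qed
    also have "\<dots> = (x2 - x1) * integral {x1..x2} (\<lambda>z. \<bar>f z\<bar>)" by simp
    also have "integral {x1..x2} (\<lambda>z. \<bar>f z\<bar>) = P x2 - P x1"
      unfolding P_def using comb[OF x12 af] by simp
    finally show ?thesis by simp
  qed
  have split: "\<Phi> x2 - \<Phi> x1 = (x2 - x1) * F x1 + integral {x1..x2} (\<lambda>z. f z * (x2 - z))" if "t0 \<le> x1" "x1 \<le> x2" for x1 x2
  proof -
    have "\<Phi> x2 = integral {t0..x1} (\<lambda>z. f z * (x2 - z)) + integral {x1..x2} (\<lambda>z. f z * (x2 - z))"
      unfolding \<Phi>_def by (rule comb[OF that int])
    also have "integral {t0..x1} (\<lambda>z. f z * (x2 - z)) = integral {t0..x1} (\<lambda>z. f z * (x1 - z) + f z * (x2 - x1))"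
      by (simp add: algebra_simps)
    also have "\<dots> = \<Phi> x1 + F x1 * (x2 - x1)"
      unfolding \<Phi>_def F_def by (subst integral_add[OF int integrable_on_mult_left[OF fi]]) simp
    finally show ?thesis by simp
  qed
  have fwd: "\<bar>\<Phi> x2 - \<Phi> x1 - F x1 * (x2 - x1)\<bar> \<le> (x2 - x1) * (P x2 - P x1)" if "t0 \<le> x1" "x1 \<le> x2" for x1 x2
  proof -
    have "\<bar>integral {x1..x2} (\<lambda>z. f z * (x2 - z))\<bar> \<le> (x2 - x1) * (P x2 - P x1)"
      by (rule est[OF that]) (auto intro!: continuous_intros)
    then show ?thesis using split[OF that] by (simp add: mult.commute)
  qed
  have bwd: "\<bar>\<Phi> x1 - \<Phi> x2 - F x2 * (x1 - x2)\<bar> \<le> (x2 - x1) * (P x2 - P x1)" if "t0 \<le> x1" "x1 \<le> x2" for x1 x2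
  proof -
    have "\<bar>integral {x1..x2} (\<lambda>z. f z * (x1 - z))\<bar> \<le> (x2 - x1) * (P x2 - P x1)"
      by (rule est[OF that]) (auto intro!: continuous_intros)
    moreover have "integral {x1..x2} (\<lambda>z. f z * (x1 - z)) = integral {x1..x2} (\<lambda>z. f z * (x2 - z)) + integral {x1..x2} (\<lambda>z. f z * (x1 - x2))"
      by (subst integral_add[symmetric, OF int integrable_on_mult_left[OF fi]]) (simp add: algebra_simps)
    moreover have "integral {x1..x2} (\<lambda>z. f z * (x1 - x2)) = integral {x1..x2} f * (x1 - x2)"
      by (rule integral_mult_left)
    moreover have "integral {x1..x2} f = F x2 - F x1"
      unfolding F_def using comb[OF that fi] by simp
    moreover have "\<Phi> x2 - \<Phi> x1 - (x2 - x1) * F x1 = integral {x1..x2} (\<lambda>z. f z * (x2 - z))"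
      using split[OF that] by simp
    ultimately have "\<bar>\<Phi> x2 - \<Phi> x1 - (x2 - x1) * F x1 + (F x2 - F x1) * (x1 - x2)\<bar> \<le> (x2 - x1) * (P x2 - P x1)"
      by metis
    also have "\<Phi> x2 - \<Phi> x1 - (x2 - x1) * F x1 + (F x2 - F x1) * (x1 - x2) = - (\<Phi> x1 - \<Phi> x2 - F x2 * (x1 - x2))"
      by (simp add: algebra_simps)
    finally show ?thesis by simp
  qed
  have both: "\<bar>\<Phi> x' - \<Phi> x - F x * (x' - x)\<bar> \<le> \<bar>P x' - P x\<bar> * \<bar>x' - x\<bar>" if "t0 \<le> x'" for x'
  proof (cases "x \<le> x'")
    case True
    have "(x' - x) * (P x' - P x) \<le> \<bar>x' - x\<bar> * \<bar>P x' - P x\<bar>" using abs_ge_self[of "(x' - x) * (P x' - P x)"] by (simp add: abs_mult)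
    then show ?thesis using fwd[of x x'] x True by (simp add: mult.commute)
  next
    case False
    have "(x - x') * (P x - P x') \<le> \<bar>x' - x\<bar> * \<bar>P x' - P x\<bar>"
      using abs_ge_self[of "(x - x') * (P x - P x')"]
      unfolding abs_mult abs_minus_commute[of x'] abs_minus_commute[of "P x'"] .
    moreover have "\<bar>\<Phi> x' - \<Phi> x - F x * (x' - x)\<bar> \<le> (x - x') * (P x - P x')"
      by (rule bwd) (use that False in auto)
    ultimately show ?thesis unfolding mult.commute[of "\<bar>P x' - P x\<bar>"] by (rule order_trans[rotated])
  qed
  have "continuous_on {t0..x + 1} P"
    unfolding P_def by (rule indefinite_integral_continuous_1[OF af])
  then have "isCont P x" using x by (simp add: continuous_on_interior)
  have "(\<Phi> has_real_derivative F x) (at x)"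
    unfolding has_field_derivative_def has_derivative_at_alt
  proof (intro conjI allI impI)
    show "bounded_linear ((*) (F x))" by (rule bounded_linear_mult_right)
    fix e :: real assume "0 < e"
    then obtain d where d: "d > 0" "\<And>x'. \<bar>x' - x\<bar> < d \<Longrightarrow> \<bar>P x' - P x\<bar> < e"
      using \<open>isCont P x\<close> unfolding continuous_at_eps_delta dist_real_def by blast
    show "\<exists>d>0. \<forall>x'. norm (x' - x) < d \<longrightarrow> norm (\<Phi> x' - \<Phi> x - F x * (x' - x)) \<le> e * norm (x' - x)"
    proof (intro exI[of _ "min d (x - t0)"] conjI allI impI)
      show "0 < min d (x - t0)" using d x by simp
      fix x' assume x': "norm (x' - x) < min d (x - t0)"
      have "\<bar>\<Phi> x' - \<Phi> x - F x * (x' - x)\<bar> \<le> \<bar>P x' - P x\<bar> * \<bar>x' - x\<bar>" by (rule both) (use x' in auto)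
      also have "\<dots> \<le> e * \<bar>x' - x\<bar>" using d(2)[of x'] x' by (intro mult_right_mono) auto
      finally show "norm (\<Phi> x' - \<Phi> x - F x * (x' - x)) \<le> e * norm (x' - x)" by simp
    qed
  qed
  then show ?thesis unfolding \<Phi>_def F_def .
qed

lemma next_index_properties:
  fixes t :: "nat \<Rightarrow> real"
  assumes t: "\<And>i. i < I \<Longrightarrow> t i < t (Suc i)" and x: "t 0 < x" "x \<le> t I"
  shows "next_index t x \<le> I" "x \<le> t (next_index t x)" "0 < next_index t x" "t (next_index t x - 1) < x"
proof -
  show a: "next_index t x \<le> I" "x \<le> t (next_index t x)"
    unfolding next_index_def using x by (auto intro: Least_le LeastI)
  then show b: "0 < next_index t x" using x by (cases "next_index t x") auto
  then show "t (next_index t x - 1) < x"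
    using not_less_Least[of "next_index t x - 1" "\<lambda>i. x \<le> t i"] unfolding next_index_def by simp
qed

section \<open>Kick sequences on refining grids that exhaust the line\<close>

locale kick_approximations =
  fixes t u y :: "nat \<Rightarrow> nat \<Rightarrow> real" and I :: "nat \<Rightarrow> nat" and mesh :: "nat \<Rightarrow> real"
    and h g :: "real \<Rightarrow> real" and R :: real
  assumes t_mono: "\<And>n i. i < I n \<Longrightarrow> t n i < t n (Suc i)"
    and mesh: "\<And>n i. i < I n \<Longrightarrow> t n (Suc i) - t n i \<le> mesh n" "mesh \<longlonglongrightarrow> 0"
    and cover: "\<And>n. t n 0 \<le> - real n" "\<And>n. real n \<le> t n (I n)"
    and u_Suc: "\<And>n i. i < I n \<Longrightarrow> u n (Suc i) = u n i + (t n (Suc i) - t n i) * y n i"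
    and y_Suc: "\<And>n i. i < I n \<Longrightarrow> y n (Suc i) = y n i - integral {t n i..t n (Suc i)} h * g (u n (Suc i))"
    and u_bound: "\<And>n i. i \<le> I n \<Longrightarrow> \<bar>u n i\<bar> \<le> R"
    and h: "\<And>a b. h absolutely_integrable_on {a..b}"
    and g_cont: "continuous_on UNIV g"
begin

lemma subsequence:
  assumes k: "strict_mono (k :: nat \<Rightarrow> nat)"
  shows "kick_approximations (\<lambda>n. t (k n)) (\<lambda>n. u (k n)) (\<lambda>n. y (k n)) (\<lambda>n. I (k n)) (\<lambda>n. mesh (k n)) h g R"
proof
  have "real n \<le> real (k n)" for n using seq_suble[OF k] by simp
  then show "t (k n) 0 \<le> - real n" "real n \<le> t (k n) (I (k n))" for n using cover[of "k n"] by (smt (verit))+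
  show "(\<lambda>n. mesh (k n)) \<longlonglongrightarrow> 0" using LIMSEQ_subseq_LIMSEQ[OF mesh(2) k] by (simp add: o_def)
qed (use t_mono mesh u_Suc y_Suc u_bound h g_cont in auto)

lemma integrable_h: "h integrable_on {a..b}"
  using h set_lebesgue_integral_eq_integral(1) by blast

lemma t_le: "i \<le> j \<Longrightarrow> j \<le> I n \<Longrightarrow> t n i \<le> t n j"
  using grid_mono[of "I n" "t n" i j] t_mono by (simp add: less_imp_le)

abbreviation \<iota> :: "nat \<Rightarrow> real \<Rightarrow> nat" where "\<iota> n \<equiv> next_index (t n)"

lemma index:
  assumes "\<bar>x\<bar> < real n"
  shows "\<iota> n x \<le> I n" "x \<le> t n (\<iota> n x)" "t n (\<iota> n x) - x \<le> mesh n"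
proof -
  have x: "t n 0 < x" "x \<le> t n (I n)" using assms cover[of n] by (auto simp: abs_less_iff)
  note * = next_index_properties[of "I n" "t n" x, OF t_mono x]
  show "\<iota> n x \<le> I n" "x \<le> t n (\<iota> n x)" using *(1,2) by simp_all
  have "t n (Suc (\<iota> n x - 1)) - t n (\<iota> n x - 1) \<le> mesh n" using * by (intro mesh) auto
  then show "t n (\<iota> n x) - x \<le> mesh n" using * by simp
qed

lemma index_mono: "z \<le> x \<Longrightarrow> \<bar>x\<bar> < real n \<Longrightarrow> \<iota> n z \<le> \<iota> n x"
  using index(2)[of x n] unfolding next_index_def[of _ z] by (intro Least_le) auto

lemma eventually_less: "\<forall>\<^sub>F n in sequentially. \<bar>x\<bar> < real n"
  by real_asymp

lemma t_index_tendsto: "(\<lambda>n. t n (\<iota> n x)) \<longlonglongrightarrow> x"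
proof (rule tendsto_sandwich[of "\<lambda>_. x" _ _ "\<lambda>n. x + mesh n"])
  show "\<forall>\<^sub>F n in sequentially. x \<le> t n (\<iota> n x)"
    using eventually_less[of x] by eventually_elim (rule index(2))
  show "\<forall>\<^sub>F n in sequentially. t n (\<iota> n x) \<le> x + mesh n"
    using eventually_less[of x] by eventually_elim (use index(3) in \<open>force simp: algebra_simps\<close>)
  show "(\<lambda>n. x + mesh n) \<longlonglongrightarrow> x" using tendsto_add[OF tendsto_const mesh(2), of x] by simp
qed simp

end

text \<open>The sequences live on different grids, so closeness to \<open>U\<close> is required at
  grid points only, uniformly over those in a bounded interval.\<close>

locale kick_limit = kick_approximations +
  fixes U :: "real \<Rightarrow> real"
  assumes U_cont: "continuous_on UNIV U"
    and unif: "\<And>A e. 0 < e \<Longrightarrow> \<exists>n0. \<forall>n\<ge>n0. \<forall>i\<le>I n. \<bar>t n i\<bar> \<le> A \<longrightarrow> \<bar>u n i - U (t n i)\<bar> < e"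
begin

lemma u_tendsto:
  assumes "(\<lambda>n. t n (j n)) \<longlonglongrightarrow> x" "\<forall>\<^sub>F n in sequentially. j n \<le> I n"
  shows "(\<lambda>n. u n (j n)) \<longlonglongrightarrow> U x"
proof -
  have "isCont U x" using U_cont by (simp add: continuous_on_eq_continuous_at)
  then have 1: "(\<lambda>n. U (t n (j n))) \<longlonglongrightarrow> U x" by (rule isCont_tendsto_compose[OF _ assms(1)])
  have "\<forall>\<^sub>F n in sequentially. \<bar>t n (j n)\<bar> < \<bar>x\<bar> + 1"
    using order_tendstoD(2)[OF tendsto_rabs[OF assms(1)], of "\<bar>x\<bar> + 1"] by simp
  then have ev: "\<forall>\<^sub>F n in sequentially. j n \<le> I n \<and> \<bar>t n (j n)\<bar> \<le> \<bar>x\<bar> + 1"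
    using assms(2) by eventually_elim auto
  have "(\<lambda>n. u n (j n) - U (t n (j n))) \<longlonglongrightarrow> 0"
  proof (rule tendstoI)
    fix e :: real assume "0 < e"
    then obtain n0 where n0: "\<forall>n\<ge>n0. \<forall>i\<le>I n. \<bar>t n i\<bar> \<le> \<bar>x\<bar> + 1 \<longrightarrow> \<bar>u n i - U (t n i)\<bar> < e" using unif by blast
    show "\<forall>\<^sub>F n in sequentially. dist (u n (j n) - U (t n (j n))) 0 < e"
      using ev eventually_ge_at_top[of n0] by eventually_elim (simp add: dist_real_def n0)
  qed
  from tendsto_add[OF this 1] show ?thesis by simp
qed

lemma u_index_tendsto: "(\<lambda>n. u n (\<iota> n x)) \<longlonglongrightarrow> U x"
proof (rule u_tendsto[OF t_index_tendsto])
  show "\<forall>\<^sub>F n in sequentially. \<iota> n x \<le> I n"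
    using eventually_less[of x] by eventually_elim (rule index(1))
qed

lemma g_tendsto: "(v \<longlonglongrightarrow> w) \<Longrightarrow> (\<lambda>n. g (v n)) \<longlonglongrightarrow> g w"
  using g_cont by (intro isCont_tendsto_compose[of _ g]) (simp_all add: continuous_on_eq_continuous_at)

lemma kick_sum_tendsto:
  assumes x: "t0 < x"
  shows "(\<lambda>n. \<Sum>i=\<iota> n t0..<\<iota> n x. integral {t n i..t n (Suc i)} h * (g (u n (Suc i)) * (t n (\<iota> n x) - t n (Suc i))))
           \<longlonglongrightarrow> integral {t0..x} (\<lambda>z. h z * (g (U z) * (x - z)))" (is "?S \<longlonglongrightarrow> _")
proof -
  obtain G where G: "\<And>v. \<bar>v\<bar> \<le> R \<Longrightarrow> \<bar>g v\<bar> \<le> G"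
  proof -
    have "compact (g ` {-R..R})" by (intro compact_continuous_image continuous_on_subset[OF g_cont]) auto
    then obtain G where "\<forall>w\<in>g ` {-R..R}. norm w \<le> G" using compact_imp_bounded bounded_iff by metis
    then show thesis by (intro that[of G]) (simp add: abs_le_iff)
  qed
  \<comment> \<open>The domain is made independent of \<open>n\<close>: the rounded end of the
    integral exceeds \<open>x\<close> by at most \<open>mesh n\<close>, which is eventually below
    \<open>1\<close>, so \<open>[t0, x + 1]\<close> suffices. The point \<open>t0\<close> is removed
    because its membership in the range of integration varies with the grid.\<close>
  define f where "f n z = (if z \<in> {t n (\<iota> n t0)..t n (\<iota> n x)} \<and> z \<noteq> t0
      then h z * (g (u n (\<iota> n z)) * (t n (\<iota> n x) - t n (\<iota> n z))) else 0)" for n z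
  define F where "F z = (if z \<in> {t0<..x} then h z * (g (U z) * (x - z)) else 0)" for z
  have "\<forall>\<^sub>F n in sequentially. \<bar>t0\<bar> < real n \<and> \<bar>x\<bar> + 1 < real n \<and> mesh n < 1"
    using order_tendstoD(2)[OF mesh(2) zero_less_one] eventually_less[of t0] eventually_less[of "\<bar>x\<bar> + 1"]
    by eventually_elim simp
  then obtain n0 where n0: "\<And>n. n \<ge> n0 \<Longrightarrow> \<bar>t0\<bar> < real n" "\<And>n. n \<ge> n0 \<Longrightarrow> \<bar>x\<bar> + 1 < real n" "\<And>n. n \<ge> n0 \<Longrightarrow> mesh n < 1"
    unfolding eventually_sequentially by blast
  have ends: "t0 \<le> t n (\<iota> n t0)" "x \<le> t n (\<iota> n x)" "t n (\<iota> n x) \<le> x + 1" "\<iota> n t0 \<le> \<iota> n x" "\<iota> n x \<le> I n" if "n \<ge> n0" for n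
    using index[of t0 n] index[of x n] n0[OF that] index_mono[of t0 x n] x by auto
  have conv: "(\<lambda>n. ?S (n + n0)) \<longlonglongrightarrow> integral {t0..x + 1} F"
  proof -
    have S: "(f (n + n0) has_integral ?S (n + n0)) {t0..x + 1}" for n
    proof -
      let ?n = "n + n0"
      let ?\<phi> = "\<lambda>j. g (u ?n j) * (t ?n (\<iota> ?n x) - t ?n j)"
      have "((\<lambda>z. h z * ?\<phi> (\<iota> ?n z)) has_integral ?S ?n) {t ?n (\<iota> ?n t0)..t ?n (\<iota> ?n x)}"
        by (rule has_integral_cells[of "I ?n"]) (use t_mono integrable_h ends[of ?n] in auto)
      then have "((\<lambda>z. if z \<in> {t ?n (\<iota> ?n t0)..t ?n (\<iota> ?n x)} then h z * ?\<phi> (\<iota> ?n z) else 0) has_integral ?S ?n) {t0..x + 1}"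
        by (subst has_integral_restrict) (use ends[of ?n] in auto)
      then show ?thesis
        by (rule has_integral_spike_finite[where S = "{t0}", rotated 2]) (auto simp: f_def)
    qed
    have "(\<lambda>n. integral {t0..x + 1} (f (n + n0))) \<longlonglongrightarrow> integral {t0..x + 1} F"
    proof (rule dominated_convergence(2)[OF has_integral_integrable[OF S]])
      show "(\<lambda>z. \<bar>h z\<bar> * (G * (x + 1 - t0))) integrable_on {t0..x + 1}"
        using absolutely_integrable_norm[OF h, of t0 "x + 1"] set_lebesgue_integral_eq_integral(1)
        by (intro integrable_on_mult_left) (fastforce simp: o_def)
      show "norm (f (n + n0) z) \<le> \<bar>h z\<bar> * (G * (x + 1 - t0))" if z: "z \<in> {t0..x + 1}" for n z
      proof -
        have G0: "0 \<le> G" using order_trans[OF abs_ge_zero G[OF u_bound[of 0 0]]] by simp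
        show "norm (f (n + n0) z) \<le> \<bar>h z\<bar> * (G * (x + 1 - t0))"
        proof (cases "z \<in> {t (n + n0) (\<iota> (n + n0) t0)..t (n + n0) (\<iota> (n + n0) x)} \<and> z \<noteq> t0")
          case True
          let ?n = "n + n0"
          have zn: "\<bar>z\<bar> < real ?n" using z n0(1,2)[of ?n] by auto
          have le: "\<iota> ?n z \<le> \<iota> ?n x" using True unfolding next_index_def[of _ z] by (intro Least_le) auto
          have "t ?n (\<iota> ?n z) \<le> t ?n (\<iota> ?n x)" using t_le[OF le] ends[of ?n] by simp
          then have "\<bar>t ?n (\<iota> ?n x) - t ?n (\<iota> ?n z)\<bar> \<le> x + 1 - t0"
            using ends[of ?n] index(2)[OF zn] z by auto
          moreover have "\<bar>g (u ?n (\<iota> ?n z))\<bar> \<le> G" using G u_bound index(1)[OF zn] by blast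
          ultimately have "\<bar>g (u ?n (\<iota> ?n z))\<bar> * \<bar>t ?n (\<iota> ?n x) - t ?n (\<iota> ?n z)\<bar> \<le> G * (x + 1 - t0)"
            using G0 by (intro mult_mono) auto
          then show ?thesis using True by (simp add: f_def abs_mult mult_left_mono)
        qed (use G0 x z in \<open>auto simp: f_def\<close>)
      qed
      show "(\<lambda>n. f (n + n0) z) \<longlonglongrightarrow> F z" if z: "z \<in> {t0..x + 1}" for z
      proof -
        consider "z = t0" | "z = x" | "x < z" | "t0 < z" "z < x" using z by fastforce
        then have "(\<lambda>n. f n z) \<longlonglongrightarrow> F z"
        proof cases
          case 4
          have lim: "(\<lambda>n. h z * (g (u n (\<iota> n z)) * (t n (\<iota> n x) - t n (\<iota> n z)))) \<longlonglongrightarrow> h z * (g (U z) * (x - z))"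
            by (intro tendsto_intros g_tendsto u_index_tendsto t_index_tendsto)
          have "\<forall>\<^sub>F n in sequentially. t n (\<iota> n t0) < z" "\<forall>\<^sub>F n in sequentially. z < t n (\<iota> n x)"
            using order_tendstoD[OF t_index_tendsto] 4 by blast+
          then have "\<forall>\<^sub>F n in sequentially. h z * (g (u n (\<iota> n z)) * (t n (\<iota> n x) - t n (\<iota> n z))) = f n z"
            by eventually_elim (use 4 in \<open>auto simp: f_def\<close>)
          then show ?thesis using Lim_transform_eventually[OF lim] 4 by (simp add: F_def)
        next
          case 3
          then have "\<forall>\<^sub>F n in sequentially. t n (\<iota> n x) < z" using order_tendstoD[OF t_index_tendsto] by blast
          then have "\<forall>\<^sub>F n in sequentially. f n z = F z" by eventually_elim (use 3 in \<open>auto simp: f_def F_def\<close>)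
          then show ?thesis by (rule tendsto_eventually)
        next
          case 2
          then have "f n z = 0" "F z = 0" for n by (simp_all add: f_def F_def)
          then show ?thesis by simp
        qed (simp_all add: f_def F_def)
        then show "(\<lambda>n. f (n + n0) z) \<longlonglongrightarrow> F z" by (rule LIMSEQ_ignore_initial_segment)
      qed
    qed
    then show ?thesis using integral_unique[OF S] by simp
  qed
  have "integral {t0..x + 1} F = integral {t0<..x} (\<lambda>z. h z * (g (U z) * (x - z)))"
    unfolding F_def integral_restrict_Int by (rule arg_cong2[where f = integral]) auto
  also have "\<dots> = integral {t0..x} (\<lambda>z. h z * (g (U z) * (x - z)))"
    by (rule integral_subset_negligible) (auto intro: negligible_subset[of "{t0}"])
  finally show ?thesis using LIMSEQ_offset[OF conv] by simp
qed
end

context kick_limit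
begin

text \<open>The slope \<open>c\<close> exists because \<open>y n (\<iota> n t0)\<close> is the only term of the summed recursion whose
  convergence is not yet known.\<close>

lemma integral_equation:
  obtains c where "\<And>x. t0 < x \<Longrightarrow> U x = U t0 + c * (x - t0) - integral {t0..x} (\<lambda>z. h z * g (U z) * (x - z))"
proof -
  define \<Phi> where "\<Phi> x = U x - U t0 + integral {t0..x} (\<lambda>z. h z * g (U z) * (x - z))" for x
  have lim: "(\<lambda>n. y n (\<iota> n t0) * (t n (\<iota> n x) - t n (\<iota> n t0))) \<longlonglongrightarrow> \<Phi> x" if x: "t0 < x" for x
  proof -
    let ?S = "\<lambda>n. \<Sum>i=\<iota> n t0..<\<iota> n x. integral {t n i..t n (Suc i)} h * (g (u n (Suc i)) * (t n (\<iota> n x) - t n (Suc i)))"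
    have "(\<lambda>n. u n (\<iota> n x) - u n (\<iota> n t0) + ?S n) \<longlonglongrightarrow> U x - U t0 + integral {t0..x} (\<lambda>z. h z * (g (U z) * (x - z)))"
      by (intro tendsto_intros u_index_tendsto kick_sum_tendsto x)
    then have "(\<lambda>n. u n (\<iota> n x) - u n (\<iota> n t0) + ?S n) \<longlonglongrightarrow> \<Phi> x" by (simp add: \<Phi>_def mult.assoc)
    moreover have "\<forall>\<^sub>F n in sequentially. u n (\<iota> n x) - u n (\<iota> n t0) + ?S n = y n (\<iota> n t0) * (t n (\<iota> n x) - t n (\<iota> n t0))"
      using eventually_less[of t0] eventually_less[of x]
    proof eventually_elim
      case (elim n)
      have "\<iota> n t0 \<le> \<iota> n x" "\<iota> n x \<le> I n" using index_mono[of t0 x n] x elim index(1)[of x n] by auto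
      with kick_sum_formula[of "I n" "u n" "t n" "y n" "\<lambda>i. integral {t n i..t n (Suc i)} h * g (u n (Suc i))" "\<iota> n t0" "\<iota> n x", OF u_Suc y_Suc]
      show ?case by (simp add: mult.assoc)
    qed
    ultimately show ?thesis by (rule Lim_transform_eventually)
  qed
  define c where "c = \<Phi> (t0 + 1)"
  have y: "(\<lambda>n. y n (\<iota> n t0)) \<longlonglongrightarrow> c"
  proof -
    have dl: "(\<lambda>n. t n (\<iota> n (t0 + 1)) - t n (\<iota> n t0)) \<longlonglongrightarrow> t0 + 1 - t0" by (intro tendsto_intros t_index_tendsto)
    then have pos: "\<forall>\<^sub>F n in sequentially. 0 < t n (\<iota> n (t0 + 1)) - t n (\<iota> n t0)"
      by (rule order_tendstoD) simp
    have "(\<lambda>n. y n (\<iota> n t0) * (t n (\<iota> n (t0 + 1)) - t n (\<iota> n t0)) / (t n (\<iota> n (t0 + 1)) - t n (\<iota> n t0))) \<longlonglongrightarrow> \<Phi> (t0 + 1) / (t0 + 1 - t0)"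
      by (intro tendsto_divide lim dl) auto
    then have "(\<lambda>n. y n (\<iota> n t0) * (t n (\<iota> n (t0 + 1)) - t n (\<iota> n t0)) / (t n (\<iota> n (t0 + 1)) - t n (\<iota> n t0))) \<longlonglongrightarrow> c"
      by (simp add: c_def)
    then show ?thesis
      by (rule Lim_transform_eventually) (use pos in \<open>eventually_elim, simp\<close>)
  qed
  have "\<Phi> x = c * (x - t0)" if "t0 < x" for x
    by (rule LIMSEQ_unique[OF lim[OF that]]) (intro tendsto_intros y t_index_tendsto)
  then show thesis
    by (intro that[of c]) (simp add: \<Phi>_def algebra_simps)
qed

lemma forcing_absolutely_integrable: "(\<lambda>z. h z * g (U z)) absolutely_integrable_on {a..b}"
  by (rule absolutely_integrable_mult_continuous[OF h])
     (rule continuous_on_compose2[OF g_cont continuous_on_subset[OF U_cont]], auto)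

text \<open>The integral equation with base \<open>t0\<close> describes \<open>U\<close> only to the
  right of \<open>t0\<close>, with a slope depending on \<open>t0\<close>. All bases give the
  derivative of the same \<open>U\<close>, so at each point a base to its left, such as
  \<open>x - 1\<close>, can be used.\<close>

lemma limit_solves:
  obtains U' where "\<And>x. (U has_real_derivative U' x) (at x)"
    "\<And>v w. v \<le> w \<Longrightarrow> U' w - U' v = - integral {v..w} (\<lambda>z. h z * g (U z))"
proof -
  let ?f = "\<lambda>z. h z * g (U z)"
  have "\<exists>c. \<forall>x>t0. (U has_real_derivative (c - integral {t0..x} ?f)) (at x)" for t0
  proof -
    obtain c where c: "\<And>x. t0 < x \<Longrightarrow> U x = U t0 + c * (x - t0) - integral {t0..x} (\<lambda>z. ?f z * (x - z))"
      using integral_equation[of t0] by blast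
    have "(U has_real_derivative (c - integral {t0..x} ?f)) (at x)" if x: "t0 < x" for x
    proof -
      have D: "((\<lambda>x. U t0 + c * (x - t0) - integral {t0..x} (\<lambda>z. ?f z * (x - z))) has_real_derivative (c - integral {t0..x} ?f)) (at x)"
        by (rule derivative_eq_intros has_derivative_repeated_integral[OF forcing_absolutely_integrable x] refl)+ simp
      have ev: "\<forall>\<^sub>F x in nhds x. U t0 + c * (x - t0) - integral {t0..x} (\<lambda>z. ?f z * (x - z)) = U x"
      proof (rule eventually_mono)
        show "\<forall>\<^sub>F x in nhds x. x \<in> {t0<..}" using x by (intro eventually_nhds_in_open) auto
        show "U t0 + c * (x - t0) - integral {t0..x} (\<lambda>z. ?f z * (x - z)) = U x" if "x \<in> {t0<..}" for x
          by (rule c[symmetric]) (use that in simp)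
      qed
      show ?thesis using D unfolding DERIV_cong_ev[OF refl ev refl] .
    qed
    then show ?thesis by blast
  qed
  then obtain c where c: "\<And>t0 x. t0 < x \<Longrightarrow> (U has_real_derivative (c t0 - integral {t0..x} ?f)) (at x)" by metis
  define U' where "U' = deriv U"
  have U': "U' x = c t0 - integral {t0..x} ?f" if "t0 < x" for t0 x
    unfolding U'_def by (rule DERIV_imp_deriv[OF c[OF that]])
  have fi: "?f integrable_on {a..b}" for a b using forcing_absolutely_integrable set_lebesgue_integral_eq_integral(1) by blast
  show thesis
  proof (rule that)
    show "(U has_real_derivative U' x) (at x)" for x
    proof -
      have "U' x = c (x - 1) - integral {x - 1..x} ?f" by (rule U') simp
      moreover have "(U has_real_derivative (c (x - 1) - integral {x - 1..x} ?f)) (at x)" by (rule c) simp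
      ultimately show ?thesis by metis
    qed
    show "U' w - U' v = - integral {v..w} ?f" if "v \<le> w" for v w
    proof -
      have "integral {v - 1..v} ?f + integral {v..w} ?f = integral {v - 1..w} ?f"
        using that by (intro Henstock_Kurzweil_Integration.integral_combine fi) auto
      moreover have "U' w = c (v - 1) - integral {v - 1..w} ?f" "U' v = c (v - 1) - integral {v - 1..v} ?f"
        using that by (auto intro!: U')
      ultimately show ?thesis by linarith
    qed
  qed
qed

end

text \<open>The slope bound makes every sequence Lipschitz on its own grid with a common constant.
  Extending it to the line with the same bounds places all sequences on one domain, where the
  theorem of Arzela and Ascoli applies.\<close>

lemma (in kick_approximations) converges:
  assumes y_bound: "\<And>n i. i < I n \<Longrightarrow> \<bar>y n i\<bar> \<le> Y"
  obtains U U' k where "strict_mono (k :: nat \<Rightarrow> nat)"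
    "\<And>x. (\<lambda>n. t (k n) (\<iota> (k n) x)) \<longlonglongrightarrow> x" "\<And>x. (\<lambda>n. u (k n) (\<iota> (k n) x)) \<longlonglongrightarrow> U x"
    "\<And>A e. 0 < e \<Longrightarrow> \<exists>n0. \<forall>n\<ge>n0. \<forall>i\<le>I (k n). \<bar>t (k n) i\<bar> \<le> A \<longrightarrow> \<bar>u (k n) i - U (t (k n) i)\<bar> < e"
    "\<And>x. (U has_real_derivative U' x) (at x)"
    "\<And>v w. v \<le> w \<Longrightarrow> U' w - U' v = - integral {v..w} (\<lambda>z. h z * g (U z))"
proof -
  have I: "0 < I 1" using cover[of 1] by (cases "I 1") auto
  have Y: "0 \<le> Y" using y_bound[OF I] by simp
  have lip: "\<bar>u n i - u n j\<bar> \<le> Y * \<bar>t n i - t n j\<bar>" if "i \<le> I n" "j \<le> I n" for n i j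
  proof -
    have *: "\<bar>u n j - u n i\<bar> \<le> Y * (t n j - t n i)" if "i \<le> j" "j \<le> I n" for i j
      using that
    proof (induction j rule: dec_induct)
      case (step j)
      have "\<bar>(t n (Suc j) - t n j) * y n j\<bar> \<le> (t n (Suc j) - t n j) * Y"
        using step t_mono[of j n] y_bound[of j n] by (simp add: abs_mult mult_left_mono)
      then show ?case using step u_Suc[of j n] by (simp add: algebra_simps)
    qed simp
    show ?thesis
    proof (cases "i \<le> j")
      case True
      then show ?thesis using *[of i j] t_le[of i j n] \<open>j \<le> I n\<close> by (simp add: abs_minus_commute)
    next
      case False
      then show ?thesis using *[of j i] t_le[of j i n] \<open>i \<le> I n\<close> by simp
    qed
  qed
  have "\<exists>V. (\<forall>x. \<bar>V x\<bar> \<le> R) \<and> (\<forall>x z. \<bar>V x - V z\<bar> \<le> Y * \<bar>x - z\<bar>) \<and> (\<forall>i\<le>I n. V (t n i) = u n i)" for n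
    by (rule Lipschitz_extension_finite[of "I n" "u n" Y "t n" R]) (use lip u_bound Y in blast)+
  then obtain V where V: "\<And>n x. \<bar>V n x\<bar> \<le> R" "\<And>n x z. \<bar>V n x - V n z\<bar> \<le> Y * \<bar>x - z\<bar>" "\<And>n i. i \<le> I n \<Longrightarrow> V n (t n i) = u n i"
    by metis
  obtain U k where k: "strict_mono (k :: nat \<Rightarrow> nat)" and U: "\<And>x z. \<bar>U x - U z\<bar> \<le> Y * \<bar>x - z\<bar>"
    and unif: "\<And>A e. 0 < e \<Longrightarrow> \<exists>n0. \<forall>n\<ge>n0. \<forall>x. \<bar>x\<bar> \<le> A \<longrightarrow> \<bar>V (k n) x - U x\<bar> < (e::real)"
    using Arzela_Ascoli_line[of V R Y, OF V(1,2)] by metis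
  have "Y-lipschitz_on UNIV U" by (rule lipschitz_onI) (use U Y in \<open>auto simp: dist_real_def\<close>)
  then have "continuous_on UNIV U" by (rule lipschitz_on_continuous_on)
  interpret K: kick_limit "\<lambda>n. t (k n)" "\<lambda>n. u (k n)" "\<lambda>n. y (k n)" "\<lambda>n. I (k n)" "\<lambda>n. mesh (k n)" h g R U
  proof (intro kick_limit.intro subsequence k kick_limit_axioms.intro)
    show "\<exists>n0. \<forall>n\<ge>n0. \<forall>i\<le>I (k n). \<bar>t (k n) i\<bar> \<le> A \<longrightarrow> \<bar>u (k n) i - U (t (k n) i)\<bar> < e" if "0 < e" for A e
      using unif[OF that, of A] V(3) by metis
  qed fact
  obtain U' where "\<And>x. (U has_real_derivative U' x) (at x)"
    "\<And>v w. v \<le> w \<Longrightarrow> U' w - U' v = - integral {v..w} (\<lambda>z. h z * g (U z))"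
    using K.limit_solves by blast
  then show thesis
    by (intro that[of k U U'] k K.t_index_tendsto K.u_index_tendsto K.unif)
qed

subsection \<open>Solutions of the limit equation\<close>

text \<open>Continuity and local absolute continuity of \<open>U'\<close> are properties of
  indefinite integrals; the equation holds almost everywhere by Lebesgue differentiation on the
  intervals \<open>(-n, n)\<close>, which have only countably many exceptional null sets.\<close>

lemma caratheodory_from_integral:
  fixes U U' f :: "real \<Rightarrow> real"
  assumes U: "\<And>x. (U has_real_derivative U' x) (at x)"
    and U': "\<And>v w. v \<le> w \<Longrightarrow> U' w - U' v = - integral {v..w} f"
    and f: "\<And>a b. f absolutely_integrable_on {a..b}"
    and F: "\<And>t. F t (U t) = f t"
  shows "caratheodory_solution F U"
proof -
  have dU: "deriv U = U'" using DERIV_imp_deriv[OF U] by blast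
  have fi: "f integrable_on {a..b}" for a b using f set_lebesgue_integral_eq_integral(1) by blast
  have eq: "U' t = U' v - integral {v..t} f" if "v \<le> t" for v t
    using U'[OF that] by simp
  have ac: "abs_continuous_on {x..y} U'" for x y
  proof (rule abs_continuous_on_indefinite_integral)
    show "(\<lambda>t. - f t) absolutely_integrable_on {x..y}"
      using absolutely_integrable_mult_continuous[OF f, of x y "\<lambda>_. - 1"] by simp
  qed (use U' in simp)
  have cont: "isCont U' x" for x
  proof -
    have "continuous_on {x - 1..x + 1} (\<lambda>t. U' (x - 1) - integral {x - 1..t} f)"
      by (intro continuous_intros indefinite_integral_continuous_1 fi)
    then have "continuous_on {x - 1..x + 1} U'"
    proof (rule continuous_on_eq)
      show "U' (x - 1) - integral {x - 1..t} f = U' t" if "t \<in> {x - 1..x + 1}" for t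
        by (rule eq[symmetric]) (use that in simp)
    qed
    then show ?thesis by (rule continuous_on_interior) simp
  qed
  have "U C1_differentiable_on UNIV"
    unfolding C1_differentiable_on_def
    by (intro exI[of _ U'] conjI ballI)
       (simp_all add: U cont continuous_at_imp_continuous_on flip: has_real_derivative_iff_has_vector_derivative)
  moreover have "locally_abs_continuous (deriv U)"
    unfolding locally_abs_continuous_def dU using ac by blast
  moreover have "AE t in lebesgue. deriv U differentiable (at t) \<and> deriv (deriv U) t + F t (U t) = 0"
  proof -
    have "AE t in lebesgue. \<forall>n::nat. t \<in> {- real n<..<real n} \<longrightarrow> ((\<lambda>t. integral {- real n..t} f) has_real_derivative f t) (at t)"
      unfolding AE_all_countable using AE_has_derivative_indefinite_integral[OF fi] by blast
    then show ?thesis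
    proof eventually_elim
      case (elim t)
      obtain n :: nat where n: "\<bar>t\<bar> < real n" using reals_Archimedean2 by blast
      then have t: "t \<in> {- real n<..<real n}" by auto
      then have "((\<lambda>t. integral {- real n..t} f) has_real_derivative f t) (at t)" using elim by blast
      then have D: "((\<lambda>t. U' (- real n) - integral {- real n..t} f) has_real_derivative - f t) (at t)"
        by (auto intro!: derivative_eq_intros)
      have ev: "\<forall>\<^sub>F s in nhds t. U' (- real n) - integral {- real n..s} f = U' s"
      proof (rule eventually_mono)
        show "\<forall>\<^sub>F s in nhds t. s \<in> {- real n<..<real n}" using t by (intro eventually_nhds_in_open) auto
        show "U' (- real n) - integral {- real n..s} f = U' s" if "s \<in> {- real n<..<real n}" for s
          by (rule eq[symmetric]) (use that in simp)
      qed
      have D': "(U' has_real_derivative - f t) (at t)" using D unfolding DERIV_cong_ev[OF refl ev refl] .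
      then show ?case unfolding dU F DERIV_imp_deriv[OF D'] using real_differentiable_def by auto
    qed
  qed
  ultimately show ?thesis unfolding caratheodory_solution_def by blast
qed

text \<open>The zero set is closed; it is open by a Gronwall estimate, as \<open>g\<close> is sublinear near zero.\<close>

lemma nonneg_solution_positive:
  fixes U U' h g :: "real \<Rightarrow> real"
  assumes U: "\<And>x. (U has_real_derivative U' x) (at x)"
    and U': "\<And>v w. v \<le> w \<Longrightarrow> U' w - U' v = - integral {v..w} (\<lambda>z. h z * g (U z))"
    and h: "\<And>a b. h absolutely_integrable_on {a..b}" and g: "continuous_on UNIV g"
    and small: "0 < \<eta>" "\<And>s. 0 \<le> s \<Longrightarrow> s \<le> \<eta> \<Longrightarrow> \<bar>g s\<bar> \<le> s"
    and nn: "\<And>t. 0 \<le> U t" and nz: "U t1 \<noteq> 0"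
  shows "0 < U t"
proof -
  have contU: "isCont U x" for x using U DERIV_isCont by blast
  have contU': "continuous_on S U" for S using contU continuous_at_imp_continuous_on by blast
  define Z where "Z = {t. U t = 0}"
  have "closed Z" unfolding Z_def by (intro closed_Collect_eq contU' continuous_intros)
  moreover have "open Z"
    unfolding open_dist
  proof
    fix t0 assume "t0 \<in> Z"
    then have U0: "U t0 = 0" by (simp add: Z_def)
    have U'0: "U' t0 = 0"
      by (rule DERIV_local_min[OF U, of 1]) (use nn U0 in auto)
    have hi: "(\<lambda>z. \<bar>h z\<bar>) integrable_on {a..b}" for a b
      using absolutely_integrable_norm[OF h, of a b] set_lebesgue_integral_eq_integral(1) by (fastforce simp: o_def)
    define H where "H = integral {t0 - 1..t0 + 1} (\<lambda>z. \<bar>h z\<bar>)"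
    have H: "0 \<le> H" unfolding H_def by (rule integral_nonneg[OF hi]) simp
    obtain d where d: "d > 0" "\<And>x. \<bar>x - t0\<bar> < d \<Longrightarrow> U x < \<eta>"
    proof -
      have "\<forall>e>0. \<exists>d>0. \<forall>x. \<bar>x - t0\<bar> < d \<longrightarrow> \<bar>U x - U t0\<bar> < e"
        using contU[of t0] unfolding continuous_at_eps_delta dist_real_def .
      then obtain d where "d > 0" "\<forall>x. \<bar>x - t0\<bar> < d \<longrightarrow> \<bar>U x - U t0\<bar> < \<eta>" using small(1) by blast
      then show thesis using U0 by (intro that[of d]) auto
    qed
    \<comment> \<open>The slope vanishes at \<open>t0\<close>, so near \<open>t0\<close> it is at
      most \<open>H * U tm\<close>, where \<open>U tm\<close> is the local maximum. The mean value
      inequality then gives \<open>U tm \<le> \<delta> * H * U tm\<close>, and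
      \<open>\<delta> * H \<le> 1 / 2\<close> forces \<open>U tm\<close> to vanish.\<close>
    define \<delta> where "\<delta> = min (d / 2) (min 1 (1 / (2 * (H + 1))))"
    have \<delta>: "0 < \<delta>" "\<delta> < d" "\<delta> \<le> 1" "\<delta> * H \<le> 1 / 2"
    proof -
      show "0 < \<delta>" "\<delta> < d" using d H by (auto simp: \<delta>_def)
      show "\<delta> \<le> 1" unfolding \<delta>_def by (intro min.coboundedI2 min.cobounded1)
      have "\<delta> * H \<le> 1 / (2 * (H + 1)) * H" using H by (intro mult_right_mono) (auto simp: \<delta>_def)
      also have "\<dots> \<le> 1 / 2" using H by (simp add: field_simps)
      finally show "\<delta> * H \<le> 1 / 2" .
    qed
    obtain tm where tm: "tm \<in> {t0 - \<delta>..t0 + \<delta>}" "\<And>x. x \<in> {t0 - \<delta>..t0 + \<delta>} \<Longrightarrow> U x \<le> U tm"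
      using continuous_attains_sup[of "{t0 - \<delta>..t0 + \<delta>}" U] contU' \<delta>(1) by auto
    have fi: "(\<lambda>z. h z * g (U z)) integrable_on {v..w}" for v w
      by (rule set_lebesgue_integral_eq_integral(1), rule absolutely_integrable_mult_continuous[OF h])
         (rule continuous_on_compose2[OF g contU'], auto)
    have est: "\<bar>integral {v..w} (\<lambda>z. h z * g (U z))\<bar> \<le> H * U tm" if vw: "{v..w} \<subseteq> {t0 - \<delta>..t0 + \<delta>}" for v w
    proof -
      have "norm (integral {v..w} (\<lambda>z. h z * g (U z))) \<le> integral {v..w} (\<lambda>z. \<bar>h z\<bar> * U tm)"
      proof (rule integral_norm_bound_integral[OF fi])
        show "(\<lambda>z. \<bar>h z\<bar> * U tm) integrable_on {v..w}" by (intro integrable_on_mult_left hi)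
        fix z assume "z \<in> {v..w}"
        then have z: "z \<in> {t0 - \<delta>..t0 + \<delta>}" using vw by blast
        then have "\<bar>z - t0\<bar> < d" using \<delta>(2) by (auto simp: abs_less_iff)
        then have "U z \<le> \<eta>" using d(2)[of z] by simp
        then have "\<bar>g (U z)\<bar> \<le> U tm" using small(2)[of "U z"] nn tm(2)[OF z] by (meson order_trans)
        then show "norm (h z * g (U z)) \<le> \<bar>h z\<bar> * U tm" by (simp add: abs_mult mult_left_mono)
      qed
      also have "\<dots> = integral {v..w} (\<lambda>z. \<bar>h z\<bar>) * U tm" by simp
      also have "integral {v..w} (\<lambda>z. \<bar>h z\<bar>) \<le> H"
        unfolding H_def by (rule integral_subset_le) (use vw \<delta>(3) hi in auto)
      finally show ?thesis using nn[of tm] by (simp add: mult_right_mono)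
    qed
    have U'est: "\<bar>U' x\<bar> \<le> H * U tm" if x: "x \<in> {t0 - \<delta>..t0 + \<delta>}" for x
    proof (cases "t0 \<le> x")
      case True
      then have "\<bar>U' x\<bar> = \<bar>integral {t0..x} (\<lambda>z. h z * g (U z))\<bar>" using U'[of t0 x] U'0 by simp
      also have "\<dots> \<le> H * U tm" by (rule est) (use x \<delta>(1) in auto)
      finally show ?thesis .
    next
      case False
      then have "\<bar>U' x\<bar> = \<bar>integral {x..t0} (\<lambda>z. h z * g (U z))\<bar>" using U'[of x t0] U'0 by simp
      also have "\<dots> \<le> H * U tm" by (rule est) (use x \<delta>(1) in auto)
      finally show ?thesis .
    qed
    have "norm (U tm - U t0) \<le> H * U tm * norm (tm - t0)"
    proof (rule field_differentiable_bound[of "{t0 - \<delta>..t0 + \<delta>}" U U'])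
      show "(U has_field_derivative U' z) (at z within {t0 - \<delta>..t0 + \<delta>})" for z
        using U by (rule has_field_derivative_at_within)
      show "norm (U' z) \<le> H * U tm" if "z \<in> {t0 - \<delta>..t0 + \<delta>}" for z using U'est[OF that] by simp
    qed (use tm \<delta> in auto)
    then have "U tm \<le> H * U tm * \<bar>tm - t0\<bar>" using U0 by (simp add: abs_le_iff)
    also have "\<dots> \<le> H * U tm * \<delta>" using tm(1) H nn[of tm] by (intro mult_left_mono) (auto simp: abs_le_iff)
    also have "\<dots> = \<delta> * H * U tm" by simp
    also have "\<dots> \<le> 1 / 2 * U tm" using \<delta>(4) nn[of tm] by (rule mult_right_mono)
    finally have "U tm \<le> 0" by simp
    show "\<exists>e>0. \<forall>x. dist x t0 < e \<longrightarrow> x \<in> Z"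
    proof (intro exI[of _ \<delta>] conjI allI impI)
      fix x assume "dist x t0 < \<delta>"
      then have "U x \<le> U tm" by (intro tm(2)) (auto simp: dist_real_def)
      then show "x \<in> Z" using nn[of x] \<open>U tm \<le> 0\<close> by (simp add: Z_def)
    qed (use \<delta> in simp)
  qed
  ultimately have "Z = {} \<or> Z = UNIV" using clopen by blast
  then have "U t \<noteq> 0" using nz by (auto simp: Z_def)
  then show ?thesis using nn[of t] by simp
qed

subsection \<open>Weights with alternating signs\<close>

lemma integral_cells:
  fixes t :: "nat \<Rightarrow> real" and f :: "real \<Rightarrow> real"
  assumes t: "\<And>i. i < b \<Longrightarrow> t i \<le> t (Suc i)" and f: "\<And>x z. f integrable_on {x..z}" and ab: "a \<le> b"
  shows "(\<Sum>i=a..<b. integral {t i..t (Suc i)} f) = integral {t a..t b} f"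
proof -
  have "(\<Sum>i=a..<j. integral {t i..t (Suc i)} f) = integral {t a..t j} f" if "a \<le> j" "j \<le> b" for j
    using that
  proof (induction j rule: dec_induct)
    case (step j)
    have "t a \<le> t j" "t j \<le> t (Suc j)" using grid_mono[of b t a j] t step by auto
    then show ?case using step Henstock_Kurzweil_Integration.integral_combine[of "t a" "t j" "t (Suc j)" f] f by simp
  qed simp
  then show ?thesis using ab by simp
qed

lemma positive_min_on_interval:
  fixes g :: "real \<Rightarrow> real"
  assumes "continuous_on UNIV g" "\<And>x. 0 < x \<Longrightarrow> 0 < g x" "0 < p"
  obtains \<gamma> where "0 < \<gamma>" "\<And>x. p \<le> x \<Longrightarrow> x \<le> q \<Longrightarrow> \<gamma> \<le> g x"
proof (cases "p \<le> q")
  case True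
  obtain x where "x \<in> {p..q}" "\<And>z. z \<in> {p..q} \<Longrightarrow> g x \<le> g z"
    using continuous_attains_inf[of "{p..q}" g] True continuous_on_subset[OF assms(1)] by auto
  then show thesis using assms by (intro that[of "g x"]) auto
qed (auto intro: that[of 1])

text \<open>In the application \<open>[E (2 * j), E (2 * j + 1)]\<close> is $I^{+}_{i,\ell}$ with \<open>j = i + \<ell> m\<close>; the mass of
  the weight away from the ends of a block, where the block is cut into \<open>c\<close> equal parts, is at least \<open>c0\<close>.\<close>

locale sign_blocks =
  fixes a :: "real \<Rightarrow> real" and E :: "int \<Rightarrow> real" and l L A0 c0 :: real and c :: nat
  assumes a_int: "\<And>x z. a absolutely_integrable_on {x..z}"
    and len: "0 < l" "\<And>q. l \<le> E (q + 1) - E q" "\<And>q. E (q + 1) - E q \<le> L"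
    and a_even: "\<And>q. even q \<Longrightarrow> negligible {t \<in> {E q..E (q + 1)}. a t < 0}"
    and a_odd: "\<And>q. odd q \<Longrightarrow> negligible {t \<in> {E q..E (q + 1)}. 0 < a t}"
    and mass: "\<And>q. \<bar>integral {E q..E (q + 1)} a\<bar> \<le> A0"
    and core: "2 \<le> c" "0 < c0" 
      "\<And>q. c0 \<le> \<bar>integral {E q + (E (q + 1) - E q) / real c..E (q + 1) - (E (q + 1) - E q) / real c} a\<bar>"
begin

definition h :: "real \<Rightarrow> real \<Rightarrow> real \<Rightarrow> real" where "h lam \<mu> t = lam * pos_part a t - \<mu> * neg_part a t"

lemma h_int: "h lam \<mu> absolutely_integrable_on {x..z}"
proof -
  have neg: "(\<lambda>t. - a t) absolutely_integrable_on {x..z}"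
    using absolutely_integrable_mult_continuous[OF a_int, of x z "\<lambda>_. - 1"] by simp
  have p: "pos_part a absolutely_integrable_on {x..z}"
    unfolding pos_part_def by (rule absolutely_integrable_max_1[OF a_int]) simp
  have n: "neg_part a absolutely_integrable_on {x..z}"
    unfolding neg_part_def by (rule absolutely_integrable_max_1[OF neg]) simp
  have "(\<lambda>t. pos_part a t * lam) absolutely_integrable_on {x..z}" "(\<lambda>t. neg_part a t * \<mu>) absolutely_integrable_on {x..z}"
    by (rule absolutely_integrable_mult_continuous; fact p n continuous_on_const)+
  from set_integral_diff(1)[OF this] show ?thesis
    by (simp add: h_def[abs_def] mult.commute)
qed

lemma h_integrable: "h lam \<mu> integrable_on {x..z}"
  using h_int set_lebesgue_integral_eq_integral(1) by blast

lemma integral_h_even: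
  assumes "even q" "{x..z} \<subseteq> {E q..E (q + 1)}"
  shows "integral {x..z} (h lam \<mu>) = lam * integral {x..z} a"
proof -
  have "integral {x..z} (h lam \<mu>) = integral {x..z} (\<lambda>t. lam * a t)"
    by (rule integral_spike[OF a_even[OF assms(1)]])
       (use assms(2) in \<open>auto simp: h_def pos_part_def neg_part_def max_def not_less\<close>)
  then show ?thesis by simp
qed

lemma integral_h_odd:
  assumes "odd q" "{x..z} \<subseteq> {E q..E (q + 1)}"
  shows "integral {x..z} (h lam \<mu>) = \<mu> * integral {x..z} a"
proof -
  have "integral {x..z} (h lam \<mu>) = integral {x..z} (\<lambda>t. \<mu> * a t)"
    by (rule integral_spike[OF a_odd[OF assms(1)]])
       (use assms(2) in \<open>auto simp: h_def pos_part_def neg_part_def max_def not_less\<close>)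
  then show ?thesis by simp
qed

lemma integral_a_even:
  assumes "even q" "{x..z} \<subseteq> {E q..E (q + 1)}"
  shows "0 \<le> integral {x..z} a"
proof -
  have "integral {x..z} (\<lambda>t. max (a t) 0) = integral {x..z} a"
    by (rule integral_spike[OF a_even[OF assms(1)]]) (use assms(2) in \<open>auto simp: max_def not_less\<close>)
  moreover have "0 \<le> integral {x..z} (\<lambda>t. max (a t) 0)"
    by (cases "(\<lambda>t. max (a t) 0) integrable_on {x..z}") (auto intro: integral_nonneg simp: not_integrable_integral)
  ultimately show ?thesis by simp
qed

lemma integral_a_odd:
  assumes "odd q" "{x..z} \<subseteq> {E q..E (q + 1)}"
  shows "integral {x..z} a \<le> 0"
proof -
  have "integral {x..z} (\<lambda>t. - max (- a t) 0) = integral {x..z} a"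
    by (rule integral_spike[OF a_odd[OF assms(1)]]) (use assms(2) in \<open>auto simp: max_def not_less\<close>)
  moreover have "0 \<le> integral {x..z} (\<lambda>t. max (- a t) 0)"
    by (cases "(\<lambda>t. max (- a t) 0) integrable_on {x..z}") (auto intro: integral_nonneg simp: not_integrable_integral)
  ultimately show ?thesis by simp
qed

lemma E_mono: "E q + real n * l \<le> E (q + int n)"
proof (induction n)
  case (Suc n)
  then show ?case using len(2)[of "q + int n"] by (simp add: algebra_simps)
qed simp

text \<open>The grid starts at \<open>E q0\<close>. Cells have equal length within a block, as the
  chord inequalities require, but their length varies from block to block.\<close>

definition grid :: "int \<Rightarrow> nat \<Rightarrow> nat \<Rightarrow> real" where
  "grid q0 N i = E (q0 + int (i div N)) + real (i mod N) / real N * (E (q0 + int (i div N) + 1) - E (q0 + int (i div N)))"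

lemma grid_block:
  assumes "0 < N" "p \<le> N"
  shows "grid q0 N (q * N + p) = E (q0 + int q) + real p / real N * (E (q0 + int q + 1) - E (q0 + int q))"
proof (cases "p = N")
  case True
  have "(q * N + N) div N = Suc q" "(q * N + N) mod N = 0" using assms(1) by (simp_all add: div_mult_self1)
  then show ?thesis using True assms by (simp add: grid_def algebra_simps)
next
  case False
  then show ?thesis using assms by (simp add: grid_def)
qed

lemma grid_step:
  assumes "0 < N" "p < N"
  shows "grid q0 N (Suc (q * N + p)) - grid q0 N (q * N + p) = (E (q0 + int q + 1) - E (q0 + int q)) / real N"
  using grid_block[of N "Suc p" q0 q] grid_block[of N p q0 q] assms by (simp add: field_simps)

lemma grid_step':
  assumes "0 < N"
  shows "l / real N \<le> grid q0 N (Suc i) - grid q0 N i" "grid q0 N (Suc i) - grid q0 N i \<le> L / real N"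
proof -
  have "i = (i div N) * N + i mod N" by simp
  then have "grid q0 N (Suc i) - grid q0 N i = (E (q0 + int (i div N) + 1) - E (q0 + int (i div N))) / real N"
    using grid_step[OF assms, of "i mod N" q0 "i div N"] assms by simp
  then show "l / real N \<le> grid q0 N (Suc i) - grid q0 N i" "grid q0 N (Suc i) - grid q0 N i \<le> L / real N"
    using len assms by (auto intro!: divide_right_mono)
qed

lemma grid_less: "0 < N \<Longrightarrow> grid q0 N i < grid q0 N (Suc i)"
  using grid_step'(1)[of N q0 i] len(1) by (smt (verit) divide_pos_pos of_nat_0_less_iff)

lemma grid_in_block:
  assumes "0 < N" "p \<le> N"
  shows "grid q0 N (q * N + p) \<in> {E (q0 + int q)..E (q0 + int q + 1)}"
proof -
  let ?d = "E (q0 + int q + 1) - E (q0 + int q)"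
  have "0 \<le> ?d" using len(1) len(2)[of "q0 + int q"] by linarith
  moreover have "0 \<le> real p / real N" "real p / real N \<le> 1" using assms by auto
  ultimately have "0 \<le> real p / real N * ?d" "real p / real N * ?d \<le> 1 * ?d"
    by (simp, intro mult_right_mono) auto
  then show ?thesis unfolding grid_block[OF assms] by simp
qed

end

section \<open>Discrete problems with codes on a window of blocks\<close>

locale thresholds = sign_blocks +
  fixes g :: "real \<Rightarrow> real" and lam \<mu> \<kappa> \<gamma> \<delta> r1 r2 \<rho>1 \<rho>2 R :: real
  assumes g_cont: "continuous_on UNIV g" and g_nonneg: "\<And>x. 0 \<le> g x" and g_nonpos: "\<And>x. x \<le> 0 \<Longrightarrow> g x = 0"
    and lam_pos: "0 < lam" and \<mu>_pos: "0 < \<mu>"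
    and order: "0 < \<delta>" "2 * \<delta> \<le> r1" "r1 \<le> r2" "r2 \<le> \<rho>1" "\<rho>1 \<le> \<rho>2" "\<rho>2 \<le> R"
    and pass: "\<And>Q x. Q \<in> {r1, r2, R} \<Longrightarrow> x \<le> Q \<Longrightarrow> g x \<le> \<kappa> * Q" "0 \<le> \<kappa>" "4 * L * (lam * A0) * \<kappa> < 1"
    and die: "\<And>X. X \<in> {\<rho>1, \<rho>2} \<Longrightarrow> \<exists>\<gamma>\<ge>0. (\<forall>x. X / real c \<le> x \<and> x \<le> X \<longrightarrow> \<gamma> \<le> g x) \<and>
                  2 * X < l / real c * (lam * c0) * \<gamma>"
    and dip: "0 \<le> \<gamma>" "\<And>x. \<delta> \<le> x \<Longrightarrow> x \<le> R \<Longrightarrow> \<gamma> \<le> g x" "2 * R < l / real c * (\<mu> * c0) * \<gamma>"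
begin

abbreviation H :: "real \<Rightarrow> real" where "H \<equiv> h lam \<mu>"

text \<open>The bound of \<open>block_slope_bound\<close> with the larger of the two kick masses. It
  contains neither the number of cells nor the window, so it serves all approximations at
  once.\<close>

definition slope_bound :: real where
  "slope_bound = R / l + max lam \<mu> * A0 * (SUP x\<in>{0..R}. g x)"

lemma g_le_Sup: "0 \<le> x \<Longrightarrow> x \<le> R \<Longrightarrow> g x \<le> (SUP x\<in>{0..R}. g x)"
proof -
  have "bdd_above (g ` {0..R})"
    by (intro bounded_imp_bdd_above compact_imp_bounded compact_continuous_image continuous_on_subset[OF g_cont]) auto
  then show "0 \<le> x \<Longrightarrow> x \<le> R \<Longrightarrow> g x \<le> (SUP x\<in>{0..R}. g x)" by (intro cSUP_upper) auto
qed

context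
  fixes n :: nat and q0 :: int and N :: nat
  assumes q0: "odd q0" and N: "N = c * Suc n"
begin

lemma N0: "0 < N"
  using N core by simp

lemma N_ge: "Suc n \<le> N"
proof -
  have "1 * Suc n \<le> c * Suc n" using core(1) by (intro mult_le_mono1) simp
  then show ?thesis unfolding N by simp
qed

lemma core_fraction: "real (Suc n) / real N = 1 / real c"
  unfolding N of_nat_mult by (simp del: of_nat_Suc)

lemma cell_sub:
  assumes "i \<le> j" "j \<le> N"
  shows "{grid q0 N (q * N + i)..grid q0 N (q * N + j)} \<subseteq> {E (q0 + int q)..E (q0 + int q + 1)}"
  using grid_in_block[OF N0, of i q0 q] grid_in_block[OF N0, of j q0 q] assms by auto

lemma cells:
  assumes "i \<le> j" "j \<le> N"
  shows "(\<Sum>p=i..<j. integral {grid q0 N (q * N + p)..grid q0 N (Suc (q * N + p))} H)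
    = integral {grid q0 N (q * N + i)..grid q0 N (q * N + j)} H"
  using integral_cells[of j "\<lambda>p. grid q0 N (q * N + p)" H i] grid_less[OF N0] h_integrable assms
  by (simp add: less_imp_le)

lemma whole_block: "grid q0 N (q * N + 0) = E (q0 + int q)" "grid q0 N (q * N + N) = E (q0 + int q + 1)"
  using grid_block[OF N0, of 0 q0 q] grid_block[OF N0, of N q0 q] N0 by simp_all

text \<open>As \<open>N\<close> is a multiple of \<open>c\<close>, the points at the fractions
  \<open>1 / c\<close> and \<open>1 - 1 / c\<close> of a block are grid points for every refinement
  \<open>n\<close>. The mass bound \<open>c0\<close> of the weight thus carries over to the kicks
  without an error term.\<close>

lemma core_block:
  "grid q0 N (q * N + Suc n) = E (q0 + int q) + (E (q0 + int q + 1) - E (q0 + int q)) / real c"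
  "grid q0 N (q * N + (N - Suc n)) = E (q0 + int q + 1) - (E (q0 + int q + 1) - E (q0 + int q)) / real c"
proof -
  note le = N_ge and r1 = core_fraction
  have r2: "real (N - Suc n) / real N = 1 - 1 / real c"
    using le N0 r1 by (simp add: of_nat_diff diff_divide_distrib)
  show "grid q0 N (q * N + Suc n) = E (q0 + int q) + (E (q0 + int q + 1) - E (q0 + int q)) / real c"
    unfolding grid_block[OF N0 le] r1 by simp
  show "grid q0 N (q * N + (N - Suc n)) = E (q0 + int q + 1) - (E (q0 + int q + 1) - E (q0 + int q)) / real c"
    unfolding grid_block[OF N0 diff_le_self] r2 by (simp add: left_diff_distrib)
qed

lemma core_le: "Suc n \<le> N - Suc n"
proof -
  have "2 * Suc n \<le> N" unfolding N using core by (intro mult_right_mono) auto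
  then show ?thesis by simp
qed

text \<open>Since \<open>q0\<close> is odd, parities are exchanged: the even blocks of
  \<open>shooting\<close> are odd blocks of \<open>E\<close>, where the weight is negative. The
  kicks are minus the cell integrals of \<open>H\<close>, and the margin of \<open>Suc n\<close>
  cells has length at least \<open>l / c\<close>.\<close>

lemma shooting_grid:
  "shooting g (\<lambda>i. grid q0 N (Suc i) - grid q0 N i) (\<lambda>i. - integral {grid q0 N i..grid q0 N (Suc i)} H)
     (\<lambda>q. (E (q0 + int q + 1) - E (q0 + int q)) / real N) N (Suc n) c L (lam * c0) (\<mu> * c0) (lam * A0) \<kappa> \<gamma> \<delta> r1 r2 \<rho>1 \<rho>2 R"
proof
  show "continuous_on UNIV g" "\<And>x. 0 \<le> g x" "\<And>x. x \<le> 0 \<Longrightarrow> g x = 0" by (fact g_cont g_nonneg g_nonpos)+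
  show "N = c * Suc n" "0 < Suc n" "2 \<le> c" using N core by auto
  show "0 < (E (q0 + int q + 1) - E (q0 + int q)) / real N" for q
    using len(1) len(2)[of "q0 + int q"] N0 by simp
  show "grid q0 N (Suc (q * N + p)) - grid q0 N (q * N + p) = (E (q0 + int q + 1) - E (q0 + int q)) / real N" if "p < N" for q p
    by (rule grid_step[OF N0 that])
  show "0 < L" using len(1) len(2)[of 0] len(3)[of 0] by linarith
  show "real N * ((E (q0 + int q + 1) - E (q0 + int q)) / real N) \<le> L" for q using len(3) N0 by simp
  show "0 \<le> - integral {grid q0 N (q * N + p)..grid q0 N (Suc (q * N + p))} H" if "even q" "p < N" for q p
  proof -
    have o: "odd (q0 + int q)" using q0 that by simp
    have sub: "{grid q0 N (q * N + p)..grid q0 N (Suc (q * N + p))} \<subseteq> {E (q0 + int q)..E (q0 + int q + 1)}"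
      using cell_sub[of p "Suc p" q] that by simp
    show ?thesis unfolding integral_h_odd[OF o sub] using integral_a_odd[OF o sub] \<mu>_pos by (simp add: mult_le_0_iff)
  qed
  have ev: "even (q0 + int q)" if "odd q" for q using q0 that by simp
  show "- integral {grid q0 N (q * N + p)..grid q0 N (Suc (q * N + p))} H \<le> 0" if "odd q" "p < N" for q p
  proof -
    have sub: "{grid q0 N (q * N + p)..grid q0 N (Suc (q * N + p))} \<subseteq> {E (q0 + int q)..E (q0 + int q + 1)}"
      using cell_sub[of p "Suc p" q] that by simp
    show ?thesis unfolding integral_h_even[OF ev[OF that(1)] sub] using integral_a_even[OF ev[OF that(1)] sub] lam_pos by simp
  qed
  show "(\<Sum>p<N. - (- integral {grid q0 N (q * N + p)..grid q0 N (Suc (q * N + p))} H)) \<le> lam * A0" if "odd q" for q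
  proof -
    have "(\<Sum>p<N. - (- integral {grid q0 N (q * N + p)..grid q0 N (Suc (q * N + p))} H)) = integral {E (q0 + int q)..E (q0 + int q + 1)} H"
      using cells[of 0 N q] unfolding whole_block by (simp add: atLeast0LessThan)
    also have "\<dots> = lam * integral {E (q0 + int q)..E (q0 + int q + 1)} a" by (rule integral_h_even[OF ev[OF that]]) simp
    also have "\<dots> \<le> lam * A0" using mass[of "q0 + int q"] lam_pos by (intro mult_left_mono) auto
    finally show ?thesis .
  qed
  let ?C = "\<lambda>q. {E (q0 + int q) + (E (q0 + int q + 1) - E (q0 + int q)) / real c..E (q0 + int q + 1) - (E (q0 + int q + 1) - E (q0 + int q)) / real c}"
  have C: "(\<Sum>p=Suc n..<N - Suc n. integral {grid q0 N (q * N + p)..grid q0 N (Suc (q * N + p))} H) = integral (?C q) H" for q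
    using cells[OF core_le, of q] unfolding core_block by simp
  have sub: "?C q \<subseteq> {E (q0 + int q)..E (q0 + int q + 1)}" for q
    using cell_sub[OF core_le, of q] unfolding core_block by simp
  show "lam * c0 \<le> (\<Sum>p=Suc n..<N - Suc n. - (- integral {grid q0 N (q * N + p)..grid q0 N (Suc (q * N + p))} H))" if "odd q" for q
    using core(3)[of "q0 + int q"] integral_a_even[OF ev[OF that] sub] lam_pos
    unfolding minus_minus C integral_h_even[OF ev[OF that] sub] by (intro mult_left_mono) auto
  show "\<mu> * c0 \<le> (\<Sum>p=Suc n..<N - Suc n. - integral {grid q0 N (q * N + p)..grid q0 N (Suc (q * N + p))} H)" if "even q" for q
  proof -
    have o: "odd (q0 + int q)" using q0 that by simp
    have "\<mu> * c0 \<le> \<mu> * - integral (?C q) a"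
      using core(3)[of "q0 + int q"] integral_a_odd[OF o sub] \<mu>_pos by (intro mult_left_mono) auto
    then show ?thesis unfolding sum_negf C integral_h_odd[OF o sub] by simp
  qed
  have lc: "l / real c \<le> real (Suc n) * ((E (q0 + int q + 1) - E (q0 + int q)) / real N)" for q
  proof -
    have "real (Suc n) * ((E (q0 + int q + 1) - E (q0 + int q)) / real N) = (E (q0 + int q + 1) - E (q0 + int q)) / real c"
      using core_fraction by (simp add: divide_inverse mult_ac del: of_nat_Suc)
    then show ?thesis using len(2)[of "q0 + int q"] core by (simp add: divide_right_mono)
  qed
  show "\<exists>\<gamma>\<ge>0. (\<forall>x. X / real c \<le> x \<and> x \<le> X \<longrightarrow> \<gamma> \<le> g x) \<and>
     (\<forall>q. 2 * X < real (Suc n) * ((E (q0 + int q + 1) - E (q0 + int q)) / real N) * (lam * c0) * \<gamma>)" if X: "X \<in> {\<rho>1, \<rho>2}" for X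
  proof -
    obtain \<gamma> where \<gamma>: "\<gamma> \<ge> 0" "\<forall>x. X / real c \<le> x \<and> x \<le> X \<longrightarrow> \<gamma> \<le> g x" "2 * X < l / real c * (lam * c0) * \<gamma>"
      using die[OF X] by blast
    have "l / real c * (lam * c0) * \<gamma> \<le> real (Suc n) * ((E (q0 + int q + 1) - E (q0 + int q)) / real N) * (lam * c0) * \<gamma>" for q
      using lc[of q] \<gamma>(1) lam_pos core by (intro mult_right_mono) auto
    then show ?thesis using \<gamma> by (meson less_le_trans)
  qed
  show "2 * R < real (Suc n) * ((E (q0 + int q + 1) - E (q0 + int q)) / real N) * (\<mu> * c0) * \<gamma>" for q
  proof -
    have "l / real c * (\<mu> * c0) * \<gamma> \<le> real (Suc n) * ((E (q0 + int q + 1) - E (q0 + int q)) / real N) * (\<mu> * c0) * \<gamma>"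
      using lc[of q] dip(1) \<mu>_pos core by (intro mult_right_mono) auto
    then show ?thesis using dip(3) by linarith
  qed
qed (use order pass dip in auto)

text \<open>All kicks of a block have the same sign, so the sum of absolute values collapses to a
  multiple of one integral of \<open>a\<close> over the block.\<close>

lemma kicks_abs_sum:
  "(\<Sum>p<N. \<bar>integral {grid q0 N (q * N + p)..grid q0 N (Suc (q * N + p))} H\<bar>) \<le> max lam \<mu> * A0"
proof -
  let ?q = "q0 + int q"
  define m where "m = (if even ?q then lam else \<mu>)"
  define sg :: real where "sg = (if even ?q then 1 else - 1)"
  have m: "0 < m" "m \<le> max lam \<mu>" using lam_pos \<mu>_pos by (auto simp: m_def)
  have hm: "integral {x..z} H = m * integral {x..z} a" "0 \<le> sg * integral {x..z} a" if "{x..z} \<subseteq> {E ?q..E (?q + 1)}" for x z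
    using that integral_h_even[of ?q x z] integral_h_odd[of ?q x z] integral_a_even[of ?q x z] integral_a_odd[of ?q x z]
    by (auto simp: m_def sg_def)
  have sg: "\<bar>v\<bar> = sg * v" if "0 \<le> sg * v" for v using that by (auto simp: sg_def split: if_splits)
  have "\<bar>integral {grid q0 N (q * N + p)..grid q0 N (Suc (q * N + p))} H\<bar> = sg * integral {grid q0 N (q * N + p)..grid q0 N (Suc (q * N + p))} H"
    if "p < N" for p
  proof (rule sg)
    have sub: "{grid q0 N (q * N + p)..grid q0 N (Suc (q * N + p))} \<subseteq> {E ?q..E (?q + 1)}"
      using cell_sub[of p "Suc p" q] that by simp
    show "0 \<le> sg * integral {grid q0 N (q * N + p)..grid q0 N (Suc (q * N + p))} H"
      using mult_nonneg_nonneg[OF less_imp_le[OF m(1)] hm(2)[OF sub]] unfolding hm(1)[OF sub] by (simp add: mult_ac)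
  qed
  then have "(\<Sum>p<N. \<bar>integral {grid q0 N (q * N + p)..grid q0 N (Suc (q * N + p))} H\<bar>)
      = (\<Sum>p<N. sg * integral {grid q0 N (q * N + p)..grid q0 N (Suc (q * N + p))} H)" by (intro sum.cong) auto
  also have "\<dots> = sg * integral {E ?q..E (?q + 1)} H"
    using cells[of 0 N q] unfolding whole_block by (simp add: atLeast0LessThan sum_distrib_left[symmetric])
  also have "\<dots> = m * \<bar>integral {E ?q..E (?q + 1)} a\<bar>"
    using hm[of "E ?q" "E (?q + 1)"] sg by simp
  also have "\<dots> \<le> max lam \<mu> * A0" using m mass[of ?q] lam_pos by (intro mult_mono) auto
  finally show ?thesis .
qed

end

text \<open>The codes are expressed by grid points in place of a maximum, and only for positive
  blocks inside \<open>[-n, n]\<close>: the upper bound at every grid point of the block, the lower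
  bound at one of them. In this form each of them passes to the limit.\<close>

definition discrete_solution :: "(int \<Rightarrow> nat) \<Rightarrow> nat \<Rightarrow> nat \<Rightarrow> (nat \<Rightarrow> real) \<Rightarrow> (nat \<Rightarrow> real) \<Rightarrow> (nat \<Rightarrow> real) \<Rightarrow> bool" where
  "discrete_solution S n I t u y \<longleftrightarrow>
    (\<forall>i<I. t i < t (Suc i) \<and> t (Suc i) - t i \<le> L / real (Suc n)) \<and> t 0 \<le> - real n \<and> real n \<le> t I \<and>
    (\<forall>i<I. u (Suc i) = u i + (t (Suc i) - t i) * y i) \<and>
    (\<forall>i<I. y (Suc i) = y i - integral {t i..t (Suc i)} H * g (u (Suc i))) \<and>
    (\<forall>i\<le>I. 0 \<le> u i \<and> u i \<le> R) \<and> (\<forall>i<I. \<bar>y i\<bar> \<le> slope_bound) \<and>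
    (\<forall>j. - real n \<le> E (2 * j) \<and> E (2 * j + 1) \<le> real n \<longrightarrow>
       (\<forall>i\<le>I. t i \<in> {E (2 * j)..E (2 * j + 1)} \<longrightarrow> u i \<le> code_hi r1 \<rho>1 R (S j)) \<and>
       (\<exists>i\<le>I. t i \<in> {E (2 * j)..E (2 * j + 1)} \<and> code_lo r2 \<rho>2 (S j) \<le> u i))"

lemma discrete_problem:
  fixes S :: "int \<Rightarrow> nat" and n :: nat
  assumes S: "\<And>j. S j \<in> {0, 1, 2}"
  obtains I t u y where "discrete_solution S n I t u y"
proof -
  obtain k :: nat where "(E 1 + real n) / (2 * l) \<le> real k" using real_arch_simple by blast
  then have k: "E 1 + real n \<le> real (2 * k) * l" using len(1) by (simp add: field_simps)
  \<comment> \<open>Going back \<open>2 * k\<close> blocks from \<open>E 1\<close> covers a length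
    of at least \<open>2 * k * l\<close>, hence reaches \<open>- n\<close>; the step is even so that
    \<open>q0\<close> stays odd and the window begins with a negative block.\<close>
  define q0 where "q0 = 1 - 2 * int k"
  have q0: "odd q0" "E q0 \<le> - real n"
    using E_mono[of q0 "2 * k"] k by (auto simp: q0_def)
  obtain J :: nat where "(real n - E q0) / (2 * l) \<le> real J" using real_arch_simple by blast
  then have J: "real n \<le> E q0 + real (2 * J) * l" using len(1) by (simp add: field_simps)
  then have EJ: "real n \<le> E (q0 + 2 * int J)" using E_mono[of q0 "2 * J"] by simp
  define N where "N = c * Suc n"
  have N: "0 < N" "Suc n \<le> N" using N0[OF q0(1) N_def] N_ge[OF q0(1) N_def] by auto
  let ?t = "grid q0 N"
  interpret S: shooting g "\<lambda>i. ?t (Suc i) - ?t i" "\<lambda>i. - integral {?t i..?t (Suc i)} H"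
     "\<lambda>q. (E (q0 + int q + 1) - E (q0 + int q)) / real N" N "Suc n" c L "lam * c0" "\<mu> * c0" "lam * A0" \<kappa> \<gamma> \<delta> r1 r2 \<rho>1 \<rho>2 R
    by (rule shooting_grid[OF q0(1) N_def])
  \<comment> \<open>Block \<open>2 * j + 1\<close> of the window is block
    \<open>q0 + 2 * j + 1 = 2 * (j + 1 - k)\<close> of the line.\<close>
  define S' where "S' j = S (int j + 1 - int k)" for j
  have S': "S' j \<in> {0, 1, 2}" for j using S by (simp add: S'_def)
  obtain s where s: "S.reaches S' J s" using S.reaches_path[where J = J, OF S'] by (meson ends_in_segment)
  define u where "u = S.u s"
  define y where "y = S.y s"
  \<comment> \<open>The approximation ends with the last coded positive block, the range covered by
    \<open>S.reaches_bounded\<close>.\<close>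
  define I where "I = 2 * J * N"
  have u_nn: "0 \<le> u i" if "i \<le> (2 * J + 1) * N" for i
    using s that unfolding S.reaches_def u_def by blast
  have u_R: "u i \<le> R" if "i \<le> I" for i
    using S.reaches_bounded[OF s S'] that unfolding u_def I_def by blast
  have tq: "?t (q * N) = E (q0 + int q)" for q
    using whole_block(1)[OF q0(1) N_def, of q] by simp
  have t_mono: "?t i \<le> ?t j" if "i \<le> j" for i j
    by (rule grid_mono[OF _ that order_refl]) (simp add: grid_less[OF N(1)] less_imp_le)
  have t_less: "?t i < ?t j" if "i < j" for i j
    using grid_less[OF N(1), of q0 i] t_mono[of "Suc i" j] that by simp
  have "discrete_solution S n I ?t u y"
    unfolding discrete_solution_def
  proof (intro conjI allI impI)
    fix i assume "i < I"
    show "?t i < ?t (Suc i)" by (rule grid_less[OF N(1)])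
    have "L / real N \<le> L / real (Suc n)" using N S.L(1) by (intro divide_left_mono) auto
    then show "?t (Suc i) - ?t i \<le> L / real (Suc n)" using grid_step'(2)[OF N(1), of q0 i] by linarith
    show "u (Suc i) = u i + (?t (Suc i) - ?t i) * y i" unfolding u_def y_def by (rule S.u_Suc)
    show "y (Suc i) = y i - integral {?t i..?t (Suc i)} H * g (u (Suc i))" unfolding u_def y_def S.y_Suc by simp
    show "\<bar>y i\<bar> \<le> slope_bound"
    proof -
      define q where "q = i div N"
      define p where "p = i mod N"
      have ipq: "i = q * N + p" "p < N" using N by (simp_all add: q_def p_def)
      have "q < 2 * J" unfolding q_def using \<open>i < I\<close> N unfolding I_def by (simp add: less_mult_imp_div_less)
      then have "(q + 1) * N \<le> 2 * J * N" by (intro mult_right_mono) auto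
      then have qI: "q * N + p' \<le> I" if "p' \<le> N" for p' using that by (simp add: I_def)
      have "\<bar>y (q * N + p)\<bar> \<le> R / l + max lam \<mu> * A0 * (SUP x\<in>{0..R}. g x)"
      proof (rule block_slope_bound[where u = "\<lambda>p. u (q * N + p)" and N = N and w = "\<lambda>p. - integral {?t (q * N + p)..?t (Suc (q * N + p))} H" and g = g and p = p
            and y = "\<lambda>p. y (q * N + p)" and D = "(E (q0 + int q + 1) - E (q0 + int q)) / real N"])
        show "(\<Sum>p<N. \<bar>- integral {?t (q * N + p)..?t (Suc (q * N + p))} H\<bar>) \<le> max lam \<mu> * A0"
          using kicks_abs_sum[OF q0(1) N_def] by simp
        show "0 \<le> u (q * N + p)" if "p \<le> N" for p using qI[OF that] by (intro u_nn) (simp add: I_def)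
        show "0 \<le> (SUP x\<in>{0..R}. g x)" using g_le_Sup[of 0] g_nonneg[of 0] order by (smt (verit))
        show "\<bar>g x\<bar> \<le> (SUP x\<in>{0..R}. g x)" if "0 \<le> x" "x \<le> R" for x using g_le_Sup[OF that] g_nonneg[of x] by simp
      qed (use S.block_u S.block_y S.D_pos N len ipq u_R qI in \<open>auto simp: u_def y_def\<close>)
      then show ?thesis by (simp add: slope_bound_def ipq)
    qed
  next
    show "?t 0 \<le> - real n" using tq[of 0] q0 by simp
    show "real n \<le> ?t I" unfolding I_def tq using EJ by simp
  next
    fix i assume "i \<le> I"
    then show "0 \<le> u i" "u i \<le> R" using u_nn u_R by (auto simp: I_def)
  next
    fix j assume j: "- real n \<le> E (2 * j) \<and> E (2 * j + 1) \<le> real n"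
    have E_le: "q \<le> q'" if "E q \<le> E q'" for q q'
    proof (rule ccontr)
      assume "\<not> ?thesis"
      then have "E q' + real (nat (q - q')) * l \<le> E q" "0 < nat (q - q')" using E_mono[of q' "nat (q - q')"] by auto
      then show False using that len(1) by (smt (verit) mult_pos_pos of_nat_0_less_iff)
    qed
    have "q0 \<le> 2 * j" "2 * j + 1 \<le> q0 + 2 * int J" using E_le j q0 EJ by force+
    then obtain jn :: nat where jn: "j = int jn + 1 - int k" "jn < J"
      by (intro that[of "nat (j - 1 + int k)"]) (auto simp: q0_def)
    define q where "q = 2 * jn + 1"
    have q: "q0 + int q = 2 * j" "Suc q \<le> 2 * J" using jn by (auto simp: q_def q0_def)
    have ends: "?t (q * N) = E (2 * j)" "?t (q * N + N) = E (2 * j + 1)"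
      using whole_block[OF q0(1) N_def, of q] q by auto
    have "Suc q * N \<le> 2 * J * N" using q by (intro mult_right_mono) auto
    then have qI: "q * N + p \<le> I" if "p \<le> N" for p using that by (simp add: I_def)
    have M: "code_lo r2 \<rho>2 (S j) \<le> S.M s q \<and> S.M s q \<le> code_hi r1 \<rho>1 R (S j)"
      using s jn unfolding S.reaches_def S'_def q_def by auto
    show "u i \<le> code_hi r1 \<rho>1 R (S j)" if "i \<le> I" "?t i \<in> {E (2 * j)..E (2 * j + 1)}" for i
    proof -
      have "q * N \<le> i" "i \<le> q * N + N"
        using that(2) t_less[of i "q * N"] t_less[of "q * N + N" i] unfolding ends[symmetric] by force+
      then have "u i \<le> S.M s q" using S.M_ge[of "i - q * N" s q] by (simp add: u_def)
      then show ?thesis using M by simp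
    qed
    obtain p where p: "p \<le> N" "S.u s (q * N + p) = S.M s q" using S.M_attained by blast
    show "\<exists>i\<le>I. ?t i \<in> {E (2 * j)..E (2 * j + 1)} \<and> code_lo r2 \<rho>2 (S j) \<le> u i"
    proof (intro exI[of _ "q * N + p"] conjI)
      show "q * N + p \<le> I" using qI p by simp
      show "?t (q * N + p) \<in> {E (2 * j)..E (2 * j + 1)}" unfolding ends[symmetric] using t_mono p by auto
      show "code_lo r2 \<rho>2 (S j) \<le> u (q * N + p)" using p M by (simp add: u_def)
    qed
  qed
  then show thesis by (rule that)
qed

end

section \<open>Entire solutions with a prescribed code\<close>

context thresholds
begin

lemma coded_solution:
  fixes S :: "int \<Rightarrow> nat"
  assumes S: "\<And>j. S j \<in> {0, 1, 2}" and nz: "S j0 \<noteq> 0"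
    and small: "0 < \<eta>" "\<And>s. 0 \<le> s \<Longrightarrow> s \<le> \<eta> \<Longrightarrow> g s \<le> s"
  shows "\<exists>U. caratheodory_solution (\<lambda>t x. H t * g x) U \<and> (\<forall>t. 0 < U t) \<and>
    (\<forall>j. code_lo r2 \<rho>2 (S j) \<le> max_on {E (2 * j)..E (2 * j + 1)} U \<and>
         max_on {E (2 * j)..E (2 * j + 1)} U \<le> code_hi r1 \<rho>1 R (S j))"
proof -
  have "\<forall>n. \<exists>I t u y. discrete_solution S n I t u y" using discrete_problem[where S = S, OF S] by metis
  then obtain I and t u y :: "nat \<Rightarrow> nat \<Rightarrow> real" where "\<And>n. discrete_solution S n (I n) (t n) (u n) (y n)" by metis
  note P = this[unfolded discrete_solution_def]
  have u_bds: "0 \<le> u n i" "u n i \<le> R" if "i \<le> I n" for n i using P[of n] that by auto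
  interpret K: kick_approximations t u y I "\<lambda>n. L / real (Suc n)" H g R
  proof
    show "(\<lambda>n. L / real (Suc n)) \<longlonglongrightarrow> 0" by (rule LIMSEQ_Suc[OF lim_const_over_n])
    show "\<bar>u n i\<bar> \<le> R" if "i \<le> I n" for n i using u_bds[OF that] by simp
  qed (use P h_int g_cont in auto)
  have yb: "\<bar>y n i\<bar> \<le> slope_bound" if "i < I n" for n i using P[of n] that by blast
  obtain U U' k where k: "strict_mono (k :: nat \<Rightarrow> nat)"
    and t_lim: "\<And>x. (\<lambda>n. t (k n) (next_index (t (k n)) x)) \<longlonglongrightarrow> x"
    and u_lim: "\<And>x. (\<lambda>n. u (k n) (next_index (t (k n)) x)) \<longlonglongrightarrow> U x"
    and unif: "\<And>A e. 0 < e \<Longrightarrow> \<exists>n0. \<forall>n\<ge>n0. \<forall>i\<le>I (k n). \<bar>t (k n) i\<bar> \<le> A \<longrightarrow> \<bar>u (k n) i - U (t (k n) i)\<bar> < e"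
    and U: "\<And>x. (U has_real_derivative U' x) (at x)"
    and U': "\<And>v w. v \<le> w \<Longrightarrow> U' w - U' v = - integral {v..w} (\<lambda>z. H z * g (U z))"
  proof (rule K.converges[of slope_bound])
    show "\<bar>y n i\<bar> \<le> slope_bound" if "i < I n" for n i by (rule yb[OF that])
  qed (rule that)
  have k_ge: "n \<le> k n" for n using seq_suble[OF k] .
  have idx: "\<forall>\<^sub>F n in sequentially. next_index (t (k n)) x \<le> I (k n)" for x
    using K.eventually_less[of x]
  proof eventually_elim
    case (elim n)
    then have "\<bar>x\<bar> < real (k n)" using k_ge[of n] by linarith
    then show ?case by (rule K.index(1))
  qed
  have nn: "0 \<le> U x" for x
    by (rule tendsto_lowerbound[OF u_lim]) (use idx[of x] in \<open>auto elim!: eventually_mono intro: u_bds\<close>)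
  have contU: "continuous_on A U" for A
    using U DERIV_isCont continuous_at_imp_continuous_on by blast
  have codes: "code_lo r2 \<rho>2 (S j) \<le> max_on {E (2 * j)..E (2 * j + 1)} U"
    "max_on {E (2 * j)..E (2 * j + 1)} U \<le> code_hi r1 \<rho>1 R (S j)" for j
  proof -
    define B where "B = {E (2 * j)..E (2 * j + 1)}"
    define A where "A = max \<bar>E (2 * j)\<bar> \<bar>E (2 * j + 1)\<bar>"
    have B_le: "E (2 * j) < E (2 * j + 1)" using len(1) len(2)[of "2 * j"] by linarith
    have bdd: "bdd_above (U ` B)"
      unfolding B_def by (intro bounded_imp_bdd_above compact_imp_bounded compact_continuous_image contU) auto
    obtain n1 :: nat where n1: "A \<le> real n1" using real_arch_simple by blast
    have inside: "- real (k n) \<le> E (2 * j) \<and> E (2 * j + 1) \<le> real (k n)" if "n \<ge> n1" for n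
    proof -
      have "A \<le> real (k n)" using n1 that k_ge[of n] by linarith
      then show ?thesis unfolding A_def by auto
    qed
    have absA: "\<bar>x\<bar> \<le> A" if "x \<in> B" for x using that unfolding A_def B_def by (auto simp: abs_le_iff max_def)
    \<comment> \<open>Grid points at which the lower bound holds stay in the block, and there the
      discrete positions are uniformly close to \<open>U\<close>; so they need not converge.\<close>
    show "code_lo r2 \<rho>2 (S j) \<le> max_on {E (2 * j)..E (2 * j + 1)} U"
    proof (rule field_le_epsilon)
      fix e :: real assume "0 < e"
      then obtain n0 where n0: "\<And>n i. n \<ge> n0 \<Longrightarrow> i \<le> I (k n) \<Longrightarrow> \<bar>t (k n) i\<bar> \<le> A \<Longrightarrow> \<bar>u (k n) i - U (t (k n) i)\<bar> < e"
        using unif by blast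
      define n where "n = max n0 n1"
      obtain i where i: "i \<le> I (k n)" "t (k n) i \<in> B" "code_lo r2 \<rho>2 (S j) \<le> u (k n) i"
      proof -
        have "- real (k n) \<le> E (2 * j) \<and> E (2 * j + 1) \<le> real (k n)" by (rule inside) (simp add: n_def)
        then have "\<exists>i\<le>I (k n). t (k n) i \<in> B \<and> code_lo r2 \<rho>2 (S j) \<le> u (k n) i"
          using P[of "k n"] unfolding B_def by blast
        then show thesis using that by blast
      qed
      have "\<bar>u (k n) i - U (t (k n) i)\<bar> < e" using n0[of n i] i absA by (simp add: n_def)
      moreover have "U (t (k n) i) \<le> max_on B U" unfolding max_on_def by (rule cSUP_upper[OF i(2) bdd])
      ultimately show "code_lo r2 \<rho>2 (S j) \<le> max_on {E (2 * j)..E (2 * j + 1)} U + e" using i unfolding B_def by linarith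
    qed
    \<comment> \<open>Rounding up to the grid could leave the block at its right end, so the upper
      bound is first shown for interior points and then extended to the closure by
      continuity.\<close>
    have inner: "U x \<le> code_hi r1 \<rho>1 R (S j)" if x: "x \<in> {E (2 * j)<..<E (2 * j + 1)}" for x
    proof (rule tendsto_upperbound[OF u_lim])
      have "\<forall>\<^sub>F n in sequentially. E (2 * j) < t (k n) (next_index (t (k n)) x)"
        "\<forall>\<^sub>F n in sequentially. t (k n) (next_index (t (k n)) x) < E (2 * j + 1)"
        using order_tendstoD[OF t_lim[of x]] x by auto
      then show "\<forall>\<^sub>F n in sequentially. u (k n) (next_index (t (k n)) x) \<le> code_hi r1 \<rho>1 R (S j)"
        using eventually_ge_at_top[of n1] idx[of x]
      proof eventually_elim
        case (elim n)
        then have "t (k n) (next_index (t (k n)) x) \<in> {E (2 * j)..E (2 * j + 1)}" by simp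
        then show ?case using P[of "k n"] inside[OF elim(3)] elim(4) by blast
      qed
    qed simp
    have outer: "U x \<le> code_hi r1 \<rho>1 R (S j)" if "x \<in> B" for x
    proof (rule continuous_le_on_closure[of "{E (2 * j)<..<E (2 * j + 1)}" U x])
      show "x \<in> closure {E (2 * j)<..<E (2 * j + 1)}" using that B_le by (simp add: B_def)
    qed (use contU inner in auto)
    show "max_on {E (2 * j)..E (2 * j + 1)} U \<le> code_hi r1 \<rho>1 R (S j)"
      unfolding max_on_def using outer B_le by (intro cSUP_least) (auto simp: B_def)
  qed
  \<comment> \<open>The limit could be the zero solution only if every code were 0: any other code
    forces a maximum of at least \<open>r2 > 0\<close> on its block.\<close>
  have "\<exists>x. U x \<noteq> 0"
  proof (rule ccontr)
    assume "\<not> ?thesis"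
    then have "max_on {E (2 * j0)..E (2 * j0 + 1)} U = (SUP x\<in>{E (2 * j0)..E (2 * j0 + 1)}. 0)"
      unfolding max_on_def by simp
    also have "\<dots> = 0" using len(1) len(2)[of "2 * j0"] by (intro cSUP_const) auto
    finally show False using codes(1)[of j0] nz order by (auto simp: code_lo_def split: if_splits)
  qed
  then obtain t1 where t1: "U t1 \<noteq> 0" by blast
  have pos: "0 < U x" for x
  proof (rule nonneg_solution_positive[OF U U' h_int g_cont small(1) _ nn t1])
    show "\<bar>g s\<bar> \<le> s" if "0 \<le> s" "s \<le> \<eta>" for s using small(2)[OF that] g_nonneg[of s] by simp
  qed
  have f_int: "(\<lambda>t. H t * g (U t)) absolutely_integrable_on {x..z}" for x z
    by (rule absolutely_integrable_mult_continuous[OF h_int])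
       (rule continuous_on_compose2[OF g_cont contU], auto)
  have "caratheodory_solution (\<lambda>t x. H t * g x) U"
    by (rule caratheodory_from_integral[where U = U and U' = U' and f = "\<lambda>t. H t * g (U t)"])
       (use U U' f_int in auto)
  then show ?thesis using pos codes by blast
qed

end

section \<open>Choice of the constants\<close>

definition has_code :: "real \<Rightarrow> real \<Rightarrow> real \<Rightarrow> nat \<Rightarrow> real \<Rightarrow> bool" where
  "has_code r \<rho> R k M \<longleftrightarrow> (k = 0 \<longrightarrow> M < r) \<and> (k = 1 \<longrightarrow> r < M \<and> M < \<rho>) \<and> (k = 2 \<longrightarrow> \<rho> < M \<and> M < R)"

definition (in sign_blocks) codable :: "(real \<Rightarrow> real) \<Rightarrow> real \<Rightarrow> real \<Rightarrow> real \<Rightarrow> real \<Rightarrow> real \<Rightarrow> (int \<Rightarrow> nat) \<Rightarrow> bool" where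
  "codable g lam \<mu> r \<rho> R S \<longleftrightarrow>
    (\<exists>u. caratheodory_solution (\<lambda>t x. (lam * pos_part a t - \<mu> * neg_part a t) * g x) u \<and> (\<forall>t. 0 < u t) \<and>
         (\<forall>j. has_code r \<rho> R (S j) (max_on {E (2 * j)..E (2 * j + 1)} u)))"

lemma (in sign_blocks) symbolic_dynamics:
  fixes g :: "real \<Rightarrow> real"
  assumes g_cont: "continuous_on {0..} g" and g_0: "g 0 = 0" and g_pos: "\<And>s. 0 < s \<Longrightarrow> 0 < g s"
    and g_lim_0: "((\<lambda>s. g s / s) \<longlongrightarrow> 0) (at_right 0)"
    and g_lim_infinity: "((\<lambda>s. g s / s) \<longlongrightarrow> 0) at_top"
    and \<rho>: "0 < \<rho>"
  shows "\<exists>lam0>0. \<forall>lam>lam0. \<exists>r R. 0 < r \<and> r < \<rho> \<and> \<rho> < R \<and>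
    (\<exists>\<mu>0>0. \<forall>\<mu>>\<mu>0. \<forall>S :: int \<Rightarrow> nat. (\<forall>j. S j \<in> {0, 1, 2}) \<and> (\<exists>j. S j \<noteq> 0) \<longrightarrow>
       codable g lam \<mu> r \<rho> R S)"
proof -
  \<comment> \<open>Extension by zero to the negative axis, continuous because
    \<open>g 0 = 0\<close>; it makes discrete solutions straight lines once they are
    negative.\<close>
  define G where "G x = g (max x 0)" for x
  have G: "continuous_on UNIV G"
    unfolding G_def by (rule continuous_on_compose2[OF g_cont]) (auto intro!: continuous_intros)
  have Gpos: "0 < G x" if "0 < x" for x using that g_pos by (simp add: G_def)
  have Gneg: "G x = 0" if "x \<le> 0" for x using that g_0 by (simp add: G_def max_def)
  have Gnn: "0 \<le> G x" for x using Gpos[of x] Gneg[of x] by (cases "x \<le> 0") auto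
  have Geq: "G x = g x" if "0 \<le> x" for x using that by (simp add: G_def)
  have small: "\<exists>\<eta>>0. \<forall>s. 0 \<le> s \<and> s \<le> \<eta> \<longrightarrow> G s \<le> \<kappa> * s" if \<kappa>: "0 < \<kappa>" for \<kappa>
  proof -
    have "\<forall>\<^sub>F s in at_right 0. g s / s < \<kappa>" using order_tendstoD(2)[OF g_lim_0 \<kappa>] .
    then obtain b where b: "b > 0" "\<And>s. 0 < s \<Longrightarrow> s < b \<Longrightarrow> g s / s < \<kappa>"
      unfolding eventually_at_right_field by auto
    have "G s \<le> \<kappa> * s" if "0 \<le> s" "s \<le> b / 2" for s
    proof (cases "s = 0")
      case False
      then show ?thesis using b(2)[of s] that b(1) Geq[of s] by (simp add: field_simps)
    qed (simp add: Gneg)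
    then show ?thesis using b(1) by (intro exI[of _ "b / 2"]) auto
  qed
  have L: "0 < L" using len(1) len(2)[of 0] len(3)[of 0] by linarith
  have A0: "0 \<le> A0" using mass[of 0] by linarith
  have cr: "0 < real c" using core by simp
  \<comment> \<open>The interval contains \<open>[X / c, X]\<close> for both fatal maxima
    \<open>X = \<rho> / 2\<close> and \<open>X = 2 * \<rho>\<close>. Then \<open>lam > lam0\<close>
    says \<open>4 * \<rho> < l / c * (lam * c0) * \<gamma>0\<close>, the condition of
    \<open>die\<close> for the larger of them; no other threshold enters.\<close>
  obtain \<gamma>0 where \<gamma>0: "0 < \<gamma>0" "\<And>x. \<rho> / 2 / real c \<le> x \<Longrightarrow> x \<le> 2 * \<rho> \<Longrightarrow> \<gamma>0 \<le> G x"
    using positive_min_on_interval[OF G Gpos, of "\<rho> / 2 / real c" "2 * \<rho>"] \<rho> cr by auto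
  define lam0 where "lam0 = 4 * \<rho> * real c / (l * c0 * \<gamma>0)"
  have lam0: "0 < lam0" unfolding lam0_def using \<rho> cr len(1) core \<gamma>0 by simp
  show ?thesis
  proof (rule exI[of _ lam0], intro conjI allI impI lam0)
    fix lam assume lam: "lam0 < lam"
    have lam_pos: "0 < lam" using lam lam0 by simp
    \<comment> \<open>The summand \<open>1\<close> makes the product with
      \<open>4 * L * (lam * A0)\<close> strictly smaller than \<open>1\<close>, including the case
      where that factor is \<open>0\<close>.\<close>
    define \<kappa> where "\<kappa> = 1 / (4 * L * (lam * A0) + 1)"
    have den: "0 < 4 * L * (lam * A0) + 1" using L lam_pos A0 by (simp add: add_nonneg_pos)
    have \<kappa>: "0 < \<kappa>" "4 * L * (lam * A0) * \<kappa> < 1" using den by (simp_all add: \<kappa>_def)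
    obtain \<eta> where \<eta>: "0 < \<eta>" "\<And>s. 0 \<le> s \<Longrightarrow> s \<le> \<eta> \<Longrightarrow> G s \<le> \<kappa> * s" using small[OF \<kappa>(1)] by blast
    obtain \<eta>' where \<eta>': "0 < \<eta>'" "\<And>s. 0 \<le> s \<Longrightarrow> s \<le> \<eta>' \<Longrightarrow> G s \<le> s" using small[of 1] by auto
    \<comment> \<open>Below \<open>\<eta>\<close> the estimate \<open>G s \<le> \<kappa> * s\<close>
      holds, so both \<open>r2 / 2\<close> and \<open>r2\<close> are maxima that pass; the second
      bound keeps \<open>r2\<close> below the lower fatal maximum \<open>\<rho> / 2\<close>.\<close>
    define r2 where "r2 = min \<eta> (\<rho> / 2)"
    have r2: "0 < r2" "r2 \<le> \<eta>" "r2 \<le> \<rho> / 2" using \<eta> \<rho> by (auto simp: r2_def)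
    have "\<forall>\<^sub>F s in at_top. g s / s < \<kappa>" using order_tendstoD(2)[OF g_lim_infinity \<kappa>(1)] .
    then obtain b where b: "\<And>s. b \<le> s \<Longrightarrow> g s / s < \<kappa>" unfolding eventually_at_top_linorder by blast
    obtain C where C: "\<And>s. 0 \<le> s \<Longrightarrow> s \<le> b \<Longrightarrow> G s \<le> C"
    proof -
      have "bounded (G ` {0..b})" by (intro compact_imp_bounded compact_continuous_image continuous_on_subset[OF G]) auto
      then obtain C where "\<forall>w\<in>G ` {0..b}. norm w \<le> C" using bounded_iff by metis
      then show thesis by (intro that[of C]) (auto simp: abs_le_iff)
    qed
    \<comment> \<open>Beyond \<open>b\<close> the growth condition at infinity gives
      \<open>G s \<le> \<kappa> * s \<le> \<kappa> * R\<close>; up to \<open>b\<close> the function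
      is bounded by \<open>C\<close>, which is at most \<open>\<kappa> * R\<close>.\<close>
    define R where "R = max (2 * \<rho>) (C / \<kappa>)"
    have "2 * \<rho> \<le> R" "C / \<kappa> \<le> R" unfolding R_def by auto
    then have R: "2 * \<rho> \<le> R" "C \<le> \<kappa> * R" "0 < R" using \<kappa> \<rho> by (auto simp: field_simps)
    have passR: "G x \<le> \<kappa> * R" if "x \<le> R" for x
    proof -
      consider "x \<le> 0" | "0 < x" "x \<le> b" | "0 < x" "b \<le> x" by linarith
      then show ?thesis
      proof cases
        case 1
        then show ?thesis using Gneg \<kappa> R by simp
      next
        case 2
        then show ?thesis using C[of x] R by simp
      next
        case 3
        then have "G x \<le> \<kappa> * x" using b[of x] Geq[of x] by (simp add: field_simps)
        also have "\<dots> \<le> \<kappa> * R" using that \<kappa> by (intro mult_left_mono) auto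
        finally show ?thesis .
      qed
    qed
    have pass_small: "G x \<le> \<kappa> * Q" if "x \<le> Q" "0 \<le> Q" "Q \<le> r2" for x Q
    proof (cases "x \<le> 0")
      case True
      then show ?thesis using Gneg \<kappa> that by simp
    next
      case False
      then have "G x \<le> \<kappa> * x" using \<eta> r2 that by (intro \<eta>(2)) auto
      also have "\<dots> \<le> \<kappa> * Q" using that \<kappa> by (intro mult_left_mono) auto
      finally show ?thesis .
    qed
    obtain \<gamma> where \<gamma>: "0 < \<gamma>" "\<And>x. r2 / 4 \<le> x \<Longrightarrow> x \<le> R \<Longrightarrow> \<gamma> \<le> G x"
      using positive_min_on_interval[OF G Gpos, of "r2 / 4" R] r2 by auto
    \<comment> \<open>Solved from the condition
      \<open>2 * R < l / c * (\<mu> * c0) * \<gamma>\<close> under which a negative block forces a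
      dip to \<open>\<delta> = r2 / 4\<close>.\<close>
    define \<mu>0 where "\<mu>0 = 2 * R * real c / (l * c0 * \<gamma>)"
    have \<mu>0: "0 < \<mu>0" unfolding \<mu>0_def using R cr len(1) core \<gamma> by simp
    show "\<exists>r R. 0 < r \<and> r < \<rho> \<and> \<rho> < R \<and>
      (\<exists>\<mu>0>0. \<forall>\<mu>>\<mu>0. \<forall>S :: int \<Rightarrow> nat. (\<forall>j. S j \<in> {0, 1, 2}) \<and> (\<exists>j. S j \<noteq> 0) \<longrightarrow>
       codable g lam \<mu> r \<rho> R S)"
    \<comment> \<open>The limit maxima satisfy only the weak bounds by \<open>r2 / 2\<close>,
      \<open>r2\<close>, \<open>\<rho> / 2\<close>, \<open>2 * \<rho>\<close> and \<open>R\<close>.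
      Therefore \<open>r\<close> is placed strictly between \<open>r2 / 2\<close> and
      \<open>r2\<close>, and the outer constant is \<open>R + 1\<close>.\<close>
    proof (rule exI[of _ "3 / 4 * r2"], rule exI[of _ "R + 1"], intro conjI, goal_cases)
      case 4
      show ?case
      proof (rule exI[of _ \<mu>0], intro conjI allI impI \<mu>0)
      fix \<mu> and S :: "int \<Rightarrow> nat"
      assume \<mu>: "\<mu>0 < \<mu>" and "(\<forall>j. S j \<in> {0, 1, 2}) \<and> (\<exists>j. S j \<noteq> 0)"
      then obtain j0 where S: "\<And>j. S j \<in> {0, 1, 2}" "S j0 \<noteq> 0" by blast
      interpret thresholds a E l L A0 c0 c G lam \<mu> \<kappa> \<gamma> "r2 / 4" "r2 / 2" r2 "\<rho> / 2" "2 * \<rho>" R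
      proof
        show "continuous_on UNIV G" "\<And>x. 0 \<le> G x" "\<And>x. x \<le> 0 \<Longrightarrow> G x = 0" by (fact G Gnn Gneg)+
        show "0 < lam" "0 < \<mu>" using lam_pos \<mu> \<mu>0 by auto
        show "0 < r2 / 4" "2 * (r2 / 4) \<le> r2 / 2" "r2 / 2 \<le> r2" "r2 \<le> \<rho> / 2" "\<rho> / 2 \<le> 2 * \<rho>" "2 * \<rho> \<le> R"
          using r2 \<rho> R by auto
        show "G x \<le> \<kappa> * Q" if "Q \<in> {r2 / 2, r2, R}" "x \<le> Q" for Q x
          using that passR[of x] pass_small[of x Q] r2 by auto
        show "0 \<le> \<kappa>" "4 * L * (lam * A0) * \<kappa> < 1" "0 \<le> \<gamma>" using \<kappa> \<gamma> by auto
        show "\<gamma> \<le> G x" if "r2 / 4 \<le> x" "x \<le> R" for x using \<gamma>(2) that by blast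
        show "2 * R < l / real c * (\<mu> * c0) * \<gamma>"
        proof -
          have "2 * R * real c < \<mu> * (l * c0 * \<gamma>)" using \<mu> len(1) core \<gamma> by (simp add: \<mu>0_def pos_divide_less_eq)
          then show ?thesis using cr by (simp add: field_simps)
        qed
        show "\<exists>\<gamma>\<ge>0. (\<forall>x. X / real c \<le> x \<and> x \<le> X \<longrightarrow> \<gamma> \<le> G x) \<and> 2 * X < l / real c * (lam * c0) * \<gamma>" if X: "X \<in> {\<rho> / 2, 2 * \<rho>}" for X
        proof (intro exI[of _ \<gamma>0] conjI allI impI)
          show "0 \<le> \<gamma>0" using \<gamma>0 by simp
          have X': "\<rho> / 2 \<le> X" "X \<le> 2 * \<rho>" using X \<rho> by auto
          show "\<gamma>0 \<le> G x" if "X / real c \<le> x \<and> x \<le> X" for x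
          proof (rule \<gamma>0(2))
            have "\<rho> / 2 / real c \<le> X / real c" using X' cr by (intro divide_right_mono) auto
            then show "\<rho> / 2 / real c \<le> x" using that by linarith
          qed (use that X' in linarith)
          have "4 * \<rho> * real c < lam * (l * c0 * \<gamma>0)" using lam len(1) core \<gamma>0 by (simp add: lam0_def pos_divide_less_eq)
          then have "4 * \<rho> < l / real c * (lam * c0) * \<gamma>0" using cr by (simp add: field_simps)
          then show "2 * X < l / real c * (lam * c0) * \<gamma>0" using X' by linarith
        qed
      qed
      obtain U where U: "caratheodory_solution (\<lambda>t x. H t * G x) U" "\<forall>t. 0 < U t"
        "\<And>j. code_lo r2 (2 * \<rho>) (S j) \<le> max_on {E (2 * j)..E (2 * j + 1)} U"
        "\<And>j. max_on {E (2 * j)..E (2 * j + 1)} U \<le> code_hi (r2 / 2) (\<rho> / 2) R (S j)"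
        using coded_solution[where S = S and \<eta> = \<eta>', OF S \<eta>'] by blast
      \<comment> \<open>\<open>caratheodory_solution\<close> evaluates the nonlinearity only along
        \<open>U\<close>, which is positive, so the extension \<open>G\<close> can be replaced by
        \<open>g\<close>.\<close>
      have eq: "H t * G (U t) = (lam * pos_part a t - \<mu> * neg_part a t) * g (U t)" for t
        using Geq[of "U t"] U(2) by (simp add: h_def less_imp_le)
      have car: "caratheodory_solution (\<lambda>t x. (lam * pos_part a t - \<mu> * neg_part a t) * g x) U"
        using U(1) unfolding caratheodory_solution_def eq .
      show "codable g lam \<mu> (3 / 4 * r2) \<rho> (R + 1) S"
        unfolding codable_def
      proof (intro exI[of _ U] conjI car U(2) allI)
        show "has_code (3 / 4 * r2) \<rho> (R + 1) (S j) (max_on {E (2 * j)..E (2 * j + 1)} U)" for j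
          using U(3)[of j] U(4)[of j] r2 \<rho> by (auto simp: has_code_def code_lo_def code_hi_def)
      qed
      qed
    qed (use r2 \<rho> R in auto)
  qed
qed

subsection \<open>The periodic weight\<close>

text \<open>The indefinite integral is continuous, so removing the fraction \<open>1 / c\<close> at
  both ends costs less than half of the positive total mass for large \<open>c\<close>. Validity for
  all large \<open>c\<close> allows one \<open>c\<close> for finitely many blocks.\<close>

lemma interior_mass:
  fixes f :: "real \<Rightarrow> real"
  assumes f: "f absolutely_integrable_on {x..z}" and xz: "x < z"
    and nn: "AE t in lebesgue. t \<in> {x..z} \<longrightarrow> 0 \<le> f t"
    and nz: "\<not> (AE t in lebesgue. t \<in> {x..z} \<longrightarrow> f t = 0)"
  shows "\<exists>c1 e. 0 < e \<and> (\<forall>c\<ge>c1. e \<le> integral {x + (z - x) / real c..z - (z - x) / real c} f)"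
proof -
  have fi: "f integrable_on {x..z}" using f set_lebesgue_integral_eq_integral(1) by blast
  have pos: "0 < integral {x..z} f"
  proof -
    define F where "F t = indicator {x..z} t *\<^sub>R f t" for t
    have F: "integrable lebesgue F" using f unfolding set_integrable_def F_def .
    have F0: "AE t in lebesgue. 0 \<le> F t"
      using nn by eventually_elim (auto simp: F_def indicator_def)
    have eq: "integral {x..z} f = integral\<^sup>L lebesgue F"
      using set_lebesgue_integral_eq_integral(2)[OF f] unfolding set_lebesgue_integral_def F_def by simp
    have "\<not> (AE t in lebesgue. F t = 0)"
    proof
      assume "AE t in lebesgue. F t = 0"
      then have "AE t in lebesgue. t \<in> {x..z} \<longrightarrow> f t = 0"
        by eventually_elim (auto simp: F_def)
      then show False using nz by blast
    qed
    then have "integral\<^sup>L lebesgue F \<noteq> 0" using integral_nonneg_eq_0_iff_AE[OF F F0] by blast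
    moreover have "0 \<le> integral\<^sup>L lebesgue F" by (rule integral_nonneg_AE[OF F0])
    ultimately show ?thesis unfolding eq by simp
  qed
  define P where "P t = integral {x..t} f" for t
  have Pc: "continuous_on {x..z} P" unfolding P_def by (rule indefinite_integral_continuous_1[OF fi])
  have c2: "\<forall>\<^sub>F c in sequentially. x + (z - x) / real c \<in> {x..z} \<and> z - (z - x) / real c \<in> {x..z} \<and>
      x + (z - x) / real c \<le> z - (z - x) / real c"
    using eventually_ge_at_top[of "2::nat"]
  proof eventually_elim
    case (elim c)
    define d where "d = (z - x) / real c"
    have "d \<le> (z - x) / 2" unfolding d_def using elim xz by (intro divide_left_mono) auto
    moreover have "0 \<le> d" unfolding d_def using xz by simp
    ultimately show ?case unfolding d_def[symmetric] using xz by (auto simp: field_simps)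
  qed
  have l0: "(\<lambda>c. (z - x) / real c) \<longlonglongrightarrow> 0" by (rule lim_const_over_n)
  have "(\<lambda>c. P (z - (z - x) / real c)) \<longlonglongrightarrow> P z"
    by (rule continuous_on_tendsto_compose[OF Pc])
       (use tendsto_diff[OF tendsto_const l0, of z] c2 xz in \<open>auto elim: eventually_mono\<close>)
  moreover have "(\<lambda>c. P (x + (z - x) / real c)) \<longlonglongrightarrow> P x"
    by (rule continuous_on_tendsto_compose[OF Pc])
       (use tendsto_add[OF tendsto_const l0, of x] c2 xz in \<open>auto elim: eventually_mono\<close>)
  ultimately have "(\<lambda>c. P (z - (z - x) / real c) - P (x + (z - x) / real c)) \<longlonglongrightarrow> P z - P x" by (rule tendsto_diff)
  moreover have "P z - P x = integral {x..z} f" by (simp add: P_def)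
  ultimately have "\<forall>\<^sub>F c in sequentially. integral {x..z} f / 2 < P (z - (z - x) / real c) - P (x + (z - x) / real c)"
    using pos by (intro order_tendstoD(1)) auto
  then have "\<forall>\<^sub>F c in sequentially. integral {x..z} f / 2 \<le> integral {x + (z - x) / real c..z - (z - x) / real c} f"
    using c2
  proof eventually_elim
    case (elim c)
    have "f integrable_on {x..z - (z - x) / real c}" using fi by (rule integrable_on_subinterval) (use elim in auto)
    then have "P (x + (z - x) / real c) + integral {x + (z - x) / real c..z - (z - x) / real c} f = P (z - (z - x) / real c)"
      unfolding P_def using elim by (intro Henstock_Kurzweil_Integration.integral_combine) auto
    then show ?case using elim by linarith
  qed
  then show ?thesis using pos unfolding eventually_sequentially by (metis half_gt_zero)
qed

lemma finite_uniform_lower_bound: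
  fixes F :: "'i \<Rightarrow> nat \<Rightarrow> real"
  assumes "finite A" "\<And>i. i \<in> A \<Longrightarrow> \<exists>c1 e. 0 < e \<and> (\<forall>c\<ge>c1. e \<le> F i c)"
  shows "\<exists>c1 e. 0 < e \<and> (\<forall>i\<in>A. \<forall>c\<ge>c1. e \<le> F i c)"
  using assms
proof (induction A rule: finite_induct)
  case empty
  show ?case by (intro exI[of _ 0] exI[of _ 1]) auto
next
  case (insert i A)
  then obtain c1 e where 1: "0 < e" "\<And>j c. j \<in> A \<Longrightarrow> c \<ge> c1 \<Longrightarrow> e \<le> F j c" by (metis insertCI)
  obtain c2 e' where 2: "0 < e'" "\<And>c. c \<ge> c2 \<Longrightarrow> e' \<le> F i c" using insert.prems[of i] by blast
  show ?case
  proof (rule exI[of _ "max c1 c2"], rule exI[of _ "min e e'"], intro conjI ballI allI impI)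
    show "0 < min e e'" using 1 2 by simp
    show "min e e' \<le> F j c" if "j \<in> insert i A" "max c1 c2 \<le> c" for j c
      using that 1(2)[of j c] 2(2)[of c] by (cases "j = i") (auto simp: min_le_iff_disj)
  qed
qed

lemma finite_bounds:
  fixes f :: "'i \<Rightarrow> real"
  assumes "finite A"
  obtains B where "\<And>i. i \<in> A \<Longrightarrow> f i \<le> B"
  using that[of "Max (f ` A)"] assms by simp

lemma finite_positive_lower_bound:
  fixes f :: "'i \<Rightarrow> real"
  assumes "finite A" "\<And>i. i \<in> A \<Longrightarrow> 0 < f i"
  obtains e where "0 < e" "\<And>i. i \<in> A \<Longrightarrow> e \<le> f i"
  using finite_uniform_lower_bound[of A "\<lambda>i _. f i"] assms by blast

text \<open>Every block is a translate of one of the \<open>2 * m\<close> blocks of one period, so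
  finite minima and maxima bound all lengths and masses, and a single \<open>c\<close> serves all
  cores. Numbering the block ends by the integers turns the pair of an index and a period into one
  position in the code.\<close>

theorem theorem6p4:
  fixes g a :: "real \<Rightarrow> real" and T :: real and m :: nat and \<sigma> \<tau> :: "nat \<Rightarrow> real"
  assumes g_cont: "continuous_on {0..} g"
    and g_nonneg: "\<And>s. 0 \<le> s \<Longrightarrow> 0 \<le> g s"
    and g_0: "g 0 = 0"
    and g_pos: "\<And>s. 0 < s \<Longrightarrow> 0 < g s"
    and g_lim_0: "((\<lambda>s. g s / s) \<longlongrightarrow> 0) (at_right 0)"
    and g_lim_infinity: "((\<lambda>s. g s / s) \<longlongrightarrow> 0) at_top"
    and a_locint: "locally_integrable a"
    and a_period: "has_minimal_period a T"
    and m: "1 \<le> m"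
    and \<sigma>_less_\<tau>: "\<And>i. i \<in> {1..m} \<Longrightarrow> \<sigma> i < \<tau> i"
    and \<tau>_less_\<sigma>: "\<And>i. i \<in> {1..m} \<Longrightarrow> \<tau> i < \<sigma> (i + 1)"
    and \<sigma>_T: "\<sigma> (m + 1) - \<sigma> 1 = T"
    and a_pos: "\<And>i. i \<in> {1..m} \<Longrightarrow> pos_on a {\<sigma> i..\<tau> i}"
    and a_neg: "\<And>i. i \<in> {1..m} \<Longrightarrow> neg_on a {\<tau> i..\<sigma> (i + 1)}"
  shows "\<forall>\<rho>>0. \<exists>lam0>0. \<forall>lam>lam0. \<exists>r R. 0 < r \<and> r < \<rho> \<and> \<rho> < R \<and>
    (\<exists>\<mu>0>0. \<forall>\<mu>>\<mu>0. \<forall>S :: int \<Rightarrow> nat.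
       (\<forall>j. S j \<in> {0, 1, 2}) \<and> (\<exists>j. S j \<noteq> 0) \<longrightarrow>
       (\<exists>u :: real \<Rightarrow> real.
          caratheodory_solution (\<lambda>t x. (lam * pos_part a t - \<mu> * neg_part a t) * g x) u \<and>
          (\<forall>t. 0 < u t) \<and>
          (\<forall>i\<in>{1..m}. \<forall>l :: int.
             let I = {\<sigma> i + of_int l * T..\<tau> i + of_int l * T};
                 j = int i + l * int m
             in (S j = 0 \<longrightarrow> max_on I u < r) \<and>
                (S j = 1 \<longrightarrow> r < max_on I u \<and> max_on I u < \<rho>) \<and>
                (S j = 2 \<longrightarrow> \<rho> < max_on I u \<and> max_on I u < R))))"
proof -
  have a_int: "a absolutely_integrable_on {x..z}" for x z
    using a_locint unfolding locally_integrable_def by blast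
  have na_int: "(\<lambda>t. - a t) absolutely_integrable_on {x..z}" for x z
    using absolutely_integrable_mult_continuous[OF a_int, of x z "\<lambda>_. - 1"] by simp
  have per1: "a (t + T) = a t" for t using a_period unfolding has_minimal_period_def by blast
  have per_nat: "a (t + real n * T) = a t" for t n
  proof (induction n)
    case (Suc n)
    then show ?case using per1[of "t + real n * T"] by (simp add: algebra_simps)
  qed simp
  have per: "a (t + of_int k * T) = a t" for t and k :: int
  proof (cases "0 \<le> k")
    case True
    then show ?thesis using per_nat[of t "nat k"] by simp
  next
    case False
    then show ?thesis using per_nat[of "t + of_int k * T" "nat (- k)"] by (simp add: algebra_simps)
  qed
  have shift: "integral {x + of_int k * T..z + of_int k * T} a = integral {x..z} a" for x z and k :: int
    using integral_shift_cbox_plus[of x z a "of_int k * T"] per[of _ k] by (simp add: o_def add.commute)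
  have shift_neg: "negligible {t \<in> {x + of_int k * T..z + of_int k * T}. Q (a t)}"
    if "negligible {t \<in> {x..z}. Q (a t)}" for x z Q and k :: int
  proof -
    have "{t \<in> {x + of_int k * T..z + of_int k * T}. Q (a t)} \<subseteq> (+) (of_int k * T) ` {t \<in> {x..z}. Q (a t)}"
    proof
      fix t assume t: "t \<in> {t \<in> {x + of_int k * T..z + of_int k * T}. Q (a t)}"
      then have "t - of_int k * T \<in> {t \<in> {x..z}. Q (a t)}" using per[of "t - of_int k * T" k] by auto
      then show "t \<in> (+) (of_int k * T) ` {t \<in> {x..z}. Q (a t)}" by (intro image_eqI[of _ _ "t - of_int k * T"]) auto
    qed
    then show ?thesis using negligible_subset negligible_translation[OF that, of "of_int k * T"] by blast
  qed
  have AE_neg: "negligible {t \<in> X. \<not> Q t}" if ae: "AE t in lebesgue. t \<in> X \<longrightarrow> Q t" for X :: "real set" and Q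
  proof -
    obtain N where N: "N \<in> null_sets lebesgue" "{t \<in> space lebesgue. \<not> (t \<in> X \<longrightarrow> Q t)} \<subseteq> N"
      using ae unfolding eventually_ae_filter by blast
    then have "{t \<in> X. \<not> Q t} \<subseteq> N" by auto
    then show ?thesis using N negligible_iff_null_sets negligible_subset by blast
  qed
  have neg_even: "negligible {t \<in> {\<sigma> i..\<tau> i}. a t < 0}" if "i \<in> {1..m}" for i
    using AE_neg[of "{\<sigma> i..\<tau> i}" "\<lambda>t. 0 \<le> a t"] a_pos[OF that] unfolding pos_on_def by (simp add: not_le)
  have neg_odd: "negligible {t \<in> {\<tau> i..\<sigma> (i + 1)}. 0 < a t}" if "i \<in> {1..m}" for i
    using AE_neg[of "{\<tau> i..\<sigma> (i + 1)}" "\<lambda>t. 0 \<le> - a t"] a_neg[OF that] unfolding neg_on_def pos_on_def by (simp add: not_le)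
  let ?A = "{1..m}"
  obtain c1 e1 where e1: "0 < e1" "\<And>i c. i \<in> ?A \<Longrightarrow> c \<ge> c1 \<Longrightarrow>
      e1 \<le> integral {\<sigma> i + (\<tau> i - \<sigma> i) / real c..\<tau> i - (\<tau> i - \<sigma> i) / real c} a"
  proof -
    have "\<exists>c1 e. 0 < e \<and> (\<forall>c\<ge>c1. e \<le> integral {\<sigma> i + (\<tau> i - \<sigma> i) / real c..\<tau> i - (\<tau> i - \<sigma> i) / real c} a)" if "i \<in> ?A" for i
      by (rule interior_mass[OF a_int \<sigma>_less_\<tau>[OF that]]) (use a_pos[OF that] in \<open>simp_all add: pos_on_def\<close>)
    then have "\<exists>c1 e. 0 < e \<and> (\<forall>i\<in>?A. \<forall>c\<ge>c1. e \<le> integral {\<sigma> i + (\<tau> i - \<sigma> i) / real c..\<tau> i - (\<tau> i - \<sigma> i) / real c} a)"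
      by (intro finite_uniform_lower_bound) auto
    then show thesis using that by blast
  qed
  obtain c2 e2 where e2: "0 < e2" "\<And>i c. i \<in> ?A \<Longrightarrow> c \<ge> c2 \<Longrightarrow>
      e2 \<le> integral {\<tau> i + (\<sigma> (i + 1) - \<tau> i) / real c..\<sigma> (i + 1) - (\<sigma> (i + 1) - \<tau> i) / real c} (\<lambda>t. - a t)"
  proof -
    have "\<exists>c1 e. 0 < e \<and> (\<forall>c\<ge>c1. e \<le> integral {\<tau> i + (\<sigma> (i + 1) - \<tau> i) / real c..\<sigma> (i + 1) - (\<sigma> (i + 1) - \<tau> i) / real c} (\<lambda>t. - a t))"
      if "i \<in> ?A" for i
      by (rule interior_mass[OF na_int \<tau>_less_\<sigma>[OF that]]) (use a_neg[OF that] in \<open>simp_all add: neg_on_def pos_on_def\<close>)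
    then have "\<exists>c1 e. 0 < e \<and> (\<forall>i\<in>?A. \<forall>c\<ge>c1. e \<le> integral {\<tau> i + (\<sigma> (i + 1) - \<tau> i) / real c..\<sigma> (i + 1) - (\<sigma> (i + 1) - \<tau> i) / real c} (\<lambda>t. - a t))"
      by (intro finite_uniform_lower_bound) auto
    then show thesis using that by blast
  qed
  define c where "c = max 2 (max c1 c2)"
  define c0 where "c0 = min e1 e2"
  obtain l1 where l1: "0 < l1" "\<And>i. i \<in> ?A \<Longrightarrow> l1 \<le> \<tau> i - \<sigma> i"
    using finite_positive_lower_bound[of ?A "\<lambda>i. \<tau> i - \<sigma> i"] \<sigma>_less_\<tau> by auto
  obtain l2 where l2: "0 < l2" "\<And>i. i \<in> ?A \<Longrightarrow> l2 \<le> \<sigma> (i + 1) - \<tau> i"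
    using finite_positive_lower_bound[of ?A "\<lambda>i. \<sigma> (i + 1) - \<tau> i"] \<tau>_less_\<sigma> by auto
  obtain L1 where L1: "\<And>i. i \<in> ?A \<Longrightarrow> \<tau> i - \<sigma> i \<le> L1" using finite_bounds[of ?A "\<lambda>i. \<tau> i - \<sigma> i"] by auto
  obtain L2 where L2: "\<And>i. i \<in> ?A \<Longrightarrow> \<sigma> (i + 1) - \<tau> i \<le> L2" using finite_bounds[of ?A "\<lambda>i. \<sigma> (i + 1) - \<tau> i"] by auto
  obtain A1 where A1: "\<And>i. i \<in> ?A \<Longrightarrow> \<bar>integral {\<sigma> i..\<tau> i} a\<bar> \<le> A1"
    using finite_bounds[of ?A "\<lambda>i. \<bar>integral {\<sigma> i..\<tau> i} a\<bar>"] by auto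
  obtain A2 where A2: "\<And>i. i \<in> ?A \<Longrightarrow> \<bar>integral {\<tau> i..\<sigma> (i + 1)} a\<bar> \<le> A2"
    using finite_bounds[of ?A "\<lambda>i. \<bar>integral {\<tau> i..\<sigma> (i + 1)} a\<bar>"] by auto
  \<comment> \<open>\<open>j = i + k * m\<close> with \<open>i\<close> in \<open>{1..m}\<close>; as
    \<open>i\<close> starts at \<open>1\<close>, division with remainder is applied to
    \<open>j - 1\<close> and \<open>1\<close> is added back to the remainder.\<close>
  define idx :: "int \<Rightarrow> nat" where "idx j = nat ((j - 1) mod int m) + 1" for j
  define per_no :: "int \<Rightarrow> int" where "per_no j = (j - 1) div int m" for j
  define E where "E q = (if even q then \<sigma> (idx (q div 2)) else \<tau> (idx (q div 2))) + of_int (per_no (q div 2)) * T" for q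
  have idx: "idx j \<in> ?A" for j
  proof -
    have "nat ((j - 1) mod int m) < m" using m by (simp add: nat_less_iff)
    then show ?thesis by (simp add: idx_def)
  qed
  have idx_eq: "idx (int i + k * int m) = i" "per_no (int i + k * int m) = k" if "i \<in> ?A" for i k
  proof -
    have *: "int i + k * int m - 1 = (int i - 1) + k * int m" "0 \<le> int i - 1" "int i - 1 < int m" using that by auto
    show "idx (int i + k * int m) = i" unfolding idx_def *(1) using * that by (simp add: mod_pos_pos_trivial)
    show "per_no (int i + k * int m) = k" unfolding per_no_def *(1) using * by (simp add: div_pos_pos_trivial)
  qed
  have decomp: "j = int (idx j) + per_no j * int m" for j
    using idx[of j] m mod_div_mult_eq[of "j - 1" "int m"] pos_mod_sign[of "int m" "j - 1"] by (simp add: idx_def per_no_def algebra_simps)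
  have E_even: "E (2 * j) = \<sigma> (idx j) + of_int (per_no j) * T" and E_odd: "E (2 * j + 1) = \<tau> (idx j) + of_int (per_no j) * T" for j
    by (simp_all add: E_def)
  \<comment> \<open>After the last block of a period the index returns to \<open>1\<close> and the
    period number grows by one; the two expressions agree because
    \<open>\<sigma> (m + 1) = \<sigma> 1 + T\<close>.\<close>
  have E_next: "E (2 * j + 2) = \<sigma> (idx j + 1) + of_int (per_no j) * T" for j
  proof (cases "idx j = m")
    case True
    have j1: "j + 1 = int 1 + (per_no j + 1) * int m" using decomp[of j] True by (simp add: algebra_simps)
    have "1 \<in> ?A" using m by simp
    then have "idx (j + 1) = 1" "per_no (j + 1) = per_no j + 1" using idx_eq[of 1 "per_no j + 1", folded j1] by blast+
    then show ?thesis using E_even[of "j + 1"] True \<sigma>_T by (simp add: algebra_simps)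
  next
    case False
    then have "idx j + 1 \<in> ?A" using idx[of j] by auto
    moreover have j1: "j + 1 = int (idx j + 1) + per_no j * int m" using decomp[of j] by simp
    ultimately have "idx (j + 1) = idx j + 1" "per_no (j + 1) = per_no j"
      using idx_eq[of "idx j + 1" "per_no j", folded j1] by blast+
    then show ?thesis using E_even[of "j + 1"] by simp
  qed
  have blocks: "(even q \<and> E q = \<sigma> i + of_int k * T \<and> E (q + 1) = \<tau> i + of_int k * T) \<or>
      (odd q \<and> E q = \<tau> i + of_int k * T \<and> E (q + 1) = \<sigma> (i + 1) + of_int k * T)"
    if "i = idx (q div 2)" "k = per_no (q div 2)" for q i k
  proof (cases "even q")
    case True
    then obtain j where "q = 2 * j" by blast
    then show ?thesis using that E_even[of j] E_odd[of j] by simp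
  next
    case False
    then obtain j where j: "q = 2 * j + 1" by (rule oddE)
    then have "q div 2 = j" by simp
    then show ?thesis using that E_odd[of j] E_next[of j] j by (simp add: add.assoc)
  qed
  interpret sign_blocks a E "min l1 l2" "max L1 L2" "max A1 A2" c0 c
  proof
    show "a absolutely_integrable_on {x..z}" for x z by (rule a_int)
    show "0 < min l1 l2" "2 \<le> c" "0 < c0" using l1 l2 e1 e2 by (auto simp: c_def c0_def)
    fix q
    define i where "i = idx (q div 2)"
    define k where "k = per_no (q div 2)"
    have i: "i \<in> ?A" using idx by (simp add: i_def)
    note bl = blocks[OF i_def k_def]
    show "min l1 l2 \<le> E (q + 1) - E q" using bl l1(2)[OF i] l2(2)[OF i] by auto
    show "E (q + 1) - E q \<le> max L1 L2" using bl L1[OF i] L2[OF i] by auto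
    show "negligible {t \<in> {E q..E (q + 1)}. a t < 0}" if "even q"
      using bl that shift_neg[OF neg_even[OF i], of k] by auto
    show "negligible {t \<in> {E q..E (q + 1)}. 0 < a t}" if "odd q"
      using bl that shift_neg[OF neg_odd[OF i], of k] by auto
    show "\<bar>integral {E q..E (q + 1)} a\<bar> \<le> max A1 A2"
      using bl A1[OF i] A2[OF i] shift[of "\<sigma> i" k "\<tau> i"] shift[of "\<tau> i" k "\<sigma> (i + 1)"] by auto
    have sh: "integral {x + of_int k * T + d..z + of_int k * T - d} a = integral {x + d..z - d} a" for x z d
      using shift[of "x + d" k "z - d"] by (simp add: algebra_simps)
    have cc: "c1 \<le> c" "c2 \<le> c" by (auto simp: c_def)
    show "c0 \<le> \<bar>integral {E q + (E (q + 1) - E q) / real c..E (q + 1) - (E (q + 1) - E q) / real c} a\<bar>"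
    proof (cases "even q")
      case True
      then have "E q = \<sigma> i + of_int k * T" "E (q + 1) = \<tau> i + of_int k * T" using bl by auto
      then show ?thesis using e1(2)[OF i cc(1)] by (simp add: sh c0_def)
    next
      case False
      then have "E q = \<tau> i + of_int k * T" "E (q + 1) = \<sigma> (i + 1) + of_int k * T" using bl by auto
      then show ?thesis using e2(2)[OF i cc(2)] by (simp add: sh c0_def)
    qed
  qed
  have E_index: "E (2 * (int i + k * int m)) = \<sigma> i + of_int k * T" "E (2 * (int i + k * int m) + 1) = \<tau> i + of_int k * T"
    if "i \<in> ?A" for i k
    using that by (simp_all only: E_even E_odd idx_eq)
  show ?thesis
  proof (intro allI impI, goal_cases)
    case (1 \<rho>)
    obtain lam0 where lam0: "0 < lam0" and main: "\<And>lam. lam0 < lam \<Longrightarrow> \<exists>r R. 0 < r \<and> r < \<rho> \<and> \<rho> < R \<and>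
      (\<exists>\<mu>0>0. \<forall>\<mu>>\<mu>0. \<forall>S. (\<forall>j. S j \<in> {0, 1, 2}) \<and> (\<exists>j. S j \<noteq> 0) \<longrightarrow> codable g lam \<mu> r \<rho> R S)"
      using symbolic_dynamics[OF g_cont g_0 g_pos g_lim_0 g_lim_infinity 1] by blast
    show ?case
    proof (rule exI[of _ lam0], intro conjI lam0 allI impI, goal_cases)
      case (1 lam)
      from main[OF 1] obtain r R \<mu>0 where r: "0 < r" "r < \<rho>" "\<rho> < R" and \<mu>0: "0 < \<mu>0"
        and sol: "\<And>\<mu> S. \<mu>0 < \<mu> \<Longrightarrow> (\<forall>j. S j \<in> {0, 1, 2}) \<and> (\<exists>j. S j \<noteq> 0) \<Longrightarrow> codable g lam \<mu> r \<rho> R S"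
        by blast
      show ?case
      proof (rule exI[of _ r], rule exI[of _ R], intro conjI r, rule exI[of _ \<mu>0], intro conjI \<mu>0 allI impI, goal_cases)
        case (1 \<mu> S)
        from sol[OF 1] obtain u where u: "caratheodory_solution (\<lambda>t x. (lam * pos_part a t - \<mu> * neg_part a t) * g x) u" "\<forall>t. 0 < u t"
          and code: "\<And>j. has_code r \<rho> R (S j) (max_on {E (2 * j)..E (2 * j + 1)} u)"
          unfolding codable_def by blast
        show ?case
        proof (rule exI[of _ u], intro conjI u ballI allI, goal_cases)
          case (1 i k)
          show ?case
            using code[of "int i + k * int m"] unfolding Let_def has_code_def E_index[OF 1] .
        qed
      qed
    qed
  qed
qed

end
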